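(* Consider the model problem, the discretization and the S-AFEM algorithm described in the context. Assume that the solver is uniformly contractive: there is a constant $0<q_{\rm alg}<1$, independent of $\mathcal{T}_H\in\mathbb{T}$, with $|||u_H^\star-\Phi_H(v_H)|||\le q_{\rm alg}\,|||u_H^\star-v_H|||$ for all $\mathcal{T}_H\in\mathbb{T}$, $v_H\in\mathcal{X}_H$. Assume that the smoother is uniformly stable with constant at most one: there is a constant $0<C_{\rm alg}\le 1$, independent of $\mathcal{T}_H\in\mathbb{T}$, with $|||u_H^\star-\Psi_H(v_H)|||\le C_{\rm alg}\,|||u_H^\star-v_H|||$ for all $\mathcal{T}_H\in\mathbb{T}$, $v_H\in\mathcal{X}_H$. Let $K,L\in\mathbb{N}$, $C_{\rm mark},C_{\rm card}\ge 1$, $\lambda>0$, $u_0^0\in\mathcal{X}_0$, and $0<\theta\le 1$ be arbitrary. Then the S-AFEM algorithm guarantees full R-linear convergence of the quasi-error $$\mathrm{H}_\ell^k := |||u_\ell^\star-u_\ell^k|||+\eta_\ell(u_\ell^\star),$$ i.e., there exist constants $C_{\rm lin}>0$ and $0<q_{\rm lin}<1$ such that $$\mathrm{H}_\ell^k\le C_{\rm lin}\,q_{\rm lin}^{|\ell,k|-|\ell',k'|}\,\mathrm{H}_{\ell'}^{k'}\quad\text{for all }(\ell',k'),(\ell,k)\in\mathcal{Q}\text{ with }|\ell',k'|\le|\ell,k|.$$ The constants $C_{\rm lin},q_{\rm lin}$ depend only on $K,L,\lambda,\theta,q_{\rm alg}$, and the constants in (A1)--(A4) and (QM). Specifically, the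 constants $C_{\rm lin},q_{\rm lin}$ grow at most linearly in $K$ and at most exponentially in $L$.
   Context: Model problem. $\Omega\subset\mathbb{R}^d$, $d\ge1$, is a bounded polyhedral Lipschitz domain with an initial conforming triangulation $\mathcal{T}_0$ into compact simplices. On each $T\in\mathcal{T}_0$, $\boldsymbol{A}\in W^{1,\infty}(T;\mathbb{R}^{d\times d}_{\rm sym})$ and $\boldsymbol{f}\in W^{1,\infty}(T;\mathbb{R}^d)$; moreover $\boldsymbol{b}\in L^\infty(\Omega;\mathbb{R}^d)$, $c\in L^\infty(\Omega)$, $f\in L^2(\Omega)$. Let $b(v,w):=\langle \boldsymbol{A}\nabla v,\nabla w\rangle_{L^2(\Omega)}+\langle \boldsymbol{b}\cdot\nabla v+cv,w\rangle_{L^2(\Omega)}$ and assume there are $C_{\rm ell},C_{\rm bnd}>0$ with $C_{\rm ell}\|v\|_{H^1(\Omega)}^2\le b(v,v)$ and $b(v,w)\le C_{\rm bnd}\|v\|_{H^1(\Omega)}\|w\|_{H^1(\Omega)}$ for all $v,w\in H_0^1(\Omega)$. Let $F(v):=\langle f,v\rangle_{L^2(\Omega)}+\langle\boldsymbol{f},\nabla v\rangle_{L^2(\Omega)}$, and let $u^\star\in H_0^1(\Omega)$ be the unique solution of $b(u^\star,v)=F(v)$ for all $v\in H_0^1(\Omega)$. The energy norm is $|||v|||:=b(v,v)^{1/2}$, which is induced by the scalar product $a(v,w):=[b(v,w)+b(w,v)]/2$. Meshes and discretization. Refinement is newest-vertex bisection (NVB), which yields uniformly shape-regular conforming meshes.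 For a conforming triangulation $\mathcal{T}_H$ and $\mathcal{M}_H\subseteq\mathcal{T}_H$, $\mathrm{refine}(\mathcal{T}_H,\mathcal{M}_H)$ is the coarsest conforming NVB refinement of $\mathcal{T}_H$ in which at least all elements of $\mathcal{M}_H$ are refined; $\mathrm{refine}(\mathcal{T}_H)$ is the set of all conforming triangulations obtainable from $\mathcal{T}_H$ by finitely many NVB refinements; $\mathbb{T}:=\mathrm{refine}(\mathcal{T}_0)$. Fix $p\in\mathbb{N}=\{1,2,\dots\}$. For $\mathcal{T}_H\in\mathbb{T}$, $\mathcal{X}_H$ is the space of all $v_H\in H_0^1(\Omega)$ that are on each $T\in\mathcal{T}_H$ polynomials of total degree $\le p$, and $u_H^\star\in\mathcal{X}_H$ is the unique solution of $b(u_H^\star,v_H)=F(v_H)$ for all $v_H\in\mathcal{X}_H$. Quantities attached to a mesh $\mathcal{T}_\ell$ carry the index $\ell$. Estimator. For $T\in\mathcal{T}_H$, $v_H\in\mathcal{X}_H$, $\eta_H(T,v_H)^2:=|T|^{2/d}\|-\mathrm{div}(\boldsymbol{A}\nabla v_H-\boldsymbol{f})+\boldsymbol{b}\cdot\nabla v_H+cv_H-f\|_{L^2(T)}^2+|T|^{1/d}\|[\![(\boldsymbol{A}\nabla v_H-\boldsymbol{f})\cdot\boldsymbol{n}]\!]\|_{L^2(\partial T\cap\Omega)}^2$ with $\boldsymbol{n}$ the outer unit normal on $\partial T$ and $[\![\cdot]\!]$ the jump across $(d-1)$-dimensional hyperfaces; $\eta_H(\mathcal{U}_H,v_H):=(\sum_{T\in\mathcal{U}_H}\eta_H(T,v_H)^2)^{1/2}$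 for $\mathcal{U}_H\subseteq\mathcal{T}_H$, $\eta_H(v_H):=\eta_H(\mathcal{T}_H,v_H)$. It is known that there are constants $C_{\rm stab},C_{\rm rel}>0$, $0<q_{\rm red}<1$, $C_{\rm mon}\ge1$ such that for all $\mathcal{T}_H\in\mathbb{T}$, $\mathcal{T}_h\in\mathrm{refine}(\mathcal{T}_H)$, $\mathcal{U}_H\subseteq\mathcal{T}_H\cap\mathcal{T}_h$, $v_H\in\mathcal{X}_H$, $v_h\in\mathcal{X}_h$: (A1) $|\eta_h(\mathcal{U}_H,v_h)-\eta_H(\mathcal{U}_H,v_H)|\le C_{\rm stab}|||v_h-v_H|||$; (A2) $\eta_h(\mathcal{T}_h\setminus\mathcal{T}_H,v_H)\le q_{\rm red}\,\eta_H(\mathcal{T}_H\setminus\mathcal{T}_h,v_H)$; (A3) $|||u^\star-u_H^\star|||\le C_{\rm rel}\,\eta_H(u_H^\star)$; (QM) $\eta_h(u_h^\star)\le C_{\rm mon}\,\eta_H(u_H^\star)$. Moreover, there are $C_{\rm orth}>0$, $0<\delta\le1$, depending only on $C_{\rm bnd},C_{\rm ell}$, such that for nested finite-dimensional spaces $\mathcal{X}_\ell\subseteq\mathcal{X}_{\ell+1}\subseteq H_0^1(\Omega)$ with Galerkin solutions $u_\ell^\star$: (A4) $\sum_{\ell'=\ell}^{\ell+N}|||u_{\ell'+1}^\star-u_{\ell'}^\star|||^2\le C_{\rm orth}(N+1)^{1-\delta}|||u^\star-u_\ell^\star|||^2$ for all $\ell,N\in\mathbb{N}_0$. S-AFEM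 algorithm. For every $\mathcal{T}_H\in\mathbb{T}$ let $\Phi_H:\mathcal{X}_H\to\mathcal{X}_H$ (one step of the solver) and $\Psi_H:\mathcal{X}_H\to\mathcal{X}_H$ (one step of the smoother) be given. Let $L\mathbb{N}_0:=\{jL: j\in\mathbb{N}_0\}$. Input: $\mathcal{T}_0$, $K,L\in\mathbb{N}$, $0<\theta\le1$, $C_{\rm mark},C_{\rm card}\ge1$, $\lambda>0$, $u_0^0\in\mathcal{X}_0$. For $\ell=0,1,2,\dots$: (I) If $\ell\in L\mathbb{N}_0$ (solve level): for $k=1,2,3,\dots$ compute $u_\ell^k:=\Phi_\ell(u_\ell^{k-1})$ and $\eta_\ell(T,u_\ell^k)$ for all $T\in\mathcal{T}_\ell$, until $|||u_\ell^k-u_\ell^{k-1}|||\le\lambda\,\eta_\ell(u_\ell^k)$; then set $\underline{k}[\ell]:=k$. (II) If $\ell\notin L\mathbb{N}_0$ (intermediate level): for $k=1,\dots,K$ compute $u_\ell^k:=\Psi_\ell(u_\ell^{k-1})$; set $\underline{k}[\ell]:=K$ and compute $\eta_\ell(T,u_\ell^{\underline{k}[\ell]})$ for all $T\in\mathcal{T}_\ell$. (III) Determine $\widetilde{\mathcal{M}}_\ell\subseteq\mathcal{T}_\ell$ with, up to the factor $C_{\rm mark}$, minimal cardinality among all sets satisfying the Dörfler criterion $\theta\,\eta_\ell(u_\ell^{\underline{k}[\ell]})^2\le\eta_\ell(\widetilde{\mathcal{M}}_\ell,u_\ell^{\underline{k}[\ell]})^2$. (IV) Select $\mathcal{M}_\ell\subseteq\widetilde{\mathcal{M}}_\ell$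 with $\mathcal{M}_\ell=\widetilde{\mathcal{M}}_\ell$ if $\ell\in L\mathbb{N}_0$, and $\#\mathcal{M}_\ell\le C_{\rm card}\,\#\mathcal{M}_{\ell-1}$ otherwise. (V) Set $\mathcal{T}_{\ell+1}:=\mathrm{refine}(\mathcal{T}_\ell,\mathcal{M}_\ell)$ and $u_{\ell+1}^0:=u_\ell^{\underline{k}[\ell]}$. Indices. $\mathcal{Q}$ is the set of all $(\ell,k)\in\mathbb{N}_0^2$ such that $u_\ell^k$ is defined by the algorithm, ordered by $(\ell',k')\le(\ell,k)$ iff $u_{\ell'}^{k'}$ is defined not later than $u_\ell^k$; $|\ell,k|:=\#\{(\ell',k')\in\mathcal{Q}:(\ell',k')<(\ell,k)\}$. It is allowed that the solver loop on some solve level never terminates; then that level is the last one and $\mathcal{Q}$ contains all $(\ell,k)$, $k\in\mathbb{N}_0$, for this last $\ell$. *)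

theory Defs
  imports "HOL-Analysis.Analysis" "HOL-Library.Extended_Nat"
begin

section \<open>Lebesgue and Sobolev spaces\<close>

text \<open>
  Elements of the function spaces are represented by total functions on the whole space;
  only their restriction to the set in question matters, and only up to null sets.
\<close>

definition L2_space :: "(real^'n) set \<Rightarrow> (real^'n \<Rightarrow> 'b::euclidean_space) set" where
  "L2_space S = {f. f \<in> borel_measurable (lebesgue_on S) \<and>
                    integrable (lebesgue_on S) (\<lambda>x. (norm (f x))\<^sup>2)}"

definition L2_norm_on :: "(real^'n) set \<Rightarrow> (real^'n \<Rightarrow> 'b::euclidean_space) \<Rightarrow> real" where
  "L2_norm_on S f = sqrt (\<integral>x. (norm (f x))\<^sup>2 \<partial>lebesgue_on S)"

definition Linf_space :: "(real^'n) set \<Rightarrow> (real^'n \<Rightarrow> 'b::euclidean_space) set" where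
  "Linf_space S = {f. f \<in> borel_measurable (lebesgue_on S) \<and>
                      (\<exists>B. AE x in lebesgue_on S. norm (f x) \<le> B)}"

primrec Ck :: "nat \<Rightarrow> (real^'n \<Rightarrow> real) \<Rightarrow> bool" where
  "Ck 0 f \<longleftrightarrow> continuous_on UNIV f"
| "Ck (Suc k) f \<longleftrightarrow> (\<exists>g. (\<forall>x. GDERIV f x :> g x) \<and> (\<forall>i. Ck k (\<lambda>x. g x $ i)))"

text \<open>Smooth functions with compact support in the open set \<open>U\<close>, extended by zero.\<close>
definition test_fun :: "(real^'n) set \<Rightarrow> (real^'n \<Rightarrow> real) \<Rightarrow> bool" where
  "test_fun U \<phi> \<longleftrightarrow> (\<forall>k. Ck k \<phi>) \<and> compact (closure {x. \<phi> x \<noteq> 0}) \<and> closure {x. \<phi> x \<noteq> 0} \<subseteq> U"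

definition has_weak_grad ::
  "(real^'n) set \<Rightarrow> (real^'n \<Rightarrow> real) \<Rightarrow> (real^'n \<Rightarrow> real^'n) \<Rightarrow> bool" where
  "has_weak_grad U v g \<longleftrightarrow>
     (\<forall>\<phi> d\<phi>. test_fun U \<phi> \<longrightarrow> (\<forall>x. GDERIV \<phi> x :> d\<phi> x) \<longrightarrow>
        (\<integral>x. v x *\<^sub>R d\<phi> x \<partial>lebesgue_on U) = - (\<integral>x. \<phi> x *\<^sub>R g x \<partial>lebesgue_on U))"

definition has_weak_div ::
  "(real^'n) set \<Rightarrow> (real^'n \<Rightarrow> real^'n) \<Rightarrow> (real^'n \<Rightarrow> real) \<Rightarrow> bool" where
  "has_weak_div U \<sigma> g \<longleftrightarrow>
     (\<forall>\<phi> d\<phi>. test_fun U \<phi> \<longrightarrow> (\<forall>x. GDERIV \<phi> x :> d\<phi> x) \<longrightarrow>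
        (\<integral>x. \<sigma> x \<bullet> d\<phi> x \<partial>lebesgue_on U) = - (\<integral>x. g x * \<phi> x \<partial>lebesgue_on U))"

text \<open>Weak gradient and divergence are unique up to null sets; a representative is chosen.\<close>
definition weak_grad :: "(real^'n) set \<Rightarrow> (real^'n \<Rightarrow> real) \<Rightarrow> real^'n \<Rightarrow> real^'n" where
  "weak_grad U v = (SOME g. g \<in> L2_space U \<and> has_weak_grad U v g)"

definition weak_div :: "(real^'n) set \<Rightarrow> (real^'n \<Rightarrow> real^'n) \<Rightarrow> real^'n \<Rightarrow> real" where
  "weak_div U \<sigma> = (SOME g. g \<in> L2_space U \<and> has_weak_div U \<sigma> g)"

definition W1inf_space :: "(real^'n) set \<Rightarrow> (real^'n \<Rightarrow> real) set" where
  "W1inf_space U = {v \<in> Linf_space U. \<exists>g \<in> Linf_space U. has_weak_grad U v g}"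

definition H1_space :: "(real^'n) set \<Rightarrow> (real^'n \<Rightarrow> real) set" where
  "H1_space U = {v \<in> L2_space U. \<exists>g \<in> L2_space U. has_weak_grad U v g}"

definition H1_norm :: "(real^'n) set \<Rightarrow> (real^'n \<Rightarrow> real) \<Rightarrow> real" where
  "H1_norm U v = sqrt ((L2_norm_on U v)\<^sup>2 + (L2_norm_on U (weak_grad U v))\<^sup>2)"

definition H10_space :: "(real^'n) set \<Rightarrow> (real^'n \<Rightarrow> real) set" where
  "H10_space U = {v \<in> H1_space U. \<forall>\<epsilon>>0. \<exists>\<phi>. test_fun U \<phi> \<and> H1_norm U (\<lambda>x. v x - \<phi> x) < \<epsilon>}"


section \<open>Polyhedral Lipschitz domains\<close>

definition lipschitz_boundary :: "(real^'n) set \<Rightarrow> bool" where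
  "lipschitz_boundary U \<longleftrightarrow>
     (\<forall>x \<in> frontier U. \<exists>e \<phi> C r. norm e = 1 \<and> r > 0 \<and> C-lipschitz_on {z. z \<bullet> e = 0} \<phi> \<and>
        (\<forall>y \<in> ball x r. y \<in> U \<longleftrightarrow> \<phi> (y - (y \<bullet> e) *\<^sub>R e) < y \<bullet> e))"

definition polyhedral_lipschitz_domain :: "(real^'n) set \<Rightarrow> bool" where
  "polyhedral_lipschitz_domain U \<longleftrightarrow>
     open U \<and> connected U \<and> U \<noteq> {} \<and> bounded U \<and> lipschitz_boundary U \<and>
     (\<exists>F. finite F \<and> (\<forall>S\<in>F. polytope S) \<and> closure U = \<Union>F)"


section \<open>Newest-vertex bisection\<close>

text \<open>
  A tagged simplex in the sense of Maubach, Traxler and Stevenson: the ordered list of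
  vertices \<open>x\<^sub>0, \<dots>, x\<^sub>d\<close> together with its type \<open>\<gamma> \<in> {0..<d}\<close>. Its refinement edge is the
  segment from \<open>x\<^sub>0\<close> to \<open>x\<^sub>d\<close>. Descendants of the same initial triangulation coincide as
  tagged simplices iff they coincide as sets, so set operations on meshes are those of the
  underlying simplices.
\<close>
type_synonym 'n tsimplex = "(real^'n) list \<times> nat"
type_synonym 'n mesh = "'n tsimplex set"

definition elem :: "'n::finite tsimplex \<Rightarrow> (real^'n) set" where
  "elem T = convex hull set (fst T)"

definition tsimplex :: "'n::finite tsimplex \<Rightarrow> bool" where
  "tsimplex T \<longleftrightarrow> length (fst T) = CARD('n) + 1 \<and> distinct (fst T) \<and>
     \<not> affine_dependent (set (fst T)) \<and> snd T < CARD('n)"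

text \<open>
  With \<open>m\<close> the midpoint of the refinement edge, the children of \<open>(x\<^sub>0, \<dots>, x\<^sub>d)\<close> of type \<open>\<gamma>\<close> are
  \<open>(x\<^sub>0, m, x\<^sub>1, \<dots>, x\<^sub>\<gamma>, x\<^sub>\<gamma>\<^sub>+\<^sub>1, \<dots>, x\<^sub>d\<^sub>-\<^sub>1)\<close> and \<open>(x\<^sub>d, m, x\<^sub>1, \<dots>, x\<^sub>\<gamma>, x\<^sub>d\<^sub>-\<^sub>1, \<dots>, x\<^sub>\<gamma>\<^sub>+\<^sub>1)\<close>,
  both of type \<open>\<gamma> + 1\<close> modulo \<open>d\<close>. For \<open>d = 2\<close>, the refinement edge of a child is opposite to
  the new vertex for either type.
\<close>
definition children :: "'n::finite tsimplex \<Rightarrow> 'n mesh" where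
  "children T =
     (let vs = fst T; \<gamma> = snd T; m = midpoint (hd vs) (last vs); inner = butlast (tl vs);
          \<gamma>' = Suc \<gamma> mod CARD('n)
      in {(hd vs # m # inner, \<gamma>'),
          (last vs # m # take \<gamma> inner @ rev (drop \<gamma> inner), \<gamma>')})"

definition bisects :: "'n::finite mesh \<Rightarrow> 'n mesh \<Rightarrow> bool" where
  "bisects M M' \<longleftrightarrow> (\<exists>T\<in>M. M' = (M - {T}) \<union> children T)"

definition conforming :: "(real^'n) set \<Rightarrow> 'n mesh \<Rightarrow> bool" where
  "conforming U M \<longleftrightarrow> finite M \<and> (\<forall>T\<in>M. tsimplex T) \<and> inj_on elem M \<and>
     triangulation (elem ` M) \<and> \<Union>(elem ` M) = closure U"

definition refinements :: "(real^'n) set \<Rightarrow> 'n mesh \<Rightarrow> 'n mesh set" where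
  "refinements U M = {M'. bisects\<^sup>*\<^sup>* M M' \<and> conforming U M'}"

text \<open>\<open>M'\<close> is the coarsest conforming refinement of \<open>M\<close> in which all elements of \<open>R\<close> are refined.\<close>
definition is_refine :: "(real^'n) set \<Rightarrow> 'n mesh \<Rightarrow> 'n mesh \<Rightarrow> 'n mesh \<Rightarrow> bool" where
  "is_refine U M R M' \<longleftrightarrow> M' \<in> refinements U M \<and> R \<inter> M' = {} \<and>
     (\<forall>M'' \<in> refinements U M. R \<inter> M'' = {} \<longrightarrow> M'' \<in> refinements U M')"


section \<open>Model problem\<close>

record ('n::finite) problem =
  dom :: "(real^'n) set"
  T0 :: "'n mesh"
  matA :: "real^'n \<Rightarrow> real^'n^'n"
  vecf :: "real^'n \<Rightarrow> real^'n"
  vecb :: "real^'n \<Rightarrow> real^'n"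
  coefc :: "real^'n \<Rightarrow> real"
  rhs :: "real^'n \<Rightarrow> real"

abbreviation H10 :: "'n::finite problem \<Rightarrow> (real^'n \<Rightarrow> real) set" where
  "H10 P \<equiv> H10_space (dom P)"

abbreviation grad :: "'n::finite problem \<Rightarrow> (real^'n \<Rightarrow> real) \<Rightarrow> real^'n \<Rightarrow> real^'n" where
  "grad P v \<equiv> weak_grad (dom P) v"

definition bform :: "'n::finite problem \<Rightarrow> (real^'n \<Rightarrow> real) \<Rightarrow> (real^'n \<Rightarrow> real) \<Rightarrow> real" where
  "bform P v w =
     (\<integral>x. (matA P x *v grad P v x) \<bullet> grad P w x \<partial>lebesgue_on (dom P)) +
     (\<integral>x. (vecb P x \<bullet> grad P v x + coefc P x * v x) * w x \<partial>lebesgue_on (dom P))"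

definition Ffun :: "'n::finite problem \<Rightarrow> (real^'n \<Rightarrow> real) \<Rightarrow> real" where
  "Ffun P v = (\<integral>x. rhs P x * v x \<partial>lebesgue_on (dom P)) +
              (\<integral>x. vecf P x \<bullet> grad P v x \<partial>lebesgue_on (dom P))"

definition model_problem :: "'n::finite problem \<Rightarrow> bool" where
  "model_problem P \<longleftrightarrow>
     polyhedral_lipschitz_domain (dom P) \<and> conforming (dom P) (T0 P) \<and>
     (\<forall>T \<in> T0 P.
        (\<forall>i j. (\<lambda>x. matA P x $ i $ j) \<in> W1inf_space (interior (elem T))) \<and>
        (AE x in lebesgue_on (elem T). transpose (matA P x) = matA P x) \<and>
        (\<forall>i. (\<lambda>x. vecf P x $ i) \<in> W1inf_space (interior (elem T)))) \<and>
     vecb P \<in> Linf_space (dom P) \<and> coefc P \<in> Linf_space (dom P) \<and> rhs P \<in> L2_space (dom P) \<and>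
     (\<exists>Cell>0. \<forall>v \<in> H10 P. Cell * (H1_norm (dom P) v)\<^sup>2 \<le> bform P v v) \<and>
     (\<exists>Cbnd>0. \<forall>v \<in> H10 P. \<forall>w \<in> H10 P.
        bform P v w \<le> Cbnd * H1_norm (dom P) v * H1_norm (dom P) w)"

definition enorm :: "'n::finite problem \<Rightarrow> (real^'n \<Rightarrow> real) \<Rightarrow> real" where
  "enorm P v = sqrt (bform P v v)"

abbreviation edist :: "'n::finite problem \<Rightarrow> (real^'n \<Rightarrow> real) \<Rightarrow> (real^'n \<Rightarrow> real) \<Rightarrow> real" where
  "edist P v w \<equiv> enorm P (\<lambda>x. v x - w x)"

text \<open>For \<open>V = H10 P\<close> this is the weak formulation, for subspaces it is the Galerkin one.\<close>
definition solves_on ::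
  "'n::finite problem \<Rightarrow> (real^'n \<Rightarrow> real) set \<Rightarrow> (real^'n \<Rightarrow> real) \<Rightarrow> bool" where
  "solves_on P V u \<longleftrightarrow> u \<in> V \<and> (\<forall>v\<in>V. bform P u v = Ffun P v)"


section \<open>Discretization\<close>

definition poly_deg_le :: "nat \<Rightarrow> (real^'n \<Rightarrow> real) \<Rightarrow> bool" where
  "poly_deg_le p q \<longleftrightarrow>
     (\<exists>c. \<forall>x. q x = (\<Sum>\<alpha> | sum \<alpha> (UNIV :: 'n set) \<le> p. c \<alpha> * (\<Prod>i\<in>UNIV. (x $ i) ^ \<alpha> i)))"

definition meshes :: "'n::finite problem \<Rightarrow> 'n mesh set" where
  "meshes P = refinements (dom P) (T0 P)"

definition fe_space :: "'n::finite problem \<Rightarrow> nat \<Rightarrow> 'n mesh \<Rightarrow> (real^'n \<Rightarrow> real) set" where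
  "fe_space P p M =
     {v \<in> H10 P. \<forall>T\<in>M. \<exists>q. poly_deg_le p q \<and> (AE x in lebesgue_on (elem T). v x = q x)}"


section \<open>Residual error estimator\<close>

definition flux :: "'n::finite problem \<Rightarrow> (real^'n \<Rightarrow> real) \<Rightarrow> real^'n \<Rightarrow> real^'n" where
  "flux P v x = matA P x *v grad P v x - vecf P x"

text \<open>
  On each element the flux of a discrete function is \<open>W\<^sup>1\<^sup>,\<^sup>\<infinity>\<close> and hence has a unique continuous
  representative up to the boundary, whose boundary values are the trace.
\<close>
definition elem_trace ::
  "'n::finite tsimplex \<Rightarrow> (real^'n \<Rightarrow> real^'n) \<Rightarrow> real^'n \<Rightarrow> real^'n" where
  "elem_trace T \<sigma> =
     (SOME g. continuous_on (elem T) g \<and> (AE x in lebesgue_on (elem T). g x = \<sigma> x))"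

definition outer_normal :: "(real^'n) set \<Rightarrow> (real^'n) set \<Rightarrow> real^'n" where
  "outer_normal S F = (SOME n. norm n = 1 \<and> (\<forall>x\<in>F. \<forall>y\<in>S. n \<bullet> (y - x) \<le> 0))"

text \<open>
  Integral over a subset \<open>F\<close> of a hyperplane with unit normal \<open>n\<close> with respect to the
  \<open>(d-1)\<close>-dimensional surface measure, expressed by Fubini as a Lebesgue integral over the prism
  of height one erected on \<open>F\<close>; \<open>closest_point (affine hull F)\<close> projects the prism back onto \<open>F\<close>.
  In dimension one this is evaluation at a point.
\<close>
definition facet_integral :: "(real^'n) set \<Rightarrow> real^'n \<Rightarrow> (real^'n \<Rightarrow> real) \<Rightarrow> real" where
  "facet_integral F n g =
     (\<integral>x. g (closest_point (affine hull F) x)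
        \<partial>lebesgue_on {y + t *\<^sub>R n | y t. y \<in> F \<and> 0 \<le> t \<and> t \<le> 1})"

text \<open>
  Up to sets of surface measure zero, the part of the boundary of \<open>T\<close> inside the domain is the
  union of the facets that \<open>T\<close> shares with another element.
\<close>
definition eta_sq :: "'n::finite problem \<Rightarrow> 'n mesh \<Rightarrow> 'n tsimplex \<Rightarrow> (real^'n \<Rightarrow> real) \<Rightarrow> real" where
  "eta_sq P M T v =
     measure lebesgue (elem T) powr (2 / real CARD('n)) *
       (L2_norm_on (elem T) (\<lambda>x. - weak_div (interior (elem T)) (flux P v) x
            + vecb P x \<bullet> grad P v x + coefc P x * v x - rhs P x))\<^sup>2
     + measure lebesgue (elem T) powr (1 / real CARD('n)) *
       (\<Sum>T' | T' \<in> M \<and> (elem T \<inter> elem T') facet_of elem T.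
          let F = elem T \<inter> elem T'; n = outer_normal (elem T) F
          in facet_integral F n
               (\<lambda>x. ((elem_trace T (flux P v) x - elem_trace T' (flux P v) x) \<bullet> n)\<^sup>2))"

text \<open>\<open>eta P M U v\<close> is \<open>\<eta>\<^sub>M(U, v)\<close> for \<open>U \<subseteq> M\<close>; the mesh \<open>M\<close> enters via the jumps.\<close>
definition eta :: "'n::finite problem \<Rightarrow> 'n mesh \<Rightarrow> 'n mesh \<Rightarrow> (real^'n \<Rightarrow> real) \<Rightarrow> real" where
  "eta P M U v = sqrt (\<Sum>T\<in>U. eta_sq P M T v)"


section \<open>Properties of the estimator and quasi-orthogonality\<close>

definition stability :: "'n::finite problem \<Rightarrow> nat \<Rightarrow> real \<Rightarrow> bool" where
  "stability P p C \<longleftrightarrow>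
     (\<forall>M \<in> meshes P. \<forall>M' \<in> refinements (dom P) M. \<forall>U. U \<subseteq> M \<inter> M' \<longrightarrow>
        (\<forall>v \<in> fe_space P p M. \<forall>v' \<in> fe_space P p M'.
           \<bar>eta P M' U v' - eta P M U v\<bar> \<le> C * edist P v' v))"

definition reduction :: "'n::finite problem \<Rightarrow> nat \<Rightarrow> real \<Rightarrow> bool" where
  "reduction P p q \<longleftrightarrow>
     (\<forall>M \<in> meshes P. \<forall>M' \<in> refinements (dom P) M. \<forall>v \<in> fe_space P p M.
        eta P M' (M' - M) v \<le> q * eta P M (M - M') v)"

definition reliability ::
  "'n::finite problem \<Rightarrow> (real^'n \<Rightarrow> real) \<Rightarrow> ('n mesh \<Rightarrow> real^'n \<Rightarrow> real) \<Rightarrow> real \<Rightarrow> bool" where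
  "reliability P us ud C \<longleftrightarrow> (\<forall>M \<in> meshes P. edist P us (ud M) \<le> C * eta P M M (ud M))"

definition quasi_monotonicity ::
  "'n::finite problem \<Rightarrow> ('n mesh \<Rightarrow> real^'n \<Rightarrow> real) \<Rightarrow> real \<Rightarrow> bool" where
  "quasi_monotonicity P ud C \<longleftrightarrow>
     (\<forall>M \<in> meshes P. \<forall>M' \<in> refinements (dom P) M.
        eta P M' M' (ud M') \<le> C * eta P M M (ud M))"

text \<open>A linear space that is finite-dimensional after identifying functions equal a.e. on \<open>U\<close>.\<close>
definition fin_dim_space :: "(real^'n) set \<Rightarrow> (real^'n \<Rightarrow> real) set \<Rightarrow> bool" where
  "fin_dim_space U V \<longleftrightarrow>
     (\<lambda>x. 0) \<in> V \<and> (\<forall>v\<in>V. \<forall>w\<in>V. (\<lambda>x. v x + w x) \<in> V) \<and> (\<forall>a. \<forall>v\<in>V. (\<lambda>x. a * v x) \<in> V) \<and>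
     (\<exists>B. finite B \<and> B \<subseteq> V \<and>
        (\<forall>v\<in>V. \<exists>c. AE x in lebesgue_on U. v x = (\<Sum>\<beta>\<in>B. c \<beta> * \<beta> x)))"

definition quasi_orthogonality ::
  "'n::finite problem \<Rightarrow> (real^'n \<Rightarrow> real) \<Rightarrow> real \<Rightarrow> real \<Rightarrow> bool" where
  "quasi_orthogonality P us C \<delta> \<longleftrightarrow>
     (\<forall>V w. (\<forall>l::nat. fin_dim_space (dom P) (V l) \<and> V l \<subseteq> V (Suc l) \<and> V l \<subseteq> H10 P \<and>
                 solves_on P (V l) (w l)) \<longrightarrow>
        (\<forall>l N. (\<Sum>l' = l..l + N. (edist P (w (Suc l')) (w l'))\<^sup>2)
                  \<le> C * real (N + 1) powr (1 - \<delta>) * (edist P us (w l))\<^sup>2))"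


section \<open>The S-AFEM algorithm\<close>

text \<open>
  The output of one run. \<open>last_it R l\<close> is the final index \<open>k\<close> on level \<open>l\<close>, with value \<open>\<infinity>\<close> if the
  solver loop does not terminate. Entries for levels that are not reached, and iterates beyond the
  final index, are meaningless.
\<close>
record ('n::finite) safem_run =
  mesh :: "nat \<Rightarrow> 'n mesh"
  iter :: "nat \<Rightarrow> nat \<Rightarrow> real^'n \<Rightarrow> real"
  last_it :: "nat \<Rightarrow> enat"
  min_marked :: "nat \<Rightarrow> 'n mesh"
  marked :: "nat \<Rightarrow> 'n mesh"

definition reached :: "'n::finite safem_run \<Rightarrow> nat \<Rightarrow> bool" where
  "reached R l \<longleftrightarrow> (\<forall>j<l. last_it R j \<noteq> \<infinity>)"

definition doerfler ::
  "'n::finite problem \<Rightarrow> real \<Rightarrow> 'n mesh \<Rightarrow> (real^'n \<Rightarrow> real) \<Rightarrow> 'n mesh \<Rightarrow> bool" where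
  "doerfler P \<theta> M v U \<longleftrightarrow> U \<subseteq> M \<and> \<theta> * (eta P M M v)\<^sup>2 \<le> (eta P M U v)\<^sup>2"

text \<open>
  In the solve step, \<open>k\<close> ranges over all computed steps, and the stopping criterion holds exactly
  for the last one (for none of them if the loop does not terminate).
\<close>
definition solve_step ::
  "'n::finite problem \<Rightarrow> ('n mesh \<Rightarrow> (real^'n \<Rightarrow> real) \<Rightarrow> real^'n \<Rightarrow> real) \<Rightarrow> real \<Rightarrow>
   'n safem_run \<Rightarrow> nat \<Rightarrow> bool" where
  "solve_step P \<Phi> lam R l \<longleftrightarrow>
     last_it R l \<ge> 1 \<and>
     (\<forall>k\<ge>1. enat k \<le> last_it R l \<longrightarrow>
        iter R l k = \<Phi> (mesh R l) (iter R l (k - 1)) \<and>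
        (edist P (iter R l k) (iter R l (k - 1)) \<le> lam * eta P (mesh R l) (mesh R l) (iter R l k)
           \<longleftrightarrow> enat k = last_it R l))"

definition smooth_step ::
  "('n::finite mesh \<Rightarrow> (real^'n \<Rightarrow> real) \<Rightarrow> real^'n \<Rightarrow> real) \<Rightarrow> nat \<Rightarrow>
   'n safem_run \<Rightarrow> nat \<Rightarrow> bool" where
  "smooth_step \<Psi> K R l \<longleftrightarrow>
     last_it R l = enat K \<and> (\<forall>k\<in>{1..K}. iter R l k = \<Psi> (mesh R l) (iter R l (k - 1)))"

definition mark_refine_step ::
  "'n::finite problem \<Rightarrow> nat \<Rightarrow> real \<Rightarrow> real \<Rightarrow> real \<Rightarrow> 'n safem_run \<Rightarrow> nat \<Rightarrow> nat \<Rightarrow> bool" where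
  "mark_refine_step P L \<theta> Cmark Ccard R l k \<longleftrightarrow>
     doerfler P \<theta> (mesh R l) (iter R l k) (min_marked R l) \<and>
     (\<forall>U. doerfler P \<theta> (mesh R l) (iter R l k) U \<longrightarrow>
        real (card (min_marked R l)) \<le> Cmark * real (card U)) \<and>
     marked R l \<subseteq> min_marked R l \<and>
     (if L dvd l then marked R l = min_marked R l
      else real (card (marked R l)) \<le> Ccard * real (card (marked R (l - 1)))) \<and>
     is_refine (dom P) (mesh R l) (marked R l) (mesh R (Suc l)) \<and>
     iter R (Suc l) 0 = iter R l k"

definition safem ::
  "'n::finite problem \<Rightarrow>
   ('n mesh \<Rightarrow> (real^'n \<Rightarrow> real) \<Rightarrow> real^'n \<Rightarrow> real) \<Rightarrow>
   ('n mesh \<Rightarrow> (real^'n \<Rightarrow> real) \<Rightarrow> real^'n \<Rightarrow> real) \<Rightarrow>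
   nat \<Rightarrow> nat \<Rightarrow> real \<Rightarrow> real \<Rightarrow> real \<Rightarrow> real \<Rightarrow> (real^'n \<Rightarrow> real) \<Rightarrow> 'n safem_run \<Rightarrow> bool" where
  "safem P \<Phi> \<Psi> K L \<theta> Cmark Ccard lam u00 R \<longleftrightarrow>
     mesh R 0 = T0 P \<and> iter R 0 0 = u00 \<and>
     (\<forall>l. reached R l \<longrightarrow>
        (if L dvd l then solve_step P \<Phi> lam R l else smooth_step \<Psi> K R l) \<and>
        (\<forall>k. last_it R l = enat k \<longrightarrow> mark_refine_step P L \<theta> Cmark Ccard R l k))"

definition Qset :: "'n::finite safem_run \<Rightarrow> (nat \<times> nat) set" where
  "Qset R = {(l, k). reached R l \<and> enat k \<le> last_it R l}"

text \<open>The iterates are computed in lexicographic order of \<open>(l, k)\<close>.\<close>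
definition step_index :: "'n::finite safem_run \<Rightarrow> nat \<Rightarrow> nat \<Rightarrow> nat" where
  "step_index R l k = card {(l', k') \<in> Qset R. l' < l \<or> (l' = l \<and> k' < k)}"

definition quasi_error ::
  "'n::finite problem \<Rightarrow> ('n mesh \<Rightarrow> real^'n \<Rightarrow> real) \<Rightarrow> 'n safem_run \<Rightarrow> nat \<Rightarrow> nat \<Rightarrow> real" where
  "quasi_error P ud R l k =
     edist P (ud (mesh R l)) (iter R l k) + eta P (mesh R l) (mesh R l) (ud (mesh R l))"

end

theory Submission
  imports Defs
begin

text \<open>
  Write \<open>d\<^sub>l\<close> for the energy distance of the discrete solutions on the levels \<open>l\<close> and \<open>l + 1\<close>.
  On a solve level, Doerfler marking contracts the estimator of the exact discrete solution up to
  the algebraic error and \<open>d\<^sub>l\<close>; on an intermediate level it grows by at most a multiple of \<open>d\<^sub>l\<close>.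
  The algebraic error contracts at least once per solve level and never grows by smoothing. Hence a
  weighted quasi-error \<open>Y\<^sub>j\<close> at the start of the \<open>j\<close>-th solve level satisfies
  \<open>Y\<^sub>j\<^sub>+\<^sub>1 \<le> \<rho> Y\<^sub>j + C S\<^sub>j\<close> with \<open>\<rho> < 1\<close> and \<open>S\<^sub>j\<close> the sum of the \<open>d\<^sub>l\<close> up to the next solve level.
  By the Cauchy-Schwarz inequality, quasi-orthogonality and reliability, \<open>S\<^sub>j + \<dots> + S\<^sub>j\<^sub>+\<^sub>n\<^sub>-\<^sub>1\<close> is
  bounded by a multiple of \<open>(nL)\<^sup>1\<^sup>-\<^sup>\<delta>\<^sup>/\<^sup>2 Y\<^sub>j\<close>. As this is sublinear in \<open>n\<close>, some \<open>Y\<^sub>i\<close> with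
  \<open>j < i \<le> j + N\<close> is at most \<open>Y\<^sub>j / 2\<close>, where \<open>N\<close> is polynomial in \<open>L\<close>, and so the tail sums of
  \<open>Y\<close> are bounded by \<open>N Y\<^sub>j\<close>.

  Within a solve level the quasi-error decays geometrically until the stopping criterion is met,
  since the estimator is dominated by the algebraic error as long as it fails; an intermediate level
  has only \<open>K\<close> steps. Consequently the sum of the quasi-errors over all later steps is at most \<open>A\<close>
  times the current one, with \<open>A\<close> linear in \<open>K\<close> and polynomial in \<open>L\<close>, and these sums therefore
  contract by the factor \<open>1 - 1/A\<close> in every step.
\<close>

section \<open>The fundamental lemma of the calculus of variations\<close>

text \<open>The abstract argument uses the energy distance only through nonnegativity, symmetry and
  the triangle inequality, but these are not free: \<open>weak_grad\<close> picks an arbitrary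
  representative, so it is linear only almost everywhere, and only because weak gradients are
  unique. That uniqueness is the fundamental lemma, which is derived here from smooth cut-offs of
  boxes. As the bilinear form is not symmetric, the triangle inequality comes from Cauchy-Schwarz
  for its symmetric part. Quasi-orthogonality asks for nested finite-dimensional spaces, so both
  properties are proved for \<open>fe_space\<close>.

  The bound on sums of \<open>d\<^sub>l\<close> grows with the number of levels, so summing the
  perturbed contraction does not bound the tails of \<open>Y\<close> at once; it is only
  sublinearity that allows an \<open>N\<close> for which \<open>N\<close> consecutive values have
  average at most half the current one. As a solver loop may run forever, a run is always cut at the
  later of the two compared steps, and no constant depends on the cut.\<close>

lemma integral_boxes_zero_imp_AE_zero:
  fixes f :: "'a::euclidean_space \<Rightarrow> real"
  assumes int: "integrable lborel f"
    and boxes: "\<And>a b. set_lebesgue_integral lborel (box a b) f = 0"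
  shows "AE x in lborel. f x = 0"
proof (rule sigma_finite_measure.density_zero[OF sigma_finite_lborel int])
  let ?I = "\<lambda>A. set_lebesgue_integral lborel A f"
  let ?E = "range (\<lambda>(a, b). box a b::'a set)"
  have si: "set_integrable lborel A f" if "A \<in> sets borel" for A
    unfolding set_integrable_def using that int
    using integrable_mult_indicator[of A lborel f] by simp
  \<comment> \<open>The whole space is not a box, but complements in the Dynkin argument need its
    integral; it is the limit over growing boxes.\<close>
  have univ: "?I UNIV = 0"
  proof -
    let ?A = "\<lambda>n::nat. box (- (real n *\<^sub>R One)) (real n *\<^sub>R One) :: 'a set"
    have "(\<lambda>n. ?I (?A n)) \<longlonglongrightarrow> ?I (\<Union>n. ?A n)"
    proof (rule set_integral_cont_up)
      show "incseq ?A"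
      proof (intro incseq_SucI subsetI)
        fix n :: nat and x assume x: "x \<in> ?A n"
        show "x \<in> ?A (Suc n)" unfolding mem_box
        proof
          fix i :: 'a assume "i \<in> Basis"
          with x have "- real n < x \<bullet> i" "x \<bullet> i < real n" by (auto simp: mem_box)
          with \<open>i \<in> Basis\<close> show "- (real (Suc n) *\<^sub>R One) \<bullet> i < x \<bullet> i \<and> x \<bullet> i < (real (Suc n) *\<^sub>R One) \<bullet> i"
            by simp
        qed
      qed
      show "set_integrable lborel (\<Union>n. ?A n) f" by (rule si) auto
    qed auto
    then show ?thesis
      unfolding UN_box_eq_UNIV using boxes by (simp add: LIMSEQ_const_iff)
  qed
  fix A :: "'a set" assume "A \<in> sets lborel"
  then have A: "A \<in> sigma_sets UNIV ?E" by (simp add: borel_eq_box)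
  have stab: "Int_stable ?E" "?E \<subseteq> Pow UNIV"
    by (auto simp: Int_stable_def box_Int_box)
  \<comment> \<open>The sets over which \<open>f\<close> integrates to zero form a Dynkin system,
    and boxes are an intersection-stable generator of the Borel sets.\<close>
  from stab A show "?I A = 0"
  proof (induction rule: sigma_sets_induct_disjoint[consumes 3, case_names basic empty compl union])
    case (compl A)
    then have A: "A \<in> sets borel" by (simp add: borel_eq_box)
    have "?I (A \<union> (UNIV - A)) = ?I A + ?I (UNIV - A)"
      by (rule set_integral_Un) (use A si in auto)
    then show ?case using compl univ by simp
  next
    case (union A)
    then have A: "A i \<in> sets borel" for i by (auto simp: borel_eq_box)
    have "?I (\<Union>i. A i) = (\<Sum>i. ?I (A i))"
      by (rule lebesgue_integral_countable_add) (use A si union in \<open>auto simp: disjoint_family_on_def\<close>)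
    then show ?case using union by simp
  qed (use boxes in \<open>auto simp: Int_stable_def box_Int_box set_lebesgue_integral_def\<close>)
qed

section \<open>Smooth functions and cut-offs of boxes\<close>

lemma Ck_Suc_imp: "Ck (Suc k) f \<Longrightarrow> Ck k f"
proof (induction k arbitrary: f)
  case 0
  then obtain g where "\<And>x. GDERIV f x :> g x" by auto
  then have "isCont f x" for x
    unfolding gderiv_def using has_derivative_continuous by blast
  then show ?case by (simp add: continuous_at_imp_continuous_on)
next
  case (Suc k)
  then obtain g where "\<forall>x. GDERIV f x :> g x" "\<forall>i. Ck (Suc k) (\<lambda>x. g x $ i)" by auto
  with Suc.IH show ?case by auto
qed

lemma Ck_const: "Ck k (\<lambda>x. c)"
proof (induction k arbitrary: c)
  case (Suc k)
  then show ?case by (auto intro!: exI[of _ "\<lambda>x. 0"] GDERIV_const)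
qed auto

lemma Ck_add: "Ck k f \<Longrightarrow> Ck k g \<Longrightarrow> Ck k (\<lambda>x. f x + g x)"
proof (induction k arbitrary: f g)
  case (Suc k)
  then obtain f' g' where "\<forall>x. GDERIV f x :> f' x" "\<forall>i. Ck k (\<lambda>x. f' x $ i)"
    "\<forall>x. GDERIV g x :> g' x" "\<forall>i. Ck k (\<lambda>x. g' x $ i)" by auto
  then show ?case using Suc.IH
    by (auto intro!: exI[of _ "\<lambda>x. f' x + g' x"] GDERIV_add)
qed (auto intro: continuous_on_add)

lemma Ck_mult: "Ck k f \<Longrightarrow> Ck k g \<Longrightarrow> Ck k (\<lambda>x. f x * g x)"
proof (induction k arbitrary: f g)
  case (Suc k)
  then obtain f' g' where *: "\<forall>x. GDERIV f x :> f' x" "\<forall>i. Ck k (\<lambda>x. f' x $ i)"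
    "\<forall>x. GDERIV g x :> g' x" "\<forall>i. Ck k (\<lambda>x. g' x $ i)" by auto
  have "Ck k f" "Ck k g" using Suc.prems Ck_Suc_imp by blast+
  then show ?case using Suc.IH *
    by (auto intro!: exI[of _ "\<lambda>x. f x *\<^sub>R g' x + g x *\<^sub>R f' x"] GDERIV_mult Ck_add)
qed (auto intro: continuous_on_mult)

lemma Ck_prod:
  assumes "finite I" "\<And>i. i \<in> I \<Longrightarrow> Ck k (f i)"
  shows "Ck k (\<lambda>x. \<Prod>i\<in>I. f i x)"
  using assms by (induction I rule: finite_induct) (auto intro: Ck_const Ck_mult)

text \<open>The classical smooth function \<open>exp (- c / t)\<close>, extended by zero, divided by
  powers of \<open>t\<close>. The derivative of \<open>bump c n\<close> is a combination of
  \<open>bump c (n+2)\<close> and \<open>bump c (n+1)\<close>, so the family is closed under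
  differentiation. Letting \<open>c\<close> tend to zero turns \<open>bump c 0\<close> into the
  indicator of the positive half-line.\<close>

definition bump :: "real \<Rightarrow> nat \<Rightarrow> real \<Rightarrow> real" where
  "bump c n t = (if 0 < t then exp (- c / t) / t ^ n else 0)"

text \<open>Substituting \<open>y = c / t\<close> turns the right limit into that of
  \<open>(y / c) ^ n * exp (- y)\<close> at infinity.\<close>

lemma bump_tendsto_0:
  assumes "c > 0" shows "(bump c n \<longlongrightarrow> 0) (at 0)"
proof -
  have *: "((\<lambda>t::real. exp (- c / t) / t ^ n) \<longlongrightarrow> 0) (at_right 0)"
  proof -
    have "((\<lambda>y. (y / c) ^ n * exp (- y)) \<longlongrightarrow> 0) at_top"
    proof -
      have "((\<lambda>y. (1 / c ^ n) * (y ^ n / exp y)) \<longlongrightarrow> (1 / c ^ n) * 0) at_top"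
        by (intro tendsto_intros tendsto_power_div_exp_0)
      then show ?thesis by (simp add: field_simps exp_minus)
    qed
    moreover have "LIM t at_right 0. c / t :> at_top"
      using filterlim_tendsto_pos_mult_at_top[OF tendsto_const assms filterlim_inverse_at_top_right]
      by (simp add: field_simps)
    ultimately have "((\<lambda>t. (c / t / c) ^ n * exp (- (c / t))) \<longlongrightarrow> 0) (at_right 0)"
      by (rule filterlim_compose)
    then show ?thesis using assms by (simp add: field_simps)
  qed
  have "(bump c n \<longlongrightarrow> 0) (at_right 0)"
    by (rule Lim_transform_eventually[OF *])
       (simp add: bump_def eventually_at_filter)
  moreover have "(bump c n \<longlongrightarrow> 0) (at_left 0)"
    by (rule Lim_transform_eventually[OF tendsto_const])
       (simp add: bump_def eventually_at_filter)
  ultimately show ?thesis by (simp add: filterlim_split_at)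
qed

lemma bump_DERIV:
  assumes "c > 0"
  shows "(bump c n has_real_derivative (c * bump c (n+2) t - real n * bump c (n+1) t)) (at t)"
proof -
  consider "t > 0" | "t < 0" | "t = 0" by linarith
  then show ?thesis
  proof cases
    case 1
    have "((\<lambda>t. exp (- c / t) / t ^ n) has_real_derivative
        (c * bump c (n+2) t - real n * bump c (n+1) t)) (at t)"
      using 1 by (auto intro!: derivative_eq_intros simp: bump_def field_simps power2_eq_square)
        (cases n; simp add: field_simps power2_eq_square)
    then show ?thesis
      by (rule DERIV_cong_ev[THEN iffD1, OF refl _ refl, rotated])
         (use 1 eventually_nhds_in_open[of "{0<..}" t] in \<open>auto elim!: eventually_mono simp: bump_def\<close>)
  next
    case 2
    have "((\<lambda>t. 0) has_real_derivative (c * bump c (n+2) t - real n * bump c (n+1) t)) (at t)"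
      using 2 by (simp add: bump_def)
    then show ?thesis
      by (rule DERIV_cong_ev[THEN iffD1, OF refl _ refl, rotated])
         (use 2 eventually_nhds_in_open[of "{..<0}" t] in \<open>auto elim!: eventually_mono simp: bump_def\<close>)
  next
    case 3
    \<comment> \<open>At the origin the difference quotient of \<open>bump c n\<close> is
      \<open>bump c (n+1)\<close> itself, which tends to zero.\<close>
    have "(\<lambda>h. (bump c n h - bump c n 0) / h) = bump c (n+1)"
      by (auto simp: bump_def fun_eq_iff)
    then have "((\<lambda>h. (bump c n (0+h) - bump c n 0) / h) \<longlongrightarrow> 0) (at 0)"
      using bump_tendsto_0[OF assms, of "n+1"] by simp
    then show ?thesis using 3 unfolding DERIV_def by (simp add: bump_def)
  qed
qed

text \<open>Induction over \<open>k\<close> with \<open>n\<close> arbitrary: the gradient is a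
  combination of bumps with larger \<open>n\<close>, times the fixed vector
  \<open>v\<close>.\<close>

lemma Ck_bump_affine:
  assumes "c > 0"
  shows "Ck k (\<lambda>x. bump c n (x \<bullet> v - a))"
proof (induction k arbitrary: n)
  case 0
  have "continuous_on UNIV (bump c n)"
    using bump_DERIV[OF assms] by (meson DERIV_isCont continuous_at_imp_continuous_on)
  then show ?case
    by (auto intro!: continuous_on_compose2[of UNIV "bump c n"] continuous_intros)
next
  case (Suc k)
  define D where "D x = c * bump c (n+2) (x \<bullet> v - a) - real n * bump c (n+1) (x \<bullet> v - a)" for x
  have "GDERIV (\<lambda>x. bump c n (x \<bullet> v - a)) x :> D x *\<^sub>R v" for x
  proof -
    have "GDERIV (\<lambda>x. x \<bullet> v - a) x :> v"
      unfolding gderiv_def by (auto intro!: derivative_eq_intros)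
    from GDERIV_DERIV_compose[OF this bump_DERIV[OF assms]] show ?thesis by (simp add: D_def)
  qed
  moreover have "Ck k (\<lambda>x. (D x *\<^sub>R v) $ i)" for i
  proof -
    have "Ck k (\<lambda>x. c * v $ i * bump c (n+2) (x \<bullet> v - a) + (- real n * v $ i) * bump c (n+1) (x \<bullet> v - a))"
      by (intro Ck_add Ck_mult Ck_const Suc)
    then show ?thesis by (simp add: D_def algebra_simps)
  qed
  ultimately show ?case
    unfolding Ck.simps by (intro exI[of _ "\<lambda>x. D x *\<^sub>R v"] conjI allI)
qed

lemma bump_le_1: "c > 0 \<Longrightarrow> \<bar>bump c 0 t\<bar> \<le> 1"
  by (auto simp: bump_def)

lemma bump_tendsto_1: "(\<lambda>m. bump (1 / real (Suc m)) 0 t) \<longlonglongrightarrow> (if t > 0 then 1 else 0)"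
proof (cases "t > 0")
  case True
  have "(\<lambda>m. exp (- (1 / real (Suc m)) / t)) \<longlonglongrightarrow> exp (- 0 / t)"
    using LIMSEQ_inverse_real_of_nat by (intro tendsto_intros) (use True in \<open>auto simp: inverse_eq_divide\<close>)
  then show ?thesis using True by (simp add: bump_def)
qed (simp add: bump_def)

text \<open>For positive \<open>c\<close> a smooth cut-off that is nonzero exactly on the open box;
  as \<open>c\<close> tends to zero it converges pointwise to the indicator of the box.\<close>

definition box_bump :: "real \<Rightarrow> real^'n \<Rightarrow> real^'n \<Rightarrow> real^'n \<Rightarrow> real" where
  "box_bump c a b x = (\<Prod>i\<in>UNIV. bump c 0 (x $ i - a $ i) * bump c 0 (b $ i - x $ i))"

lemma test_fun_box_bump:
  fixes a b :: "real^'n"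
  assumes "c > 0" "cbox a b \<subseteq> U"
  shows "test_fun U (box_bump c a b)"
proof -
  have "Ck k (box_bump c a b)" for k
  proof -
    \<comment> \<open>The second factor is written through \<open>axis i (-1)\<close>, so that both
      are bumps of affine functions.\<close>
    have "Ck k (\<lambda>x::real^'n. bump c 0 (x \<bullet> axis i 1 - a $ i) * bump c 0 (x \<bullet> axis i (-1) - (- b $ i)))" for i
      using assms by (intro Ck_mult Ck_bump_affine)
    then have "Ck k (\<lambda>x::real^'n. \<Prod>i\<in>UNIV. bump c 0 (x \<bullet> axis i 1 - a $ i) * bump c 0 (x \<bullet> axis i (-1) - (- b $ i)))"
      by (intro Ck_prod) auto
    then show ?thesis by (simp add: box_bump_def[abs_def] inner_axis)
  qed
  moreover have sub: "closure {x. box_bump c a b x \<noteq> 0} \<subseteq> cbox a b"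
  proof (rule closure_minimal)
    show "{x. box_bump c a b x \<noteq> 0} \<subseteq> cbox a b"
      by (auto simp: box_bump_def bump_def mem_box_cart split: if_splits)
         (meson less_eq_real_def not_less diff_gt_0_iff_gt)+
  qed (rule closed_cbox)
  moreover have "compact (closure {x. box_bump c a b x \<noteq> 0})"
    using sub compact_cbox closed_closure compact_Int_closed by (metis inf.absorb2 closed_Int_compact compact_Int_closed)
  ultimately show ?thesis using assms by (auto simp: test_fun_def)
qed

lemma box_bump_le_1: "c > 0 \<Longrightarrow> \<bar>box_bump c a b x\<bar> \<le> 1"
  unfolding box_bump_def abs_prod abs_mult
  by (intro prod_le_1) (auto intro!: mult_le_one bump_le_1)

lemma box_bump_tendsto:
  "(\<lambda>m. box_bump (1 / real (Suc m)) a b x) \<longlonglongrightarrow> indicator (box a b) x"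
proof -
  have "(\<lambda>m. box_bump (1 / real (Suc m)) a b x) \<longlonglongrightarrow>
     (\<Prod>i\<in>UNIV. (if x $ i - a $ i > 0 then 1 else 0) * (if b $ i - x $ i > 0 then 1 else 0))"
    unfolding box_bump_def by (intro tendsto_intros bump_tendsto_1)
  moreover have "(\<Prod>i\<in>UNIV. (if x $ i - a $ i > 0 then 1 else 0) * (if b $ i - x $ i > 0 then 1 else 0))
     = (indicator (box a b) x :: real)"
  proof (cases "x \<in> box a b")
    case False
    then obtain i where "\<not> (a $ i < x $ i \<and> x $ i < b $ i)" by (auto simp: mem_box_cart)
    then have "(\<Prod>i\<in>UNIV. (if x $ i - a $ i > 0 then 1 else 0) * (if b $ i - x $ i > 0 then 1 else 0)) = (0::real)"
      by (intro prod_zero bexI[of _ i]) auto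
    then show ?thesis using False by simp
  qed (auto simp: mem_box_cart)
  ultimately show ?thesis by simp
qed

text \<open>Dominated convergence along \<open>box_bump\<close> with parameter tending to zero shows
  that \<open>f\<close> integrates to zero over open boxes whose closed box lies in
  \<open>U\<close>. The result on boxes then applies on each of countably many closed boxes covering
  \<open>U\<close>.\<close>

lemma test_fun_integrals_zero_imp_AE_zero:
  fixes f :: "real^'n \<Rightarrow> real"
  assumes U: "open U" and int: "integrable (lebesgue_on U) f"
    and zero: "\<And>\<phi>. test_fun U \<phi> \<Longrightarrow> (\<integral>x. \<phi> x * f x \<partial>lebesgue_on U) = 0"
  shows "AE x in lebesgue_on U. f x = 0"
proof -
  have Us[measurable, simp]: "U \<in> sets lebesgue" using U by auto
  define F where "F x = indicator U x * f x" for x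
  have F: "integrable lebesgue F"
    using int by (simp add: F_def[abs_def] integrable_restrict_space)
  have box0: "(\<integral>x. indicator (box c d) x * F x \<partial>lebesgue) = 0" if sub: "cbox c d \<subseteq> U" for c d
  proof -
    have "(\<lambda>m. \<integral>x. box_bump (1 / real (Suc m)) c d x * f x \<partial>lebesgue_on U) \<longlonglongrightarrow>
        (\<integral>x. indicator (box c d) x * f x \<partial>lebesgue_on U)"
    proof (rule integral_dominated_convergence[where w = "\<lambda>x. norm (f x)"])
      show "(\<lambda>x. indicator (box c d) x * f x) \<in> borel_measurable (lebesgue_on U)"
        by (intro borel_measurable_times borel_measurable_integrable[OF int] measurable_restrict_space1
            borel_measurable_indicator) simp
      show "(\<lambda>x. box_bump (1 / real (Suc m)) c d x * f x) \<in> borel_measurable (lebesgue_on U)" for m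
      proof (intro borel_measurable_times borel_measurable_integrable[OF int] measurable_restrict_space1)
        have "continuous_on UNIV (box_bump (1 / real (Suc m)) c d)"
          using test_fun_box_bump[OF _ sub, of "1 / real (Suc m)"] by (auto simp: test_fun_def dest: spec[of _ 0])
        then show "box_bump (1 / real (Suc m)) c d \<in> borel_measurable lebesgue"
          by (intro measurable_completion) (simp add: borel_measurable_continuous_onI)
      qed
      show "integrable (lebesgue_on U) (\<lambda>x. norm (f x))" using int by simp
      show "AE x in lebesgue_on U. (\<lambda>m. box_bump (1 / real (Suc m)) c d x * f x) \<longlonglongrightarrow> indicator (box c d) x * f x"
        by (intro AE_I2 tendsto_mult box_bump_tendsto tendsto_const)
      show "AE x in lebesgue_on U. norm (box_bump (1 / real (Suc m)) c d x * f x) \<le> norm (f x)" for m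
        by (intro AE_I2) (simp add: abs_mult mult_left_le_one_le box_bump_le_1)
    qed
    moreover have "(\<integral>x. box_bump (1 / real (Suc m)) c d x * f x \<partial>lebesgue_on U) = 0" for m
      by (rule zero) (rule test_fun_box_bump[OF _ sub], simp)
    ultimately have "(\<integral>x. indicator (box c d) x * f x \<partial>lebesgue_on U) = 0"
      by (simp add: LIMSEQ_const_iff)
    then show ?thesis by (simp add: integral_restrict_space F_def algebra_simps)
  qed
  have cb: "AE x in lebesgue. x \<in> cbox a b \<longrightarrow> F x = 0" if sub: "cbox a b \<subseteq> U" for a b
  proof -
    have intF: "integrable lebesgue (\<lambda>x. indicator A x * F x)" if "A \<in> sets borel" for A
      using integrable_mult_indicator[OF _ F, of A] that by simp
    \<comment> \<open>The result on boxes concerns \<open>lborel\<close>, so the Lebesgue measurable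
      function is replaced by a Borel representative.\<close>
    obtain G where G: "G \<in> borel_measurable lborel"
      and GF: "AE x in lborel. indicator (box a b) x * F x = G x"
      using completion_ex_borel_measurable_real[of "\<lambda>x. indicator (box a b) x * F x" lborel]
        intF[of "box a b"] by auto
    have GF': "AE x in lebesgue. indicator (box a b) x * F x = G x"
      using GF by (rule AE_completion)
    have G': "G \<in> borel_measurable lebesgue" using G by (simp add: measurable_completion)
    have "integrable lebesgue G"
      using integrable_cong_AE[THEN iffD1, OF _ _ GF' intF[of "box a b"]] G' intF[of "box a b"] by auto
    then have iG: "integrable lborel G" using G by (simp add: integrable_completion)
    have "AE x in lborel. G x = 0"
    proof (rule integral_boxes_zero_imp_AE_zero[OF iG])
      fix c d :: "real^'n"
      obtain c' d' where cd: "box c d \<inter> box a b = box c' d'" using box_Int_box by blast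
      have 1: "set_lebesgue_integral lborel (box c d) G = (\<integral>x. indicator (box c d) x * G x \<partial>lebesgue)"
        using G by (simp add: set_lebesgue_integral_def integral_completion)
      also have "\<dots> = (\<integral>x. indicator (box c d) x * (indicator (box a b) x * F x) \<partial>lebesgue)"
        using GF' by (intro integral_cong_AE borel_measurable_times borel_measurable_indicator
            borel_measurable_integrable[OF F] G') auto
      also have "\<dots> = (\<integral>x. indicator (box c' d') x * F x \<partial>lebesgue)"
        unfolding cd[symmetric] by (intro Bochner_Integration.integral_cong refl) (auto simp: indicator_def)
      also have "\<dots> = 0"
      proof (cases "box c' d' = {}")
        case False
        \<comment> \<open>The closed box has to lie in \<open>U\<close>: if the intersection is
          nonempty, it is the closure of an open box inside \<open>cbox a b\<close>.\<close>
        then have "cbox c' d' = closure (box c' d')" by (simp add: closure_box)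
        also have "\<dots> \<subseteq> closure (box a b)" using cd by (intro closure_mono) auto
        also have "\<dots> \<subseteq> cbox a b" by (intro closure_minimal box_subset_cbox closed_cbox)
        finally show ?thesis using sub by (intro box0) auto
      qed simp
      finally show "set_lebesgue_integral lborel (box c d) G = 0" .
    qed
    then have "AE x in lebesgue. G x = 0" by (rule AE_completion)
    moreover have "AE x in lebesgue. x \<notin> cbox a b - box a b"
      using negligible_frontier_interval[of a b] unfolding negligible_iff_null_sets by (rule AE_not_in)
    ultimately show ?thesis using GF' by eventually_elim (auto simp: indicator_def split: if_splits)
  qed
  obtain D where D: "countable D" "D \<subseteq> Pow U" "\<And>X. X \<in> D \<Longrightarrow> \<exists>a b. X = cbox a b" "\<Union>D = U"
    using open_countable_Union_open_cbox[OF U] by metis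
  have "AE x in lebesgue. \<forall>X\<in>D. x \<in> X \<longrightarrow> F x = 0"
    unfolding AE_ball_countable[OF D(1)] using D cb by (metis PowD subsetD)
  then have "AE x in lebesgue. x \<in> U \<longrightarrow> f x = 0"
    using D(4) by (auto simp: F_def indicator_def elim!: eventually_mono)
  then show ?thesis by (simp add: AE_restrict_space_iff)
qed

section \<open>Square integrable functions\<close>

lemma L2_spaceD:
  assumes "f \<in> L2_space S"
  shows "f \<in> borel_measurable (lebesgue_on S)" "integrable (lebesgue_on S) (\<lambda>x. (norm (f x))\<^sup>2)"
  using assms by (auto simp: L2_space_def)

lemma L2_space_add:
  assumes "f \<in> L2_space S" "g \<in> L2_space S"
  shows "(\<lambda>x. f x + g x) \<in> L2_space S"
proof -
  note [measurable] = L2_spaceD[OF assms(1)] L2_spaceD[OF assms(2)]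
  have "integrable (lebesgue_on S) (\<lambda>x. (norm (f x + g x))\<^sup>2)"
  proof (rule Bochner_Integration.integrable_bound[where f = "\<lambda>x. 2 * (norm (f x))\<^sup>2 + 2 * (norm (g x))\<^sup>2"])
    have "(norm (f x + g x))\<^sup>2 \<le> 2 * (norm (f x))\<^sup>2 + 2 * (norm (g x))\<^sup>2" for x
    proof -
      have "(norm (f x + g x))\<^sup>2 \<le> (norm (f x) + norm (g x))\<^sup>2"
        by (intro power_mono norm_triangle_ineq) auto
      also have "\<dots> \<le> 2 * (norm (f x))\<^sup>2 + 2 * (norm (g x))\<^sup>2"
        using sum_squares_bound[of "norm (f x)" "norm (g x)"] by (simp add: power2_sum)
      finally show ?thesis .
    qed
    then show "AE x in lebesgue_on S. norm ((norm (f x + g x))\<^sup>2) \<le> norm (2 * (norm (f x))\<^sup>2 + 2 * (norm (g x))\<^sup>2)"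
      by (intro AE_I2) (smt (verit) real_norm_def zero_le_power2)
  qed (use L2_spaceD[OF assms(1)] L2_spaceD[OF assms(2)] in auto)
  then show ?thesis by (simp add: L2_space_def)
qed

lemma L2_space_scale: "f \<in> L2_space S \<Longrightarrow> (\<lambda>x. a *\<^sub>R f x) \<in> L2_space S"
  by (auto simp: L2_space_def power_mult_distrib)

lemma L2_inner_integrable:
  assumes "f \<in> L2_space S" "g \<in> L2_space S"
  shows "integrable (lebesgue_on S) (\<lambda>x. f x \<bullet> g x)"
proof (rule Bochner_Integration.integrable_bound[where f = "\<lambda>x. (norm (f x))\<^sup>2 + (norm (g x))\<^sup>2"])
  have "\<bar>f x \<bullet> g x\<bar> \<le> (norm (f x))\<^sup>2 + (norm (g x))\<^sup>2" for x
    using Cauchy_Schwarz_ineq2[of "f x" "g x"] sum_squares_bound[of "norm (f x)" "norm (g x)"]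
      mult_nonneg_nonneg[OF norm_ge_zero norm_ge_zero, of "f x" "g x"] by linarith
  then show "AE x in lebesgue_on S. norm (f x \<bullet> g x) \<le> norm ((norm (f x))\<^sup>2 + (norm (g x))\<^sup>2)"
    by (intro AE_I2) (smt (verit) real_norm_def)
qed (use L2_spaceD[OF assms(1)] L2_spaceD[OF assms(2)] in auto)

text \<open>The constant in the majorant \<open>1 + (norm (f x))\<^sup>2\<close> is integrable
  because \<open>U\<close> has finite measure.\<close>

lemma L2_integrable:
  assumes "U \<in> lmeasurable" "f \<in> L2_space U"
  shows "integrable (lebesgue_on U) f"
proof (rule Bochner_Integration.integrable_bound[where f = "\<lambda>x. 1 + (norm (f x))\<^sup>2"])
  have "integrable (lebesgue_on U) (\<lambda>x. 1 :: real)"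
    using assms(1) by (intro finite_measure.integrable_const finite_measure_lebesgue_on)
  then show "integrable (lebesgue_on U) (\<lambda>x. 1 + (norm (f x))\<^sup>2)"
    using L2_spaceD[OF assms(2)] by auto
  have "norm (f x) \<le> 1 + (norm (f x))\<^sup>2" for x
    using sum_squares_bound[of 1 "norm (f x)"] norm_ge_zero[of "f x"]
    unfolding power2_eq_square by linarith
  then show "AE x in lebesgue_on U. norm (f x) \<le> norm (1 + (norm (f x))\<^sup>2)"
    by (intro AE_I2) (smt (verit) real_norm_def)
qed (use L2_spaceD[OF assms(2)] in auto)

lemma L2_space_bounded_mult:
  assumes "f \<in> L2_space S" and m: "h \<in> borel_measurable (lebesgue_on S)"
    and B: "AE x in lebesgue_on S. norm (h x) \<le> B * norm (f x)"
  shows "h \<in> L2_space S"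
proof -
  note [measurable] = m
  have "integrable (lebesgue_on S) (\<lambda>x. (norm (h x))\<^sup>2)"
  proof (rule Bochner_Integration.integrable_bound[where f = "\<lambda>x. B\<^sup>2 * (norm (f x))\<^sup>2"])
    show "AE x in lebesgue_on S. norm ((norm (h x))\<^sup>2) \<le> norm (B\<^sup>2 * (norm (f x))\<^sup>2)"
      using B
    proof eventually_elim
      case (elim x)
      then have "(norm (h x))\<^sup>2 \<le> (B * norm (f x))\<^sup>2" by (intro power_mono) auto
      then show ?case by (simp add: power_mult_distrib)
    qed
  qed (use L2_spaceD[OF assms(1)] in auto)
  with m show ?thesis by (simp add: L2_space_def)
qed

lemma L2_norm_on_sq: "(L2_norm_on S f)\<^sup>2 = (\<integral>x. (norm (f x))\<^sup>2 \<partial>lebesgue_on S)"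
  by (simp add: L2_norm_on_def)

section \<open>Test functions\<close>

lemma GDERIV_unique:
  assumes "GDERIV f x :> D" "GDERIV f x :> E"
  shows "D = E"
proof -
  have "(\<lambda>h. h \<bullet> D) = (\<lambda>h. h \<bullet> E)"
    using assms unfolding gderiv_def by (rule has_derivative_unique)
  then have "\<forall>h. h \<bullet> D = h \<bullet> E" by metis
  then show ?thesis by (simp only: vector_eq_ldot)
qed

lemma test_fun_gradient_vanishes:
  assumes "GDERIV \<phi> x :> D" "x \<notin> closure {x. \<phi> x \<noteq> 0}"
  shows "D = 0"
proof -
  have "eventually (\<lambda>y. y \<in> - closure {x. \<phi> x \<noteq> 0}) (nhds x)"
    by (rule eventually_nhds_in_open) (use assms(2) in auto)
  then have "eventually (\<lambda>y. \<phi> y = 0) (nhds x)"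
    by (rule eventually_mono) (use closure_subset[of "{x. \<phi> x \<noteq> 0}"] in auto)
  moreover have "GDERIV (\<lambda>x. 0) x :> 0" by (rule GDERIV_const)
  ultimately have "(\<phi> has_derivative (\<lambda>h. h \<bullet> 0)) (at x)"
    unfolding gderiv_def by (subst has_derivative_transform_eventually[where f = "\<lambda>x. 0"])
      (auto simp: eventually_at_filter elim!: eventually_mono dest: eventually_nhds_x_imp_x)
  then show ?thesis using assms(1) GDERIV_unique unfolding gderiv_def by blast
qed

lemma test_fun_continuous:
  assumes "test_fun U \<phi>" shows "continuous_on UNIV \<phi>"
  using assms unfolding test_fun_def by (metis Ck.simps(1))

lemma test_fun_has_gradient:
  assumes "test_fun U \<phi>" obtains d\<phi> where "\<And>x. GDERIV \<phi> x :> d\<phi> x"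
  using assms unfolding test_fun_def by (metis Ck.simps(2))

lemma test_fun_gradient_continuous:
  assumes "test_fun U \<phi>" "\<And>x. GDERIV \<phi> x :> d\<phi> x"
  shows "continuous_on UNIV d\<phi>"
proof -
  have "Ck (Suc 0) \<phi>" using assms(1) by (simp add: test_fun_def del: Ck.simps)
  then obtain g where g: "\<And>x. GDERIV \<phi> x :> g x" "\<And>i. continuous_on UNIV (\<lambda>x. g x $ i)" by auto
  have "continuous_on UNIV (\<lambda>x. \<chi> i. g x $ i)" by (intro continuous_on_vec_lambda g)
  then have "continuous_on UNIV g" by simp
  moreover have "g = d\<phi>" using GDERIV_unique g(1) assms(2) by blast
  ultimately show ?thesis by simp
qed

lemma continuous_bounded_support:
  fixes f :: "'a::topological_space \<Rightarrow> 'b::real_normed_vector"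
  assumes "continuous_on UNIV f" "compact C" "\<And>x. x \<notin> C \<Longrightarrow> f x = 0"
  obtains B where "B \<ge> 0" "\<And>x. norm (f x) \<le> B"
proof -
  have "bounded (f ` C)"
    using assms by (intro compact_imp_bounded compact_continuous_image) (auto intro: continuous_on_subset)
  then obtain B where B: "\<And>x. x \<in> C \<Longrightarrow> norm (f x) \<le> B" by (auto simp: bounded_iff)
  have "norm (f x) \<le> max B 0" for x using B[of x] assms(3)[of x] by (cases "x \<in> C") auto
  then show ?thesis by (intro that[of "max B 0"]) auto
qed

lemma test_fun_bounds:
  assumes "test_fun U \<phi>" "\<And>x. GDERIV \<phi> x :> d\<phi> x"
  shows "\<exists>B\<ge>0. \<forall>x. \<bar>\<phi> x\<bar> \<le> B \<and> norm (d\<phi> x) \<le> B"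
proof -
  let ?C = "closure {x. \<phi> x \<noteq> 0}"
  have C: "compact ?C" using assms by (simp add: test_fun_def)
  have "\<phi> x = 0" if "x \<notin> ?C" for x using that closure_subset[of "{x. \<phi> x \<noteq> 0}"] by auto
  then obtain B1 where B1: "B1 \<ge> 0" "\<And>x. norm (\<phi> x) \<le> B1"
    using continuous_bounded_support[OF test_fun_continuous[OF assms(1)] C] by blast
  obtain B2 where B2: "B2 \<ge> 0" "\<And>x. norm (d\<phi> x) \<le> B2"
    using continuous_bounded_support[OF test_fun_gradient_continuous[OF assms] C]
      test_fun_gradient_vanishes[OF assms(2)] by blast
  show ?thesis
    by (rule exI[of _ "max B1 B2"]) (use B1 B2 in \<open>auto simp: le_max_iff_disj\<close>)
qed

lemma test_fun_add:
  assumes "test_fun U \<phi>" "test_fun U \<psi>" shows "test_fun U (\<lambda>x. \<phi> x + \<psi> x)"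
proof -
  have "closure {x. \<phi> x + \<psi> x \<noteq> 0} \<subseteq> closure ({x. \<phi> x \<noteq> 0} \<union> {x. \<psi> x \<noteq> 0})"
    by (intro closure_mono) auto
  then have sub: "closure {x. \<phi> x + \<psi> x \<noteq> 0} \<subseteq> closure {x. \<phi> x \<noteq> 0} \<union> closure {x. \<psi> x \<noteq> 0}"
    by simp
  moreover have "compact (closure {x. \<phi> x \<noteq> 0} \<union> closure {x. \<psi> x \<noteq> 0})"
    using assms by (auto simp: test_fun_def)
  ultimately have "compact (closure {x. \<phi> x + \<psi> x \<noteq> 0})"
    by (meson closed_closure closed_subset compact_eq_bounded_closed bounded_subset)
  moreover have "closure {x. \<phi> x + \<psi> x \<noteq> 0} \<subseteq> U"
    using sub assms unfolding test_fun_def by blast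
  ultimately show ?thesis using assms by (simp add: test_fun_def Ck_add)
qed

lemma test_fun_scale:
  assumes "test_fun U \<phi>" shows "test_fun U (\<lambda>x. a * \<phi> x)"
proof -
  have sub: "closure {x. a * \<phi> x \<noteq> 0} \<subseteq> closure {x. \<phi> x \<noteq> 0}"
    by (intro closure_mono) auto
  moreover have "compact (closure {x. \<phi> x \<noteq> 0})"
    using assms by (auto simp: test_fun_def)
  ultimately have "compact (closure {x. a * \<phi> x \<noteq> 0})"
    by (meson closed_closure compact_eq_bounded_closed bounded_subset)
  moreover have "closure {x. a * \<phi> x \<noteq> 0} \<subseteq> U"
    using sub assms unfolding test_fun_def by blast
  ultimately show ?thesis using assms by (simp add: test_fun_def Ck_mult Ck_const)
qed

lemma test_fun_0: "test_fun U (\<lambda>x. 0)"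
  unfolding test_fun_def by (auto intro: Ck_const)

section \<open>Weak gradients\<close>

text \<open>Difference quotients of \<open>f\<close> integrate to zero by translation invariance of
  Lebesgue measure, and they converge to the partial derivative. Compact support and the mean value
  theorem give the integrable majorant.\<close>

lemma integral_gradient_eq_0:
  fixes f :: "real^'n \<Rightarrow> real"
  assumes f: "\<And>x. GDERIV f x :> df x" and cont: "continuous_on UNIV df"
    and C: "compact C" "\<And>x. x \<notin> C \<Longrightarrow> f x = 0"
  shows "(\<integral>x. df x $ i \<partial>lborel) = 0"
proof -
  let ?e = "axis i 1 :: real^'n"
  have fc: "continuous_on UNIV f"
    using f has_derivative_continuous unfolding gderiv_def
    by (blast intro: continuous_at_imp_continuous_on)
  then have fm[measurable]: "f \<in> borel_measurable borel" by (rule borel_measurable_continuous_onI)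
  have df0: "df x = 0" if "x \<notin> C" for x
  proof -
    have "eventually (\<lambda>y. y \<in> - C) (nhds x)"
      by (rule eventually_nhds_in_open) (use C that in \<open>auto simp: compact_imp_closed\<close>)
    then have "eventually (\<lambda>y. 0 = f y) (nhds x)"
      by (rule eventually_mono) (use C in auto)
    then have "GDERIV f x :> 0"
      unfolding gderiv_def
      by (subst has_derivative_transform_eventually[where f = "\<lambda>x. 0"])
         (auto simp: eventually_at_filter elim!: eventually_mono dest: eventually_nhds_x_imp_x)
    then show ?thesis using GDERIV_unique f by blast
  qed
  obtain B where B: "B \<ge> 0" "\<And>x. norm (df x) \<le> B"
    using continuous_bounded_support[OF cont C(1) df0] by blast
  obtain r where r: "\<And>x. x \<in> C \<Longrightarrow> norm x \<le> r"
    using C(1) compact_imp_bounded bounded_iff by metis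
  define q where "q m x = (f (x + (1 / real (Suc m)) *\<^sub>R ?e) - f x) * real (Suc m)" for m x
  have deriv: "((\<lambda>t. f (x + t *\<^sub>R ?e)) has_real_derivative df (x + t *\<^sub>R ?e) $ i) (at t)" for x t
  proof -
    have "(f has_derivative (\<lambda>h. h \<bullet> df (x + t *\<^sub>R ?e))) (at (x + t *\<^sub>R ?e))"
      using f by (simp add: gderiv_def)
    moreover have "((\<lambda>t. x + t *\<^sub>R ?e) has_derivative (\<lambda>t. t *\<^sub>R ?e)) (at t)"
      by (auto intro!: derivative_eq_intros)
    ultimately have "((\<lambda>t. f (x + t *\<^sub>R ?e)) has_derivative (\<lambda>s. (s *\<^sub>R ?e) \<bullet> df (x + t *\<^sub>R ?e))) (at t)"
      by (rule has_derivative_compose[rotated])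
    then show ?thesis
      by (simp add: has_field_derivative_def inner_axis' mult_commute_abs)
  qed
  \<comment> \<open>The radius is enlarged by one because the shift has length at most one: outside
    the larger ball both evaluation points lie outside \<open>C\<close>.\<close>
  have qB: "\<bar>q m x\<bar> \<le> B * indicator (cball 0 (r + 1)) x" for m x
  proof (cases "norm x \<le> r + 1")
    case True
    obtain z where "f (x + (1 / real (Suc m)) *\<^sub>R ?e) - f (x + 0 *\<^sub>R ?e)
        = (1 / real (Suc m) - 0) * df (x + z *\<^sub>R ?e) $ i"
      using MVT2[of 0 "1 / real (Suc m)" "\<lambda>t. f (x + t *\<^sub>R ?e)" "\<lambda>t. df (x + t *\<^sub>R ?e) $ i"] deriv
      by auto
    then have "q m x = df (x + z *\<^sub>R ?e) $ i" by (simp add: q_def)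
    then show ?thesis
      using True B(2)[of "x + z *\<^sub>R ?e"] component_le_norm_cart[of "df (x + z *\<^sub>R ?e)" i]
      by (simp add: indicator_def)
  next
    case False
    have "norm x \<le> norm (x + (1 / real (Suc m)) *\<^sub>R ?e) + norm ((1 / real (Suc m)) *\<^sub>R ?e)"
      by (metis add_diff_cancel_right' norm_triangle_ineq4)
    then have "norm (x + (1 / real (Suc m)) *\<^sub>R ?e) > r" using False
      by (simp add: norm_axis_1) (smt (verit) divide_le_eq_1_pos of_nat_0_le_iff)
    then have "f x = 0" "f (x + (1 / real (Suc m)) *\<^sub>R ?e) = 0"
      using False C(2) r by force+
    then show ?thesis using B by (simp add: q_def)
  qed
  have qlim: "(\<lambda>m. q m x) \<longlonglongrightarrow> df x $ i" for x
  proof -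
    have "((\<lambda>h. (f (x + h *\<^sub>R ?e) - f x) / h) \<longlongrightarrow> df x $ i) (at 0)"
      using deriv[of x 0] by (simp add: DERIV_def)
    moreover have "filterlim (\<lambda>m. 1 / real (Suc m)) (at 0) sequentially"
      using LIMSEQ_inverse_real_of_nat
      by (auto simp: filterlim_at inverse_eq_divide)
    ultimately have "(\<lambda>m. (f (x + (1 / real (Suc m)) *\<^sub>R ?e) - f x) / (1 / real (Suc m))) \<longlonglongrightarrow> df x $ i"
      by (rule filterlim_compose)
    then show ?thesis by (simp add: q_def)
  qed
  have "(\<lambda>m. \<integral>x. q m x \<partial>lborel) \<longlonglongrightarrow> (\<integral>x. df x $ i \<partial>lborel)"
  proof (rule integral_dominated_convergence[where w = "\<lambda>x. B * indicator (cball 0 (r + 1)) x"])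
    show "(\<lambda>x. df x $ i) \<in> borel_measurable lborel"
      by (simp, intro borel_measurable_continuous_onI continuous_intros cont)
    show "q m \<in> borel_measurable lborel" for m
      unfolding q_def[abs_def] by measurable
    show "integrable lborel (\<lambda>x. B * indicator (cball 0 (r + 1)) x)"
      by (intro integrable_mult_right integrable_real_indicator)
         (simp_all add: emeasure_bounded_finite[unfolded infinity_ennreal_def])
  qed (use qB qlim in auto)
  moreover have "(\<integral>x. q m x \<partial>lborel) = 0" for m
  proof -
    have shift: "distr lborel borel ((+) ((1 / real (Suc m)) *\<^sub>R ?e)) = lborel"
      by (rule lborel_distr_plus)
    have fi: "integrable lborel f"
    proof -
      obtain B' where B': "B' \<ge> 0" "\<And>x. norm (f x) \<le> B'"
        using continuous_bounded_support[OF fc C] by blast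
      have le: "norm (f x) \<le> norm (B' * indicator (cball 0 r) x)" for x
        using C(2)[of x] r[of x] B'(1) B'(2)[of x] by (cases "x \<in> C") (simp_all add: indicator_def)
      show ?thesis
      proof (rule Bochner_Integration.integrable_bound[OF _ _ AE_I2])
        show "integrable lborel (\<lambda>x. B' * indicator (cball 0 r) x)"
          by (intro integrable_mult_right integrable_real_indicator)
             (simp_all add: emeasure_bounded_finite[unfolded infinity_ennreal_def])
      qed (simp, rule le)
    qed
    then have "integrable (distr lborel borel ((+) ((1 / real (Suc m)) *\<^sub>R ?e))) f"
      by (simp only: shift)
    then have fi': "integrable lborel (\<lambda>x. f ((1 / real (Suc m)) *\<^sub>R ?e + x))"
      by (subst (asm) integrable_distr_eq) auto
    have "(\<integral>x. f ((1 / real (Suc m)) *\<^sub>R ?e + x) \<partial>lborel)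
        = (\<integral>x. f x \<partial>distr lborel borel ((+) ((1 / real (Suc m)) *\<^sub>R ?e)))"
      by (subst integral_distr) auto
    also have "\<dots> = (\<integral>x. f x \<partial>lborel)" by (simp only: shift)
    finally have "(\<integral>x. f ((1 / real (Suc m)) *\<^sub>R ?e + x) - f x \<partial>lborel) = 0"
      using fi fi' by simp
    then show ?thesis by (simp add: q_def add.commute)
  qed
  ultimately show ?thesis by (simp add: LIMSEQ_const_iff)
qed

text \<open>Integration by parts: the product of \<open>\<psi>\<close> and \<open>\<phi>\<close> has
  compact support, so its gradient integrates to zero, and the product rule splits this
  integral.\<close>

lemma test_fun_has_weak_grad:
  assumes U: "open U" and \<psi>: "test_fun U \<psi>" "\<And>x. GDERIV \<psi> x :> d\<psi> x"
  shows "has_weak_grad U \<psi> d\<psi>"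
  unfolding has_weak_grad_def
proof (intro allI impI)
  fix \<phi> d\<phi> assume \<phi>: "test_fun U \<phi>" and "\<forall>x. GDERIV \<phi> x :> d\<phi> x"
  then have d\<phi>: "\<And>x. GDERIV \<phi> x :> d\<phi> x" by blast
  let ?C = "closure {x. \<psi> x \<noteq> 0}"
  have C: "compact ?C" "?C \<subseteq> U" using \<psi>(1) by (auto simp: test_fun_def)
  have \<psi>0: "\<psi> x = 0" if "x \<notin> ?C" for x using that closure_subset[of "{x. \<psi> x \<noteq> 0}"] by auto
  note d\<psi>0 = test_fun_gradient_vanishes[OF \<psi>(2)]
  note cont = test_fun_continuous[OF \<phi>] test_fun_continuous[OF \<psi>(1)]
    test_fun_gradient_continuous[OF \<phi> d\<phi>] test_fun_gradient_continuous[OF \<psi>]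
  have int: "integrable (lebesgue_on U) h" "integral\<^sup>L (lebesgue_on U) h = integral\<^sup>L lborel h"
    if h: "continuous_on UNIV h" "\<And>x. x \<notin> ?C \<Longrightarrow> h x = 0" for h :: "real^'a \<Rightarrow> real^'a"
  proof -
    have hm[measurable]: "h \<in> borel_measurable borel" using h(1) by (rule borel_measurable_continuous_onI)
    have eq: "(\<lambda>x. indicator U x *\<^sub>R h x) = h" "(\<lambda>x. indicator ?C x *\<^sub>R h x) = h"
      using h(2) C(2) by (auto simp: indicator_def fun_eq_iff)
    have "set_integrable lborel ?C h"
      unfolding set_integrable_def
      by (intro borel_integrable_compact C continuous_on_subset[OF h(1)]) auto
    then have ih: "integrable lborel h" by (simp add: set_integrable_def eq)
    then have "integrable lebesgue h" by (simp add: integrable_completion)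
    then show "integrable (lebesgue_on U) h"
      using U by (simp add: integrable_restrict_space eq)
    show "integral\<^sup>L (lebesgue_on U) h = integral\<^sup>L lborel h"
      using U by (simp add: integral_restrict_space eq integral_completion)
  qed
  have c1: "continuous_on UNIV (\<lambda>x. \<psi> x *\<^sub>R d\<phi> x)" "continuous_on UNIV (\<lambda>x. \<phi> x *\<^sub>R d\<psi> x)"
    by (intro continuous_intros cont)+
  have z: "\<psi> x *\<^sub>R d\<phi> x = 0" "\<phi> x *\<^sub>R d\<psi> x = 0" if "x \<notin> ?C" for x
    using \<psi>0[OF that] d\<psi>0[OF that] by simp_all
  have sum: "continuous_on UNIV (\<lambda>x. \<psi> x *\<^sub>R d\<phi> x + \<phi> x *\<^sub>R d\<psi> x)"
    by (intro continuous_intros c1)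
  have iS: "integrable (lebesgue_on U) (\<lambda>x. \<psi> x *\<^sub>R d\<phi> x + \<phi> x *\<^sub>R d\<psi> x)"
    "integral\<^sup>L (lebesgue_on U) (\<lambda>x. \<psi> x *\<^sub>R d\<phi> x + \<phi> x *\<^sub>R d\<psi> x) =
      integral\<^sup>L lborel (\<lambda>x. \<psi> x *\<^sub>R d\<phi> x + \<phi> x *\<^sub>R d\<psi> x)"
    using int[OF sum] z by simp_all
  have il: "integrable lborel (\<lambda>x. \<psi> x *\<^sub>R d\<phi> x + \<phi> x *\<^sub>R d\<psi> x)"
  proof -
    have "set_integrable lborel ?C (\<lambda>x. \<psi> x *\<^sub>R d\<phi> x + \<phi> x *\<^sub>R d\<psi> x)"
      unfolding set_integrable_def
      by (intro borel_integrable_compact C continuous_on_subset[OF sum]) auto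
    moreover have "(\<lambda>x. indicator ?C x *\<^sub>R (\<psi> x *\<^sub>R d\<phi> x + \<phi> x *\<^sub>R d\<psi> x)) = (\<lambda>x. \<psi> x *\<^sub>R d\<phi> x + \<phi> x *\<^sub>R d\<psi> x)"
      using z by (force simp: indicator_def fun_eq_iff)
    ultimately show ?thesis by (simp add: set_integrable_def)
  qed
  have "integral\<^sup>L lborel (\<lambda>x. \<psi> x *\<^sub>R d\<phi> x + \<phi> x *\<^sub>R d\<psi> x) = 0"
  proof (rule vec_eq_iff[THEN iffD2], rule allI)
    fix i
    have "(\<integral>x. (\<psi> x *\<^sub>R d\<phi> x + \<phi> x *\<^sub>R d\<psi> x) $ i \<partial>lborel) = 0"
    proof (rule integral_gradient_eq_0[where f = "\<lambda>x. \<psi> x * \<phi> x" and C = ?C])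
      show "GDERIV (\<lambda>x. \<psi> x * \<phi> x) x :> \<psi> x *\<^sub>R d\<phi> x + \<phi> x *\<^sub>R d\<psi> x" for x
        by (rule GDERIV_mult[OF \<psi>(2) d\<phi>])
      show "\<psi> x * \<phi> x = 0" if "x \<notin> ?C" for x using \<psi>0[OF that] by simp
    qed (fact sum C)+
    moreover have "(\<integral>x. (\<psi> x *\<^sub>R d\<phi> x + \<phi> x *\<^sub>R d\<psi> x) $ i \<partial>lborel) =
       (integral\<^sup>L lborel (\<lambda>x. \<psi> x *\<^sub>R d\<phi> x + \<phi> x *\<^sub>R d\<psi> x)) $ i"
      using integral_bounded_linear[OF bounded_linear_vec_nth il, of i] by simp
    ultimately show "(integral\<^sup>L lborel (\<lambda>x. \<psi> x *\<^sub>R d\<phi> x + \<phi> x *\<^sub>R d\<psi> x)) $ i = 0 $ i" by simp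
  qed
  moreover have "integrable (lebesgue_on U) (\<lambda>x. \<psi> x *\<^sub>R d\<phi> x)"
    "integrable (lebesgue_on U) (\<lambda>x. \<phi> x *\<^sub>R d\<psi> x)"
    using int(1)[OF c1(1)] int(1)[OF c1(2)] z by simp_all
  ultimately have "(\<integral>x. \<psi> x *\<^sub>R d\<phi> x \<partial>lebesgue_on U) + (\<integral>x. \<phi> x *\<^sub>R d\<psi> x \<partial>lebesgue_on U) = 0"
    using iS by simp
  then show "(\<integral>x. \<psi> x *\<^sub>R d\<phi> x \<partial>lebesgue_on U) = - (\<integral>x. \<phi> x *\<^sub>R d\<psi> x \<partial>lebesgue_on U)"
    by (simp add: eq_neg_iff_add_eq_0)
qed

lemma integrable_bounded_continuous_scaleR:
  fixes v :: "real^'n \<Rightarrow> real" and h :: "real^'n \<Rightarrow> 'b::euclidean_space"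
  assumes v: "integrable (lebesgue_on U) v" and h: "continuous_on UNIV h" "\<And>x. norm (h x) \<le> B"
  shows "integrable (lebesgue_on U) (\<lambda>x. v x *\<^sub>R h x)"
proof (rule Bochner_Integration.integrable_bound[where f = "\<lambda>x. B * v x"])
  have "h \<in> borel_measurable lebesgue"
    using h(1) by (intro measurable_completion) (simp add: borel_measurable_continuous_onI)
  then show "(\<lambda>x. v x *\<^sub>R h x) \<in> borel_measurable (lebesgue_on U)"
    by (intro borel_measurable_scaleR borel_measurable_integrable[OF v] measurable_restrict_space1)
  have "norm (v x *\<^sub>R h x) \<le> norm (B * v x)" for x
  proof -
    have "0 \<le> B" using h(2)[of x] norm_ge_zero[of "h x"] by linarith
    then show ?thesis
      using mult_right_mono[OF h(2)[of x], of "\<bar>v x\<bar>"] by (simp add: abs_mult mult.commute)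
  qed
  then show "AE x in lebesgue_on U. norm (v x *\<^sub>R h x) \<le> norm (B * v x)" by simp
qed (use v in simp)

lemma integrable_bounded_continuous_mult_right:
  fixes g :: "real^'n \<Rightarrow> real^'n"
  assumes g: "integrable (lebesgue_on U) g" and h: "continuous_on UNIV h" "\<And>x. \<bar>h x\<bar> \<le> B"
  shows "integrable (lebesgue_on U) (\<lambda>x. h x *\<^sub>R g x)"
proof (rule Bochner_Integration.integrable_bound[where f = "\<lambda>x. B *\<^sub>R g x"])
  have "h \<in> borel_measurable lebesgue"
    using h(1) by (intro measurable_completion) (simp add: borel_measurable_continuous_onI)
  then show "(\<lambda>x. h x *\<^sub>R g x) \<in> borel_measurable (lebesgue_on U)"
    by (intro borel_measurable_scaleR borel_measurable_integrable[OF g] measurable_restrict_space1)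
  have "norm (h x *\<^sub>R g x) \<le> norm (B *\<^sub>R g x)" for x
  proof -
    have "\<bar>h x\<bar> \<le> \<bar>B\<bar>" using h(2)[of x] by linarith
    then show ?thesis by (simp add: mult_right_mono)
  qed
  then show "AE x in lebesgue_on U. norm (h x *\<^sub>R g x) \<le> norm (B *\<^sub>R g x)" by simp
qed (use g in simp)

text \<open>The fundamental lemma is applied to each component of the difference. This makes
  \<open>weak_grad\<close> well defined up to null sets despite the choice in its
  definition.\<close>

lemma has_weak_grad_unique:
  assumes U: "open U" "bounded U"
    and g: "g \<in> L2_space U" "has_weak_grad U v g" and h: "h \<in> L2_space U" "has_weak_grad U v h"
  shows "AE x in lebesgue_on U. g x = h x"
proof -
  have Ul: "U \<in> lmeasurable" using U by (simp add: lmeasurable_open)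
  have ig: "integrable (lebesgue_on U) g" and ih: "integrable (lebesgue_on U) h"
    using L2_integrable[OF Ul] g h by blast+
  have "AE x in lebesgue_on U. g x $ i - h x $ i = 0" for i
  proof (rule test_fun_integrals_zero_imp_AE_zero[OF U(1)])
    show "integrable (lebesgue_on U) (\<lambda>x. g x $ i - h x $ i)"
      by (intro Bochner_Integration.integrable_diff integrable_bounded_linear[OF bounded_linear_vec_nth ig]
          integrable_bounded_linear[OF bounded_linear_vec_nth ih])
  next
    fix \<phi> assume \<phi>: "test_fun U \<phi>"
    obtain d\<phi> where d\<phi>: "\<And>x. GDERIV \<phi> x :> d\<phi> x" using test_fun_has_gradient[OF \<phi>] by blast
    obtain B where "B \<ge> 0" and B: "\<And>x. \<bar>\<phi> x\<bar> \<le> B" and "\<And>x. norm (d\<phi> x) \<le> B"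
      using test_fun_bounds[OF \<phi> d\<phi>] by auto
    note igp = integrable_bounded_continuous_mult_right[OF ig test_fun_continuous[OF \<phi>] B]
    note ihp = integrable_bounded_continuous_mult_right[OF ih test_fun_continuous[OF \<phi>] B]
    have "(\<integral>x. \<phi> x *\<^sub>R g x \<partial>lebesgue_on U) = (\<integral>x. \<phi> x *\<^sub>R h x \<partial>lebesgue_on U)"
    proof -
      have "(\<integral>x. v x *\<^sub>R d\<phi> x \<partial>lebesgue_on U) = - (\<integral>x. \<phi> x *\<^sub>R g x \<partial>lebesgue_on U)"
        "(\<integral>x. v x *\<^sub>R d\<phi> x \<partial>lebesgue_on U) = - (\<integral>x. \<phi> x *\<^sub>R h x \<partial>lebesgue_on U)"
        using g(2)[unfolded has_weak_grad_def, rule_format, OF \<phi> d\<phi>]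
          h(2)[unfolded has_weak_grad_def, rule_format, OF \<phi> d\<phi>] by simp_all
      then show ?thesis by simp
    qed
    then have "(\<integral>x. (\<phi> x *\<^sub>R g x) $ i \<partial>lebesgue_on U) = (\<integral>x. (\<phi> x *\<^sub>R h x) $ i \<partial>lebesgue_on U)"
      by (simp only: integral_bounded_linear[OF bounded_linear_vec_nth igp]
          integral_bounded_linear[OF bounded_linear_vec_nth ihp])
    moreover have "integrable (lebesgue_on U) (\<lambda>x. (\<phi> x *\<^sub>R g x) $ i)"
      "integrable (lebesgue_on U) (\<lambda>x. (\<phi> x *\<^sub>R h x) $ i)"
      by (rule integrable_bounded_linear[OF bounded_linear_vec_nth igp]
          integrable_bounded_linear[OF bounded_linear_vec_nth ihp])+
    ultimately have "(\<integral>x. (\<phi> x *\<^sub>R g x) $ i - (\<phi> x *\<^sub>R h x) $ i \<partial>lebesgue_on U) = 0"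
      by (simp only: Bochner_Integration.integral_diff)
    then show "(\<integral>x. \<phi> x * (g x $ i - h x $ i) \<partial>lebesgue_on U) = 0"
      by (simp add: right_diff_distrib)
  qed
  then have "AE x in lebesgue_on U. \<forall>i. g x $ i - h x $ i = 0"
    by (simp add: AE_all_countable)
  then show ?thesis by (auto simp: vec_eq_iff elim!: eventually_mono)
qed

text \<open>On a bounded set square integrable functions are integrable, also after multiplication
  with bounded test functions and their gradients, so the integrals split.\<close>

lemma has_weak_grad_lincomb:
  assumes U: "open U" "bounded U"
    and v: "v \<in> L2_space U" "g \<in> L2_space U" "has_weak_grad U v g"
    and w: "w \<in> L2_space U" "h \<in> L2_space U" "has_weak_grad U w h"
  shows "has_weak_grad U (\<lambda>x. a * v x + b * w x) (\<lambda>x. a *\<^sub>R g x + b *\<^sub>R h x)"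
  unfolding has_weak_grad_def
proof (intro allI impI)
  fix \<phi> d\<phi> assume \<phi>: "test_fun U \<phi>" and "\<forall>x. GDERIV \<phi> x :> d\<phi> x"
  then have d\<phi>: "\<And>x. GDERIV \<phi> x :> d\<phi> x" by blast
  have Ul: "U \<in> lmeasurable" using U by (simp add: lmeasurable_open)
  obtain B where B: "B \<ge> 0" "\<And>x. \<bar>\<phi> x\<bar> \<le> B" "\<And>x. norm (d\<phi> x) \<le> B"
    using test_fun_bounds[OF \<phi> d\<phi>] by auto
  note c = test_fun_continuous[OF \<phi>] test_fun_gradient_continuous[OF \<phi> d\<phi>]
  note i = integrable_bounded_continuous_scaleR[OF L2_integrable[OF Ul v(1)] c(2) B(3)]
    integrable_bounded_continuous_scaleR[OF L2_integrable[OF Ul w(1)] c(2) B(3)]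
    integrable_bounded_continuous_mult_right[OF L2_integrable[OF Ul v(2)] c(1) B(2)]
    integrable_bounded_continuous_mult_right[OF L2_integrable[OF Ul w(2)] c(1) B(2)]
  have "(\<integral>x. (a * v x + b * w x) *\<^sub>R d\<phi> x \<partial>lebesgue_on U) =
      (\<integral>x. a *\<^sub>R (v x *\<^sub>R d\<phi> x) + b *\<^sub>R (w x *\<^sub>R d\<phi> x) \<partial>lebesgue_on U)"
    by (simp add: scaleR_add_left)
  also have "\<dots> = a *\<^sub>R (\<integral>x. v x *\<^sub>R d\<phi> x \<partial>lebesgue_on U) + b *\<^sub>R (\<integral>x. w x *\<^sub>R d\<phi> x \<partial>lebesgue_on U)"
    using i by (simp del: scaleR_scaleR)
  also have "\<dots> = - (a *\<^sub>R (\<integral>x. \<phi> x *\<^sub>R g x \<partial>lebesgue_on U) + b *\<^sub>R (\<integral>x. \<phi> x *\<^sub>R h x \<partial>lebesgue_on U))"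
    using v(3)[unfolded has_weak_grad_def, rule_format, OF \<phi> d\<phi>]
      w(3)[unfolded has_weak_grad_def, rule_format, OF \<phi> d\<phi>] by simp
  also have "\<dots> = - (\<integral>x. a *\<^sub>R (\<phi> x *\<^sub>R g x) + b *\<^sub>R (\<phi> x *\<^sub>R h x) \<partial>lebesgue_on U)"
    using i by (simp del: scaleR_scaleR)
  also have "\<dots> = - (\<integral>x. \<phi> x *\<^sub>R (a *\<^sub>R g x + b *\<^sub>R h x) \<partial>lebesgue_on U)"
    by (simp add: scaleR_add_right mult.commute)
  finally show "(\<integral>x. (a * v x + b * w x) *\<^sub>R d\<phi> x \<partial>lebesgue_on U) =
      - (\<integral>x. \<phi> x *\<^sub>R (a *\<^sub>R g x + b *\<^sub>R h x) \<partial>lebesgue_on U)" .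
qed

lemma weak_grad_H1:
  assumes "v \<in> H1_space U"
  shows "weak_grad U v \<in> L2_space U" "has_weak_grad U v (weak_grad U v)" "v \<in> L2_space U"
proof -
  have "\<exists>g. g \<in> L2_space U \<and> has_weak_grad U v g" "v \<in> L2_space U"
    using assms by (auto simp: H1_space_def)
  then show "weak_grad U v \<in> L2_space U" "has_weak_grad U v (weak_grad U v)" "v \<in> L2_space U"
    unfolding weak_grad_def by (metis (mono_tags, lifting) someI_ex)+
qed

text \<open>Since \<open>weak_grad\<close> selects a representative, its linearity can only hold
  almost everywhere; it follows by uniqueness from the linearity of the relation
  \<open>has_weak_grad\<close>.\<close>

lemma H1_space_lincomb:
  assumes U: "open U" "bounded U" and v: "v \<in> H1_space U" and w: "w \<in> H1_space U"
  shows "(\<lambda>x. a * v x + b * w x) \<in> H1_space U"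
    and "AE x in lebesgue_on U. weak_grad U (\<lambda>x. a * v x + b * w x) x = a *\<^sub>R weak_grad U v x + b *\<^sub>R weak_grad U w x"
proof -
  note gv = weak_grad_H1[OF v] and gw = weak_grad_H1[OF w]
  have L: "(\<lambda>x. a *\<^sub>R weak_grad U v x + b *\<^sub>R weak_grad U w x) \<in> L2_space U"
    by (intro L2_space_add L2_space_scale gv gw)
  note W = has_weak_grad_lincomb[OF U gv(3,1,2) gw(3,1,2), of a b]
  show H: "(\<lambda>x. a * v x + b * w x) \<in> H1_space U"
    unfolding H1_space_def
    using L W L2_space_add[OF L2_space_scale[OF gv(3)] L2_space_scale[OF gw(3)], of a b] by auto
  show "AE x in lebesgue_on U. weak_grad U (\<lambda>x. a * v x + b * w x) x = a *\<^sub>R weak_grad U v x + b *\<^sub>R weak_grad U w x"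
    by (rule has_weak_grad_unique[OF U weak_grad_H1(1,2)[OF H] L W])
qed

lemma L2_norm_on_add_le:
  assumes "f \<in> L2_space S" "g \<in> L2_space S"
  shows "(L2_norm_on S (\<lambda>x. f x + g x))\<^sup>2 \<le> 2 * (L2_norm_on S f)\<^sup>2 + 2 * (L2_norm_on S g)\<^sup>2"
proof -
  note i = L2_spaceD(2)[OF assms(1)] L2_spaceD(2)[OF assms(2)]
  have "(norm (f x + g x))\<^sup>2 \<le> 2 * (norm (f x))\<^sup>2 + 2 * (norm (g x))\<^sup>2" for x
  proof -
    have "(norm (f x + g x))\<^sup>2 \<le> (norm (f x) + norm (g x))\<^sup>2"
      by (intro power_mono norm_triangle_ineq) auto
    also have "\<dots> \<le> 2 * (norm (f x))\<^sup>2 + 2 * (norm (g x))\<^sup>2"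
      using sum_squares_bound[of "norm (f x)" "norm (g x)"] by (simp add: power2_sum)
    finally show ?thesis .
  qed
  then have "(\<integral>x. (norm (f x + g x))\<^sup>2 \<partial>lebesgue_on S) \<le> (\<integral>x. 2 * (norm (f x))\<^sup>2 + 2 * (norm (g x))\<^sup>2 \<partial>lebesgue_on S)"
    by (intro integral_mono L2_spaceD(2)[OF L2_space_add[OF assms]]) (use i in auto)
  then show ?thesis unfolding L2_norm_on_sq using i by simp
qed

lemma L2_norm_on_scale: "(L2_norm_on S (\<lambda>x. a *\<^sub>R f x))\<^sup>2 = a\<^sup>2 * (L2_norm_on S f)\<^sup>2"
  unfolding L2_norm_on_sq by (simp add: power_mult_distrib)

lemma L2_norm_on_cong_AE:
  assumes "f \<in> L2_space S" "g \<in> L2_space S" "AE x in lebesgue_on S. f x = g x"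
  shows "L2_norm_on S f = L2_norm_on S g"
  unfolding L2_norm_on_def
  using assms(3) L2_spaceD[OF assms(1)] L2_spaceD[OF assms(2)]
  by (intro arg_cong[where f = sqrt] integral_cong_AE) (auto elim: eventually_mono)

text \<open>A crude bound on squares, inherited from the pointwise one, takes the place of the
  triangle inequality for the H1 norm; it suffices for the density argument in
  \<open>H10_space_lincomb\<close>.\<close>

lemma H1_norm_lincomb_le:
  assumes U: "open U" "bounded U" and v: "v \<in> H1_space U" and w: "w \<in> H1_space U"
  shows "(H1_norm U (\<lambda>x. a * v x + b * w x))\<^sup>2 \<le> 2 * a\<^sup>2 * (H1_norm U v)\<^sup>2 + 2 * b\<^sup>2 * (H1_norm U w)\<^sup>2"
proof -
  note gv = weak_grad_H1[OF v] and gw = weak_grad_H1[OF w]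
  note H = H1_space_lincomb[OF U v w, of a b]
  have sq: "(H1_norm U u)\<^sup>2 = (L2_norm_on U u)\<^sup>2 + (L2_norm_on U (weak_grad U u))\<^sup>2" for u
    by (simp add: H1_norm_def)
  have "L2_norm_on U (weak_grad U (\<lambda>x. a * v x + b * w x)) =
      L2_norm_on U (\<lambda>x. a *\<^sub>R weak_grad U v x + b *\<^sub>R weak_grad U w x)"
    by (intro L2_norm_on_cong_AE weak_grad_H1[OF H(1)] H(2) L2_space_add L2_space_scale gv gw)
  moreover have "(L2_norm_on U (\<lambda>x. a *\<^sub>R weak_grad U v x + b *\<^sub>R weak_grad U w x))\<^sup>2
     \<le> 2 * (a\<^sup>2 * (L2_norm_on U (weak_grad U v))\<^sup>2) + 2 * (b\<^sup>2 * (L2_norm_on U (weak_grad U w))\<^sup>2)"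
    using L2_norm_on_add_le[OF L2_space_scale[OF gv(1)] L2_space_scale[OF gw(1)], of a b]
    by (simp only: L2_norm_on_scale)
  moreover have "(L2_norm_on U (\<lambda>x. a *\<^sub>R v x + b *\<^sub>R w x))\<^sup>2
     \<le> 2 * (a\<^sup>2 * (L2_norm_on U v)\<^sup>2) + 2 * (b\<^sup>2 * (L2_norm_on U w)\<^sup>2)"
    using L2_norm_on_add_le[OF L2_space_scale[OF gv(3)] L2_space_scale[OF gw(3)], of a b]
    by (simp only: L2_norm_on_scale)
  ultimately show ?thesis unfolding sq by (simp add: algebra_simps)
qed

lemma test_fun_H1:
  assumes U: "open U" "bounded U" and \<psi>: "test_fun U \<psi>"
  shows "\<psi> \<in> H1_space U"
proof -
  have Ul: "U \<in> lmeasurable" using U by (simp add: lmeasurable_open)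
  obtain d\<psi> where d\<psi>: "\<And>x. GDERIV \<psi> x :> d\<psi> x" using test_fun_has_gradient[OF \<psi>] by blast
  obtain B where B: "B \<ge> 0" "\<And>x. \<bar>\<psi> x\<bar> \<le> B" "\<And>x. norm (d\<psi> x) \<le> B"
    using test_fun_bounds[OF \<psi> d\<psi>] by auto
  have L2: "h \<in> L2_space U" if "continuous_on UNIV h" "\<And>x. norm (h x) \<le> B"
    for h :: "real^'a \<Rightarrow> 'b::euclidean_space"
  proof -
    have m: "h \<in> borel_measurable (lebesgue_on U)"
      using that(1) by (intro measurable_restrict_space1 measurable_completion)
        (simp add: borel_measurable_continuous_onI)
    have "integrable (lebesgue_on U) (\<lambda>x. (norm (h x))\<^sup>2)"
    proof (rule Bochner_Integration.integrable_bound[where f = "\<lambda>x. B\<^sup>2"])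
      show "integrable (lebesgue_on U) (\<lambda>x. B\<^sup>2)"
        using Ul by (intro finite_measure.integrable_const finite_measure_lebesgue_on)
      show "AE x in lebesgue_on U. norm ((norm (h x))\<^sup>2) \<le> norm (B\<^sup>2)"
        using that(2) B(1) by (intro AE_I2) (simp add: power_mono)
    qed (use m in auto)
    with m show ?thesis by (simp add: L2_space_def)
  qed
  have "\<psi> \<in> L2_space U" "d\<psi> \<in> L2_space U"
    using B test_fun_continuous[OF \<psi>] test_fun_gradient_continuous[OF \<psi> d\<psi>] by (auto intro!: L2)
  with test_fun_has_weak_grad[OF U(1) \<psi> d\<psi>] show ?thesis by (auto simp: H1_space_def)
qed

lemma H10_space_lincomb:
  assumes U: "open U" "bounded U" and v: "v \<in> H10_space U" and w: "w \<in> H10_space U"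
  shows "(\<lambda>x. a * v x + b * w x) \<in> H10_space U"
proof -
  have v1: "v \<in> H1_space U" and w1: "w \<in> H1_space U" using v w by (auto simp: H10_space_def)
  have "\<exists>\<phi>. test_fun U \<phi> \<and> H1_norm U (\<lambda>x. (a * v x + b * w x) - \<phi> x) < \<epsilon>" if "\<epsilon> > 0" for \<epsilon>
  proof -
    \<comment> \<open>Chosen so that
      \<open>2 * (a\<^sup>2 + b\<^sup>2) * \<epsilon>'\<^sup>2\<close> stays strictly below
      \<open>\<epsilon>\<^sup>2\<close>, also for \<open>a = b = 0\<close>.\<close>
    define \<epsilon>' where "\<epsilon>' = \<epsilon> / (2 * (1 + \<bar>a\<bar> + \<bar>b\<bar>))"
    have \<epsilon>': "\<epsilon>' > 0" using that by (simp add: \<epsilon>'_def add_pos_nonneg)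
    obtain \<phi> where \<phi>: "test_fun U \<phi>" "H1_norm U (\<lambda>x. v x - \<phi> x) < \<epsilon>'"
      using v \<epsilon>' by (auto simp: H10_space_def)
    obtain \<psi> where \<psi>: "test_fun U \<psi>" "H1_norm U (\<lambda>x. w x - \<psi> x) < \<epsilon>'"
      using w \<epsilon>' by (auto simp: H10_space_def)
    have H1: "(\<lambda>x. v x - \<phi> x) \<in> H1_space U" "(\<lambda>x. w x - \<psi> x) \<in> H1_space U"
      using H1_space_lincomb(1)[OF U v1 test_fun_H1[OF U \<phi>(1)], of 1 "-1"]
        H1_space_lincomb(1)[OF U w1 test_fun_H1[OF U \<psi>(1)], of 1 "-1"] by simp_all
    have nn: "0 \<le> H1_norm U u" for u :: "real^'a \<Rightarrow> real" by (simp add: H1_norm_def)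
    have "(H1_norm U (\<lambda>x. a * (v x - \<phi> x) + b * (w x - \<psi> x)))\<^sup>2
        \<le> 2 * a\<^sup>2 * (H1_norm U (\<lambda>x. v x - \<phi> x))\<^sup>2 + 2 * b\<^sup>2 * (H1_norm U (\<lambda>x. w x - \<psi> x))\<^sup>2"
      by (rule H1_norm_lincomb_le[OF U H1])
    also have "\<dots> \<le> 2 * a\<^sup>2 * \<epsilon>'\<^sup>2 + 2 * b\<^sup>2 * \<epsilon>'\<^sup>2"
      using \<phi>(2) \<psi>(2) nn by (intro add_mono mult_left_mono power_mono) (auto intro: less_imp_le)
    also have "\<dots> = 2 * (\<bar>a\<bar>\<^sup>2 + \<bar>b\<bar>\<^sup>2) * \<epsilon>'\<^sup>2" by (simp add: algebra_simps)
    also have "\<dots> < (2 * (1 + \<bar>a\<bar> + \<bar>b\<bar>))\<^sup>2 * \<epsilon>'\<^sup>2"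
    proof (rule mult_strict_right_mono)
      have "2 * (x\<^sup>2 + y\<^sup>2) < (2 * (1 + x + y))\<^sup>2" if "0 \<le> x" "0 \<le> y" for x y :: real
      proof -
        have "(2 * (1 + x + y))\<^sup>2 - 2 * (x\<^sup>2 + y\<^sup>2) = 4 + 2 * x\<^sup>2 + 2 * y\<^sup>2 + 8 * x + 8 * y + 8 * (x * y)"
          by (simp add: power2_eq_square algebra_simps)
        also have "\<dots> > 0" using that by (intro add_pos_nonneg) auto
        finally show ?thesis by simp
      qed
      then show "2 * (\<bar>a\<bar>\<^sup>2 + \<bar>b\<bar>\<^sup>2) < (2 * (1 + \<bar>a\<bar> + \<bar>b\<bar>))\<^sup>2" by (meson abs_ge_zero)
    qed (use \<epsilon>' in simp)
    also have "\<dots> = \<epsilon>\<^sup>2"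
    proof -
      have "2 * (1 + \<bar>a\<bar> + \<bar>b\<bar>) * \<epsilon>' = \<epsilon>"
      proof -
        have "2 * (1 + \<bar>a\<bar> + \<bar>b\<bar>) > 0" by (simp add: add_pos_nonneg)
        then show ?thesis by (simp add: \<epsilon>'_def)
      qed
      then show ?thesis by (metis power_mult_distrib)
    qed
    finally have "H1_norm U (\<lambda>x. a * (v x - \<phi> x) + b * (w x - \<psi> x)) < \<epsilon>"
      using that by (simp add: power_less_imp_less_base)
    then have "H1_norm U (\<lambda>x. (a * v x + b * w x) - (a * \<phi> x + b * \<psi> x)) < \<epsilon>"
      by (simp add: algebra_simps)
    moreover have "test_fun U (\<lambda>x. a * \<phi> x + b * \<psi> x)"
      by (intro test_fun_add test_fun_scale \<phi> \<psi>)
    ultimately show ?thesis by blast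
  qed
  then show ?thesis using H1_space_lincomb(1)[OF U v1 w1] by (auto simp: H10_space_def)
qed

lemma H10_space_0:
  assumes U: "open U" "bounded U"
  shows "(\<lambda>x. 0) \<in> H10_space U"
proof -
  have H: "(\<lambda>x. 0) \<in> H1_space U" by (rule test_fun_H1[OF U test_fun_0])
  have "(H1_norm U (\<lambda>x. 0 * 0 + 0 * 0))\<^sup>2 \<le> 0"
    using H1_norm_lincomb_le[OF U H H, of 0 0] by simp
  then have "H1_norm U (\<lambda>x. 0) = 0" by simp
  then show ?thesis using H test_fun_0 by (auto simp: H10_space_def intro!: exI[of _ "\<lambda>x. 0"])
qed

section \<open>The energy norm\<close>

text \<open>The coefficient matrix is controlled only in the interiors of the initial elements.
  Frontiers of convex sets are null sets, so these interiors cover \<open>U\<close> up to a null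
  set, and the finitely many local bounds add up to a global one.\<close>

lemma Linf_space_piecewise:
  fixes f :: "real^'n \<Rightarrow> real"
  assumes U: "open U" and M: "finite M" "\<And>T. T \<in> M \<Longrightarrow> convex T" "U \<subseteq> \<Union>M"
    and f: "\<And>T. T \<in> M \<Longrightarrow> f \<in> Linf_space (interior T)"
  shows "f \<in> Linf_space U"
proof -
  define V where "V = (\<Union>T\<in>M. interior T)"
  have Vo: "open V" by (auto simp: V_def)
  have "negligible (\<Union>T\<in>M. frontier T)"
    using M by (intro negligible_Union) (auto intro: negligible_convex_frontier)
  moreover have "U - V \<subseteq> (\<Union>T\<in>M. frontier T)"
  proof
    fix x assume x: "x \<in> U - V"
    then obtain T where "T \<in> M" "x \<in> T" "x \<notin> interior T" using M(3) by (auto simp: V_def)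
    then show "x \<in> (\<Union>T\<in>M. frontier T)" using closure_subset[of T] by (auto simp: frontier_def)
  qed
  ultimately have N: "U - V \<in> null_sets lebesgue"
    by (metis negligible_iff_null_sets negligible_subset)
  have "f \<in> borel_measurable (lebesgue_on (U \<inter> V))"
  proof (rule measurable_piecewise_restrict[where C = "interior ` M"])
    fix W assume "W \<in> interior ` M"
    then obtain T where T: "T \<in> M" "W = interior T" by auto
    have "f \<in> borel_measurable (lebesgue_on (U \<inter> V \<inter> W))"
      using f[OF T(1)] T(2) by (auto simp: Linf_space_def intro: measurable_restrict_mono)
    then show "f \<in> borel_measurable (restrict_space (lebesgue_on (U \<inter> V)) W)"
      using U Vo T by (subst restrict_restrict_space) auto
    show "W \<inter> space (lebesgue_on (U \<inter> V)) \<in> sets (lebesgue_on (U \<inter> V))"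
      using T U Vo by (subst sets_restrict_space_iff) auto
  qed (use M in \<open>auto simp: V_def intro: countable_finite\<close>)
  moreover have "U \<inter> V = U - (U - V)" by auto
  moreover have "U - V \<in> null_sets (lebesgue_on U)"
    using N U by (simp add: null_sets_restrict_space)
  ultimately have m: "f \<in> borel_measurable (lebesgue_on U)"
    using borel_measurable_diff_null[of "U - V" U f] U by auto
  have "\<forall>T\<in>M. \<exists>B. AE x in lebesgue_on (interior T). norm (f x) \<le> B"
    using f by (auto simp: Linf_space_def)
  then obtain B where B: "\<And>T. T \<in> M \<Longrightarrow> AE x in lebesgue_on (interior T). norm (f x) \<le> B T"
    by metis
  have "AE x in lebesgue. \<forall>T\<in>M. x \<in> interior T \<longrightarrow> norm (f x) \<le> B T"
    using B M(1) by (intro AE_finite_allI) (auto simp: AE_restrict_space_iff)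
  moreover have "AE x in lebesgue. x \<notin> U - V" using N by (rule AE_not_in)
  ultimately have "AE x in lebesgue. x \<in> U \<longrightarrow> norm (f x) \<le> (\<Sum>T\<in>M. \<bar>B T\<bar>)"
  proof eventually_elim
    case (elim x)
    show ?case
    proof
      assume "x \<in> U"
      with elim obtain T where T: "T \<in> M" "norm (f x) \<le> B T" by (auto simp: V_def)
      note T(2)
      also have "B T \<le> \<bar>B T\<bar>" by simp
      also have "\<dots> \<le> (\<Sum>T\<in>M. \<bar>B T\<bar>)" using M T by (intro member_le_sum) auto
      finally show "norm (f x) \<le> (\<Sum>T\<in>M. \<bar>B T\<bar>)" by simp
    qed
  qed
  then have "AE x in lebesgue_on U. norm (f x) \<le> (\<Sum>T\<in>M. \<bar>B T\<bar>)"
    using U by (simp add: AE_restrict_space_iff)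
  then show ?thesis using m by (auto simp: Linf_space_def)
qed

lemma borel_measurable_vec_components:
  fixes f :: "'a \<Rightarrow> real^'n"
  shows "f \<in> borel_measurable M \<longleftrightarrow> (\<forall>i. (\<lambda>x. f x $ i) \<in> borel_measurable M)"
  by (subst borel_measurable_euclidean_space) (auto simp: Basis_vec_def inner_axis)

lemma L2_space_matrix_mult:
  fixes A :: "real^'n \<Rightarrow> real^'n^'n"
  assumes A: "\<And>i j. (\<lambda>x. A x $ i $ j) \<in> Linf_space U" and g: "g \<in> L2_space U"
  shows "(\<lambda>x. A x *v g x) \<in> L2_space U"
proof -
  have "\<forall>i j. \<exists>B. AE x in lebesgue_on U. norm (A x $ i $ j) \<le> B"
    using A by (auto simp: Linf_space_def)
  then obtain B where B: "\<And>i j. AE x in lebesgue_on U. norm (A x $ i $ j) \<le> B i j" by metis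
  show ?thesis
  proof (rule L2_space_bounded_mult[OF g, where B = "\<Sum>i\<in>UNIV. \<Sum>j\<in>UNIV. B i j"])
    show "(\<lambda>x. A x *v g x) \<in> borel_measurable (lebesgue_on U)"
    proof -
      have "(\<lambda>x. A x $ i $ j) \<in> borel_measurable (lebesgue_on U)" for i j
        using A[of i j] by (simp add: Linf_space_def)
      moreover have "(\<lambda>x. g x $ j) \<in> borel_measurable (lebesgue_on U)" for j
        using L2_spaceD(1)[OF g] by (simp add: borel_measurable_vec_components)
      ultimately show ?thesis
        by (simp add: borel_measurable_vec_components matrix_vector_mult_def borel_measurable_times borel_measurable_sum)
    qed
    have "AE x in lebesgue_on U. \<forall>i j. norm (A x $ i $ j) \<le> B i j"
      using B by (simp add: AE_all_countable)
    then show "AE x in lebesgue_on U. norm (A x *v g x) \<le> (\<Sum>i\<in>UNIV. \<Sum>j\<in>UNIV. B i j) * norm (g x)"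
    proof eventually_elim
      case (elim x)
      have "norm (A x *v g x) \<le> (\<Sum>i\<in>UNIV. \<bar>(A x *v g x) $ i\<bar>)" by (rule norm_le_l1_cart)
      also have "\<dots> \<le> (\<Sum>i\<in>UNIV. \<Sum>j\<in>UNIV. B i j * norm (g x))"
      proof (rule sum_mono)
        fix i
        have "\<bar>(A x *v g x) $ i\<bar> \<le> (\<Sum>j\<in>UNIV. \<bar>A x $ i $ j * g x $ j\<bar>)"
          unfolding matrix_vector_mult_def by (simp add: sum_abs)
        also have "\<dots> \<le> (\<Sum>j\<in>UNIV. B i j * norm (g x))"
          unfolding abs_mult using elim
          by (intro sum_mono mult_mono component_le_norm_cart) (auto intro: order_trans[OF abs_ge_zero])
        finally show "\<bar>(A x *v g x) $ i\<bar> \<le> (\<Sum>j\<in>UNIV. B i j * norm (g x))" .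
      qed
      finally show ?case by (simp add: sum_distrib_right)
    qed
  qed
qed

lemma L2_space_inner_Linf:
  fixes b g :: "real^'n \<Rightarrow> 'b::euclidean_space"
  assumes b: "b \<in> Linf_space U" and g: "g \<in> L2_space U"
  shows "(\<lambda>x. b x \<bullet> g x) \<in> L2_space U"
proof -
  obtain B where B: "AE x in lebesgue_on U. norm (b x) \<le> B" and bm: "b \<in> borel_measurable (lebesgue_on U)"
    using b by (auto simp: Linf_space_def)
  show ?thesis
  proof (rule L2_space_bounded_mult[OF g])
    show "(\<lambda>x. b x \<bullet> g x) \<in> borel_measurable (lebesgue_on U)"
      using bm L2_spaceD(1)[OF g] by (rule borel_measurable_inner)
    show "AE x in lebesgue_on U. norm (b x \<bullet> g x) \<le> B * norm (g x)"
      using B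
    proof eventually_elim
      case (elim x)
      have "norm (b x \<bullet> g x) \<le> norm (b x) * norm (g x)" by (simp add: Cauchy_Schwarz_ineq2)
      also have "\<dots> \<le> B * norm (g x)" using elim by (intro mult_right_mono) auto
      finally show ?case .
    qed
  qed
qed

lemma model_problem_dom:
  assumes "model_problem P"
  shows "open (dom P)" "bounded (dom P)"
  using assms by (auto simp: model_problem_def polyhedral_lipschitz_domain_def)

lemma model_problem_matA:
  assumes P: "model_problem P"
  shows "(\<lambda>x. matA P x $ i $ j) \<in> Linf_space (dom P)"
proof (rule Linf_space_piecewise[where M = "elem ` T0 P"])
  have c: "conforming (dom P) (T0 P)" using P by (simp add: model_problem_def)
  show "finite (elem ` T0 P)" using c by (simp add: conforming_def)
  show "dom P \<subseteq> \<Union>(elem ` T0 P)" using c closure_subset unfolding conforming_def by metis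
  show "convex T" if "T \<in> elem ` T0 P" for T using that by (auto simp: elem_def convex_convex_hull)
  show "(\<lambda>x. matA P x $ i $ j) \<in> Linf_space (interior T)" if "T \<in> elem ` T0 P" for T
    using P that by (auto simp: model_problem_def W1inf_space_def)
qed (use model_problem_dom[OF P] in auto)

lemma H10_lincomb:
  assumes P: "model_problem P" and "v \<in> H10 P" "w \<in> H10 P"
  shows "(\<lambda>x. a * v x + b * w x) \<in> H10 P"
  using H10_space_lincomb[OF model_problem_dom[OF P]] assms by blast

lemma H10_diff:
  assumes P: "model_problem P" and "v \<in> H10 P" "w \<in> H10 P"
  shows "(\<lambda>x. v x - w x) \<in> H10 P"
  using H10_lincomb[OF assms, of 1 "-1"] by simp

lemma H10_D:
  assumes P: "model_problem P" and "v \<in> H10 P"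
  shows "v \<in> L2_space (dom P)" "grad P v \<in> L2_space (dom P)"
  using assms(2) weak_grad_H1[of v "dom P"] by (auto simp: H10_space_def)

lemma grad_lincomb:
  assumes P: "model_problem P" and "v \<in> H10 P" "w \<in> H10 P"
  shows "AE x in lebesgue_on (dom P). grad P (\<lambda>x. a * v x + b * w x) x = a *\<^sub>R grad P v x + b *\<^sub>R grad P w x"
  using H1_space_lincomb(2)[OF model_problem_dom[OF P]] assms(2,3) by (simp add: H10_space_def)

text \<open>The integral of a non-integrable function is zero by convention, so integrability has to
  be known before \<open>bform\<close> can be shown to be bilinear.\<close>

lemma bform_terms_integrable:
  assumes P: "model_problem P" and v: "v \<in> H10 P" and w: "w \<in> H10 P"
  shows "integrable (lebesgue_on (dom P)) (\<lambda>x. (matA P x *v grad P v x) \<bullet> grad P w x)"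
    "integrable (lebesgue_on (dom P)) (\<lambda>x. (vecb P x \<bullet> grad P v x + coefc P x * v x) * w x)"
proof -
  note V = H10_D[OF P v] and W = H10_D[OF P w]
  show "integrable (lebesgue_on (dom P)) (\<lambda>x. (matA P x *v grad P v x) \<bullet> grad P w x)"
    by (intro L2_inner_integrable L2_space_matrix_mult model_problem_matA[OF P] V W)
  have "(\<lambda>x. vecb P x \<bullet> grad P v x + coefc P x \<bullet> v x) \<in> L2_space (dom P)"
    using P by (intro L2_space_add L2_space_inner_Linf V) (auto simp: model_problem_def)
  from L2_inner_integrable[OF this W(1)]
  show "integrable (lebesgue_on (dom P)) (\<lambda>x. (vecb P x \<bullet> grad P v x + coefc P x * v x) * w x)"
    by simp
qed

lemma integral_lincomb:
  fixes f g :: "'a \<Rightarrow> real"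
  assumes "integrable M f" "integrable M g"
  shows "(\<integral>x. a * f x + b * g x \<partial>M) = a * (\<integral>x. f x \<partial>M) + b * (\<integral>x. g x \<partial>M)"
    and "(\<lambda>x. a * f x + b * g x) \<in> borel_measurable M"
  using assms by auto

lemma bform_lincomb_left:
  assumes P: "model_problem P" and v: "v \<in> H10 P" and v': "v' \<in> H10 P" and w: "w \<in> H10 P"
  shows "bform P (\<lambda>x. a * v x + b * v' x) w = a * bform P v w + b * bform P v' w"
proof -
  let ?M = "lebesgue_on (dom P)"
  let ?u = "\<lambda>x. a * v x + b * v' x"
  note i = bform_terms_integrable[OF P v w] bform_terms_integrable[OF P v' w]
    bform_terms_integrable[OF P H10_lincomb[OF P v v', of a b] w]
  note g = grad_lincomb[OF P v v', of a b]
  have "(\<integral>x. (matA P x *v grad P ?u x) \<bullet> grad P w x \<partial>?M) =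
     (\<integral>x. a * ((matA P x *v grad P v x) \<bullet> grad P w x) + b * ((matA P x *v grad P v' x) \<bullet> grad P w x) \<partial>?M)"
    using g by (intro integral_cong_AE borel_measurable_integrable i integral_lincomb)
      (auto simp: matrix_vector_right_distrib matrix_vector_mult_scaleR inner_add_left elim: eventually_mono)
  moreover have "(\<integral>x. (vecb P x \<bullet> grad P ?u x + coefc P x * ?u x) * w x \<partial>?M) =
     (\<integral>x. a * ((vecb P x \<bullet> grad P v x + coefc P x * v x) * w x) + b * ((vecb P x \<bullet> grad P v' x + coefc P x * v' x) * w x) \<partial>?M)"
    using g by (intro integral_cong_AE borel_measurable_integrable i integral_lincomb)
      (auto simp: inner_add_right algebra_simps elim: eventually_mono)
  ultimately show ?thesis
    unfolding bform_def by (simp only: integral_lincomb[OF i(1,3)] integral_lincomb[OF i(2,4)]) (simp only: algebra_simps)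
qed

lemma bform_lincomb_right:
  assumes P: "model_problem P" and v: "v \<in> H10 P" and v': "v' \<in> H10 P" and w: "w \<in> H10 P"
  shows "bform P w (\<lambda>x. a * v x + b * v' x) = a * bform P w v + b * bform P w v'"
proof -
  let ?M = "lebesgue_on (dom P)"
  let ?u = "\<lambda>x. a * v x + b * v' x"
  note i = bform_terms_integrable[OF P w v] bform_terms_integrable[OF P w v']
    bform_terms_integrable[OF P w H10_lincomb[OF P v v', of a b]]
  note g = grad_lincomb[OF P v v', of a b]
  have "(\<integral>x. (matA P x *v grad P w x) \<bullet> grad P ?u x \<partial>?M) =
     (\<integral>x. a * ((matA P x *v grad P w x) \<bullet> grad P v x) + b * ((matA P x *v grad P w x) \<bullet> grad P v' x) \<partial>?M)"
    using g by (intro integral_cong_AE borel_measurable_integrable i integral_lincomb)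
      (auto simp: inner_add_right elim: eventually_mono)
  moreover have "(\<integral>x. (vecb P x \<bullet> grad P w x + coefc P x * w x) * ?u x \<partial>?M) =
     (\<integral>x. a * ((vecb P x \<bullet> grad P w x + coefc P x * w x) * v x) + b * ((vecb P x \<bullet> grad P w x + coefc P x * w x) * v' x) \<partial>?M)"
    by (simp add: algebra_simps)
  ultimately show ?thesis
    unfolding bform_def by (simp only: integral_lincomb[OF i(1,3)] integral_lincomb[OF i(2,4)]) (simp only: algebra_simps)
qed

lemma bform_nonneg:
  assumes P: "model_problem P" and v: "v \<in> H10 P"
  shows "0 \<le> bform P v v"
proof -
  obtain C where "C > 0" "C * (H1_norm (dom P) v)\<^sup>2 \<le> bform P v v"
    using P v unfolding model_problem_def by blast
  moreover have "0 \<le> C * (H1_norm (dom P) v)\<^sup>2" using \<open>C > 0\<close> by simp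
  ultimately show ?thesis by linarith
qed

text \<open>Cauchy-Schwarz for the scalar product \<open>a\<close>, the symmetric part of the form:
  the quadratic form is nonnegative at \<open>s * v - t * w\<close>, and
  \<open>s = enorm P w\<close>, \<open>t = enorm P v\<close> are inserted.\<close>

lemma bform_symmetric_part_le:
  assumes P: "model_problem P" and v: "v \<in> H10 P" and w: "w \<in> H10 P"
  shows "bform P v w + bform P w v \<le> 2 * (enorm P v * enorm P w)"
proof -
  have q: "0 \<le> s\<^sup>2 * bform P v v + t\<^sup>2 * bform P w w - s * t * (bform P v w + bform P w v)" for s t
  proof -
    have u: "(\<lambda>x. s * v x + (- t) * w x) \<in> H10 P" by (rule H10_lincomb[OF P v w])
    have "bform P (\<lambda>x. s * v x + (- t) * w x) (\<lambda>x. s * v x + (- t) * w x)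
      = s * (s * bform P v v + (- t) * bform P v w) + (- t) * (s * bform P w v + (- t) * bform P w w)"
      by (simp only: bform_lincomb_left[OF P v w u] bform_lincomb_right[OF P v w v] bform_lincomb_right[OF P v w w])
    then show ?thesis using bform_nonneg[OF P u] by (simp add: power2_eq_square algebra_simps)
  qed
  have V: "(enorm P v)\<^sup>2 = bform P v v" "(enorm P w)\<^sup>2 = bform P w w" "0 \<le> enorm P v" "0 \<le> enorm P w"
    using bform_nonneg[OF P v] bform_nonneg[OF P w] by (auto simp: enorm_def)
  define c where "c = bform P v w + bform P w v"
  consider "enorm P v * enorm P w > 0" | "enorm P v = 0" | "enorm P w = 0"
    using V(3,4) by (metis less_eq_real_def mult_pos_pos)
  then have "c \<le> 2 * (enorm P v * enorm P w)"
  proof cases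
    case 1
    have "enorm P v * enorm P w * c \<le> enorm P v * enorm P w * (2 * (enorm P v * enorm P w))"
      using q[of "enorm P w" "enorm P v"] unfolding V(1,2)[symmetric] c_def by (simp add: power2_eq_square algebra_simps)
    then show ?thesis using 1 by (simp only: mult_le_cancel_left_pos)
  next
    case 2
    show ?thesis
    proof (rule ccontr)
      assume "\<not> ?thesis"
      then have c: "c > 0" using 2 by simp
      \<comment> \<open>With \<open>enorm P v = 0\<close> the quadratic form is affine in
        \<open>s\<close>; this \<open>s\<close> makes the mixed term exceed the remaining square by
        one.\<close>
      have "0 \<le> (enorm P w)\<^sup>2 - ((enorm P w)\<^sup>2 + 1)"
        using q[of "((enorm P w)\<^sup>2 + 1) / c" 1] 2 c unfolding V(1,2)[symmetric] c_def[symmetric] by simp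
      then show False by simp
    qed
  next
    case 3
    show ?thesis
    proof (rule ccontr)
      assume "\<not> ?thesis"
      then have c: "c > 0" using 3 by simp
      have "0 \<le> (enorm P v)\<^sup>2 - ((enorm P v)\<^sup>2 + 1)"
        using q[of 1 "((enorm P v)\<^sup>2 + 1) / c"] 3 c unfolding V(1,2)[symmetric] c_def[symmetric] by simp
      then show False by simp
    qed
  qed
  then show ?thesis by (simp add: c_def)
qed

lemma enorm_nonneg: "model_problem P \<Longrightarrow> v \<in> H10 P \<Longrightarrow> 0 \<le> enorm P v"
  using bform_nonneg by (simp add: enorm_def)

lemma edist_nonneg: "model_problem P \<Longrightarrow> v \<in> H10 P \<Longrightarrow> w \<in> H10 P \<Longrightarrow> 0 \<le> edist P v w"
  by (intro enorm_nonneg H10_diff)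

text \<open>Only the symmetric part of the mixed terms survives when \<open>bform\<close> is
  expanded at the sum, so its lack of symmetry does no harm.\<close>

lemma enorm_triangle:
  assumes P: "model_problem P" and v: "v \<in> H10 P" and w: "w \<in> H10 P"
  shows "enorm P (\<lambda>x. v x + w x) \<le> enorm P v + enorm P w"
proof -
  have u: "(\<lambda>x. 1 * v x + 1 * w x) \<in> H10 P" by (rule H10_lincomb[OF P v w])
  have "bform P (\<lambda>x. 1 * v x + 1 * w x) (\<lambda>x. 1 * v x + 1 * w x)
      = 1 * (1 * bform P v v + 1 * bform P v w) + 1 * (1 * bform P w v + 1 * bform P w w)"
    by (simp only: bform_lincomb_left[OF P v w u] bform_lincomb_right[OF P v w v] bform_lincomb_right[OF P v w w])
  then have "bform P (\<lambda>x. v x + w x) (\<lambda>x. v x + w x) = bform P v v + (bform P v w + bform P w v) + bform P w w"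
    by simp
  also have "\<dots> \<le> bform P v v + 2 * (enorm P v * enorm P w) + bform P w w"
    using bform_symmetric_part_le[OF P v w] by simp
  also have "\<dots> = (enorm P v + enorm P w)\<^sup>2"
    using bform_nonneg[OF P v] bform_nonneg[OF P w] by (simp add: enorm_def power2_sum)
  finally show ?thesis
    using enorm_nonneg[OF P v] enorm_nonneg[OF P w] unfolding enorm_def[of P "\<lambda>x. v x + w x"]
    by (intro real_le_lsqrt) auto
qed

lemma edist_triangle:
  assumes P: "model_problem P" and "u \<in> H10 P" "v \<in> H10 P" "w \<in> H10 P"
  shows "edist P u w \<le> edist P u v + edist P v w"
  using enorm_triangle[OF P H10_diff[OF P assms(2,3)] H10_diff[OF P assms(3,4)]] by simp

lemma edist_commute:
  assumes P: "model_problem P" and v: "v \<in> H10 P" and w: "w \<in> H10 P"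
  shows "edist P v w = edist P w v"
proof -
  have u: "(\<lambda>x. w x - v x) \<in> H10 P" by (rule H10_diff[OF P w v])
  have u': "(\<lambda>x. (-1) * (w x - v x) + 0 * (w x - v x)) \<in> H10 P" by (rule H10_lincomb[OF P u u])
  have "bform P (\<lambda>x. (-1) * (w x - v x) + 0 * (w x - v x)) (\<lambda>x. (-1) * (w x - v x) + 0 * (w x - v x))
      = bform P (\<lambda>x. w x - v x) (\<lambda>x. w x - v x)"
    by (subst bform_lincomb_left[OF P u u u'], subst bform_lincomb_right[OF P u u u]) simp
  then show ?thesis by (simp add: enorm_def)
qed

lemma edist_self:
  assumes P: "model_problem P" and v: "v \<in> H10 P"
  shows "edist P v v = 0"
proof -
  have u: "(\<lambda>x. 0 * v x + 0 * v x) \<in> H10 P" by (rule H10_lincomb[OF P v v])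
  have "bform P (\<lambda>x. 0 * v x + 0 * v x) (\<lambda>x. 0 * v x + 0 * v x) = 0"
    by (subst bform_lincomb_left[OF P v v u]) simp
  then show ?thesis by (simp add: enorm_def)
qed

section \<open>Finite element spaces\<close>

lemma elem_sets_lebesgue [simp]: "elem T \<in> sets lebesgue"
  unfolding elem_def by (intro lmeasurable_compact[THEN fmeasurableD] compact_convex_hull finite_imp_compact) simp

text \<open>The vertices of a child are old vertices and the midpoint of an old edge, hence lie in
  the convex hull of the parent.\<close>

lemma children_elem_subset:
  assumes T: "length (fst T) \<ge> 2" and T': "T' \<in> children T"
  shows "length (fst T') \<ge> 2 \<and> elem T' \<subseteq> elem T"
proof -
  define vs where "vs = fst T"
  let ?m = "midpoint (hd vs) (last vs)" and ?inner = "butlast (tl vs)"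
  have vs: "vs \<noteq> []" "length vs \<ge> 2" using T by (auto simp: vs_def)
  have inner: "set ?inner \<subseteq> set vs" using vs by (meson in_set_butlastD list.set_sel(2) subsetI)
  have len: "length ?inner = length vs - 2" by simp
  have "fst T' \<in> {hd vs # ?m # ?inner, last vs # ?m # take (snd T) ?inner @ rev (drop (snd T) ?inner)}"
    using T' by (auto simp: children_def Let_def vs_def)
  then have "set (fst T') \<subseteq> insert ?m (set vs)" "length (fst T') \<ge> 2"
    using inner vs len subset_trans[OF set_take_subset[of "snd T" ?inner] inner]
      subset_trans[OF set_drop_subset[of "snd T" ?inner] inner] by auto
  moreover have "?m \<in> convex hull (set vs)"
  proof -
    have "hd vs \<in> convex hull (set vs)" "last vs \<in> convex hull (set vs)"
      using vs by (auto intro: hull_inc)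
    then show ?thesis
      using midpoint_in_closed_segment closed_segment_subset[OF _ _ convex_convex_hull] by blast
  qed
  ultimately have "set (fst T') \<subseteq> convex hull (set vs)"
    using hull_subset[of "set vs" convex] by blast
  then have "elem T' \<subseteq> elem T"
    unfolding elem_def vs_def by (intro hull_minimal) (auto simp: convex_convex_hull)
  with \<open>length (fst T') \<ge> 2\<close> show ?thesis by simp
qed

text \<open>Intermediate meshes of a bisection sequence may be non-conforming; the length of the
  vertex lists serves as the invariant that every bisection preserves.\<close>

lemma bisects_elem_subset:
  assumes "bisects\<^sup>*\<^sup>* M M'" and "\<forall>T\<in>M. length (fst T) \<ge> 2"
  shows "\<forall>T'\<in>M'. length (fst T') \<ge> 2 \<and> (\<exists>T\<in>M. elem T' \<subseteq> elem T)"
  using assms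
proof (induction rule: rtranclp_induct)
  case base
  then show ?case by blast
next
  case (step M1 M2)
  then obtain S where S: "S \<in> M1" "M2 = (M1 - {S}) \<union> children S" by (auto simp: bisects_def)
  show ?case
  proof
    fix T' assume "T' \<in> M2"
    then consider "T' \<in> M1" | "T' \<in> children S" using S by blast
    then show "length (fst T') \<ge> 2 \<and> (\<exists>T\<in>M. elem T' \<subseteq> elem T)"
    proof cases
      case 2
      have "length (fst S) \<ge> 2" "\<exists>T\<in>M. elem S \<subseteq> elem T" using step S by auto
      with children_elem_subset[OF _ 2] show ?thesis by (meson order_trans)
    qed (use step in blast)
  qed
qed

lemma refinements_trans:
  "M' \<in> refinements U M \<Longrightarrow> M'' \<in> refinements U M' \<Longrightarrow> M'' \<in> refinements U M"
  by (auto simp: refinements_def)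

lemma refinements_refl: "conforming U M \<Longrightarrow> M \<in> refinements U M"
  by (simp add: refinements_def)

lemma meshes_conforming: "M \<in> meshes P \<Longrightarrow> conforming (dom P) M"
  by (simp add: meshes_def refinements_def)

lemma meshes_refinements: "M \<in> meshes P \<Longrightarrow> M' \<in> refinements (dom P) M \<Longrightarrow> M' \<in> meshes P"
  unfolding meshes_def by (rule refinements_trans)

lemma meshes_finite: "M \<in> meshes P \<Longrightarrow> finite M"
  using meshes_conforming by (auto simp: conforming_def)

lemma meshes_cover: "M \<in> meshes P \<Longrightarrow> dom P \<subseteq> \<Union>(elem ` M)"
  using meshes_conforming closure_subset unfolding conforming_def by metis

lemma AE_lebesgue_on_subset:
  assumes "AE x in lebesgue_on S. Q x" "S \<in> sets lebesgue" "T \<in> sets lebesgue" "T \<subseteq> S"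
  shows "AE x in lebesgue_on T. Q x"
  using assms by (auto simp: AE_restrict_space_iff elim: eventually_mono)

text \<open>Each element of the finer mesh lies in one of the coarser mesh and inherits its
  polynomial. Nestedness is needed for quasi-orthogonality and for evaluating the estimator of a
  coarse function on the finer mesh.\<close>

lemma fe_space_mono:
  assumes M: "conforming (dom P) M" and M': "M' \<in> refinements (dom P) M"
  shows "fe_space P p M \<subseteq> fe_space P p M'"
proof
  fix v assume v: "v \<in> fe_space P p M"
  have "\<forall>T\<in>M. length (fst T) \<ge> 2"
    using M by (auto simp: conforming_def tsimplex_def Suc_le_eq)
  then have sub: "\<forall>T'\<in>M'. \<exists>T\<in>M. elem T' \<subseteq> elem T"
    using bisects_elem_subset[of M M'] M' by (auto simp: refinements_def)
  have "\<exists>q. poly_deg_le p q \<and> (AE x in lebesgue_on (elem T'). v x = q x)" if T': "T' \<in> M'" for T'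
  proof -
    obtain T where T: "T \<in> M" "elem T' \<subseteq> elem T" using sub T' by blast
    then obtain q where "poly_deg_le p q" "AE x in lebesgue_on (elem T). v x = q x"
      using v by (auto simp: fe_space_def)
    then show ?thesis using AE_lebesgue_on_subset[OF _ _ _ T(2)] by auto
  qed
  then show "v \<in> fe_space P p M'" using v by (auto simp: fe_space_def)
qed

lemma fe_space_H10: "v \<in> fe_space P p M \<Longrightarrow> v \<in> H10 P"
  by (simp add: fe_space_def)

section \<open>Finite dimension of the finite element spaces\<close>

lemma poly_deg_le_lincomb:
  fixes q r :: "real^'n \<Rightarrow> real"
  assumes "poly_deg_le p q" "poly_deg_le p r"
  shows "poly_deg_le p (\<lambda>x. a * q x + b * r x)"
proof -
  let ?S = "{\<alpha> :: 'n \<Rightarrow> nat. sum \<alpha> UNIV \<le> p}"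
  let ?m = "\<lambda>\<alpha> (x::real^'n). \<Prod>i\<in>UNIV. (x $ i) ^ \<alpha> i"
  obtain c d where "\<And>x. q x = (\<Sum>\<alpha>\<in>?S. c \<alpha> * ?m \<alpha> x)" "\<And>x. r x = (\<Sum>\<alpha>\<in>?S. d \<alpha> * ?m \<alpha> x)"
    using assms by (auto simp: poly_deg_le_def)
  then have "\<forall>x. a * q x + b * r x = (\<Sum>\<alpha>\<in>?S. (a * c \<alpha> + b * d \<alpha>) * ?m \<alpha> x)"
    by (simp add: sum_distrib_left sum.distrib algebra_simps)
  then show ?thesis unfolding poly_deg_le_def by (rule exI[of _ "\<lambda>\<alpha>. a * c \<alpha> + b * d \<alpha>"])
qed

lemma fe_space_lincomb:
  assumes P: "model_problem P" and v: "v \<in> fe_space P p M" and w: "w \<in> fe_space P p M"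
  shows "(\<lambda>x. a * v x + b * w x) \<in> fe_space P p M"
proof -
  have "\<exists>q. poly_deg_le p q \<and> (AE x in lebesgue_on (elem T). a * v x + b * w x = q x)" if T: "T \<in> M" for T
  proof -
    obtain q where q: "poly_deg_le p q" "AE x in lebesgue_on (elem T). v x = q x"
      using v T by (auto simp: fe_space_def)
    obtain r where r: "poly_deg_le p r" "AE x in lebesgue_on (elem T). w x = r x"
      using w T by (auto simp: fe_space_def)
    have "AE x in lebesgue_on (elem T). a * v x + b * w x = a * q x + b * r x"
      using q(2) r(2) by eventually_elim simp
    then show ?thesis using poly_deg_le_lincomb[OF q(1) r(1)] by blast
  qed
  then show ?thesis using H10_lincomb[OF P fe_space_H10[OF v] fe_space_H10[OF w]] by (auto simp: fe_space_def)
qed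

text \<open>The coordinates form a relation since a function equal to a polynomial on a subset need not
  determine its coefficients.\<close>
lemma finite_spanning_set:
  fixes V :: "('a \<Rightarrow> real) set" and D :: "('a \<Rightarrow> real) \<Rightarrow> ('i \<Rightarrow> real) \<Rightarrow> bool"
  assumes "finite J"
    and D: "\<And>v w c d a b. D v c \<Longrightarrow> D w d \<Longrightarrow> D (\<lambda>x. a * v x + b * w x) (\<lambda>i. a * c i + b * d i)"
    and zero: "\<And>v. D v (\<lambda>i. 0) \<Longrightarrow> AE x in N. v x = 0"
    and V: "\<And>v w a b. v \<in> V \<Longrightarrow> w \<in> V \<Longrightarrow> (\<lambda>x. a * v x + b * w x) \<in> V"
    and ex: "\<And>v. v \<in> V \<Longrightarrow> \<exists>c. D v c \<and> (\<forall>i. i \<notin> J \<longrightarrow> c i = 0)"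
  shows "\<exists>B. finite B \<and> B \<subseteq> V \<and> (\<forall>v\<in>V. \<exists>c. AE x in N. v x = (\<Sum>\<beta>\<in>B. c \<beta> * \<beta> x))"
  using \<open>finite J\<close> V ex
proof (induction J arbitrary: V rule: finite_induct)
  case empty
  have "AE x in N. v x = 0" if "v \<in> V" for v
  proof -
    obtain c where "D v c" "\<forall>i. c i = 0" using empty.prems(2)[OF \<open>v \<in> V\<close>] by auto
    then have "c = (\<lambda>i. 0)" by auto
    with \<open>D v c\<close> show ?thesis using zero by simp
  qed
  then show ?case by (intro exI[of _ "{}"]) auto
next
  case (insert j J)
  \<comment> \<open>The subspace of functions that admit coordinates vanishing at \<open>j\<close>;
    the induction hypothesis provides its spanning set.\<close>
  define V' where "V' = {v \<in> V. \<exists>c. D v c \<and> (\<forall>i. i \<notin> J \<longrightarrow> c i = 0)}"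
  have "\<exists>B. finite B \<and> B \<subseteq> V' \<and> (\<forall>v\<in>V'. \<exists>c. AE x in N. v x = (\<Sum>\<beta>\<in>B. c \<beta> * \<beta> x))"
  proof (rule insert.IH)
    fix v w a b assume "v \<in> V'" "w \<in> V'"
    then obtain c d where "v \<in> V" "w \<in> V" "D v c" "D w d"
      "\<forall>i. i \<notin> J \<longrightarrow> c i = 0" "\<forall>i. i \<notin> J \<longrightarrow> d i = 0" by (auto simp: V'_def)
    then show "(\<lambda>x. a * v x + b * w x) \<in> V'"
      using insert.prems(1)[of v w a b] D[of v c w d a b]
      by (auto simp: V'_def intro!: exI[of _ "\<lambda>i. a * c i + b * d i"])
  qed (auto simp: V'_def)
  then obtain B where B: "finite B" "B \<subseteq> V'" "\<And>v. v \<in> V' \<Longrightarrow> \<exists>c. AE x in N. v x = (\<Sum>\<beta>\<in>B. c \<beta> * \<beta> x)"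
    by blast
  show ?case
  proof (cases "V' = V")
    case True
    then show ?thesis using B by blast
  next
    case False
    moreover have "V' \<subseteq> V" by (auto simp: V'_def)
    ultimately obtain u where u: "u \<in> V" "u \<notin> V'" by blast
    obtain e where e: "D u e" "\<forall>i. i \<notin> insert j J \<longrightarrow> e i = 0" using insert.prems(2)[OF u(1)] by blast
    \<comment> \<open>One additional vector with nonzero coordinate at \<open>j\<close> suffices:
      subtracting a multiple of it moves any element of \<open>V\<close> into
      \<open>V'\<close>.\<close>
    with u have ej: "e j \<noteq> 0" by (auto simp: V'_def)
    have "\<exists>c. AE x in N. v x = (\<Sum>\<beta>\<in>insert u B. c \<beta> * \<beta> x)" if v: "v \<in> V" for v
    proof -
      obtain c where c: "D v c" "\<forall>i. i \<notin> insert j J \<longrightarrow> c i = 0" using insert.prems(2)[OF v] by blast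
      define t where "t = c j / e j"
      have "D (\<lambda>x. 1 * v x + (- t) * u x) (\<lambda>i. 1 * c i + (- t) * e i)" by (rule D[OF c(1) e(1)])
      moreover have "1 * c i + (- t) * e i = 0" if "i \<notin> J" for i
        using that c(2) e(2) ej by (cases "i = j") (auto simp: t_def)
      ultimately have "(\<lambda>x. 1 * v x + (- t) * u x) \<in> V'"
        using insert.prems(1)[OF v u(1), of 1 "- t"] by (auto simp: V'_def)
      then obtain d where d: "AE x in N. 1 * v x + (- t) * u x = (\<Sum>\<beta>\<in>B. d \<beta> * \<beta> x)" using B(3) by blast
      have uB: "u \<notin> B" using u B(2) by blast
      have "AE x in N. v x = (\<Sum>\<beta>\<in>insert u B. (if \<beta> = u then t else d \<beta>) * \<beta> x)"
        using d
      proof eventually_elim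
        case (elim x)
        have "(\<Sum>\<beta>\<in>B. (if \<beta> = u then t else d \<beta>) * \<beta> x) = (\<Sum>\<beta>\<in>B. d \<beta> * \<beta> x)"
          using uB by (intro sum.cong) auto
        then show ?case using elim uB B(1) by simp
      qed
      then show ?thesis by (rule exI[of _ "\<lambda>\<beta>. if \<beta> = u then t else d \<beta>"])
    qed
    then show ?thesis using B u by (intro exI[of _ "insert u B"]) (auto simp: V'_def)
  qed
qed

text \<open>The monomial coefficients on all elements serve as coordinates. There are finitely many
  of them, and a function with all coordinates zero vanishes almost everywhere because the elements
  cover the domain.\<close>

lemma fin_dim_fe_space:
  fixes P :: "'n::finite problem"
  assumes P: "model_problem P" and M: "M \<in> meshes P"
  shows "fin_dim_space (dom P) (fe_space P p M)"
proof -
  let ?V = "fe_space P p M"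
  let ?S = "{\<alpha> :: 'n \<Rightarrow> nat. sum \<alpha> UNIV \<le> p}"
  let ?m = "\<lambda>\<alpha> (x::real^'n). \<Prod>i\<in>UNIV. (x $ i) ^ \<alpha> i"
  have zero: "(\<lambda>x. 0) \<in> ?V"
    using H10_space_0[OF model_problem_dom[OF P]]
    by (auto simp: fe_space_def poly_deg_le_def intro!: exI[of _ "\<lambda>x. 0"] exI[of _ "\<lambda>\<alpha>. 0"])
  have "?S \<subseteq> PiE UNIV (\<lambda>i. {..p})"
  proof
    fix \<alpha> :: "'n \<Rightarrow> nat" assume "\<alpha> \<in> ?S"
    moreover have "\<alpha> i \<le> sum \<alpha> UNIV" for i by (rule member_le_sum) auto
    ultimately have "\<alpha> i \<le> p" for i using order_trans by blast
    then show "\<alpha> \<in> PiE UNIV (\<lambda>i. {..p})" by (simp add: PiE_UNIV_domain)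
  qed
  then have S: "finite ?S" by (rule finite_subset) (intro finite_PiE, auto)
  define D where "D v c \<longleftrightarrow> (\<forall>T\<in>M. AE x in lebesgue_on (elem T). v x = (\<Sum>\<alpha>\<in>?S. c (T, \<alpha>) * ?m \<alpha> x))"
    for v :: "real^'n \<Rightarrow> real" and c :: "'n tsimplex \<times> ('n \<Rightarrow> nat) \<Rightarrow> real"
  have "\<exists>B. finite B \<and> B \<subseteq> ?V \<and> (\<forall>v\<in>?V. \<exists>c. AE x in lebesgue_on (dom P). v x = (\<Sum>\<beta>\<in>B. c \<beta> * \<beta> x))"
  proof (rule finite_spanning_set[where D = D])
    show "finite (M \<times> ?S)" using S meshes_finite[OF M] by simp
  next
    fix v w c d a b assume "D v c" "D w d"
    show "D (\<lambda>x. a * v x + b * w x) (\<lambda>i. a * c i + b * d i)"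
      unfolding D_def
    proof
      fix T assume "T \<in> M"
      with \<open>D v c\<close> \<open>D w d\<close> have "AE x in lebesgue_on (elem T). v x = (\<Sum>\<alpha>\<in>?S. c (T, \<alpha>) * ?m \<alpha> x)"
        "AE x in lebesgue_on (elem T). w x = (\<Sum>\<alpha>\<in>?S. d (T, \<alpha>) * ?m \<alpha> x)" by (auto simp: D_def)
      then show "AE x in lebesgue_on (elem T). a * v x + b * w x = (\<Sum>\<alpha>\<in>?S. (a * c (T, \<alpha>) + b * d (T, \<alpha>)) * ?m \<alpha> x)"
        by eventually_elim (simp add: sum_distrib_left sum.distrib algebra_simps)
    qed
  next
    fix v assume "D v (\<lambda>i. 0)"
    then have "AE x in lebesgue. \<forall>T\<in>M. x \<in> elem T \<longrightarrow> v x = 0"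
      using meshes_finite[OF M] by (intro AE_finite_allI) (auto simp: D_def AE_restrict_space_iff)
    then have "AE x in lebesgue. x \<in> dom P \<longrightarrow> v x = 0"
      by (rule eventually_mono) (use meshes_cover[OF M] in auto)
    then show "AE x in lebesgue_on (dom P). v x = 0"
      using model_problem_dom[OF P] by (simp add: AE_restrict_space_iff)
  next
    fix v assume v: "v \<in> ?V"
    have "\<forall>T\<in>M. \<exists>c. AE x in lebesgue_on (elem T). v x = (\<Sum>\<alpha>\<in>?S. c \<alpha> * ?m \<alpha> x)"
    proof
      fix T assume "T \<in> M"
      then obtain q where q: "poly_deg_le p q" "AE x in lebesgue_on (elem T). v x = q x"
        using v by (auto simp: fe_space_def)
      from q(1) obtain c where c: "\<forall>x. q x = (\<Sum>\<alpha>\<in>?S. c \<alpha> * ?m \<alpha> x)"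
        unfolding poly_deg_le_def by (elim exE)
      show "\<exists>c. AE x in lebesgue_on (elem T). v x = (\<Sum>\<alpha>\<in>?S. c \<alpha> * ?m \<alpha> x)"
        using q(2) c by (intro exI[of _ c]) simp
    qed
    from bchoice[OF this] obtain c
      where "\<forall>T\<in>M. AE x in lebesgue_on (elem T). v x = (\<Sum>\<alpha>\<in>?S. c T \<alpha> * ?m \<alpha> x)" ..
    note c = bspec[OF this]
    define c' where "c' = (\<lambda>(T, \<alpha>). if T \<in> M \<and> \<alpha> \<in> ?S then c T \<alpha> else 0)"
    have "D v c'" unfolding D_def
    proof
      fix T assume T: "T \<in> M"
      then have "(\<Sum>\<alpha>\<in>?S. c' (T, \<alpha>) * ?m \<alpha> x) = (\<Sum>\<alpha>\<in>?S. c T \<alpha> * ?m \<alpha> x)" for x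
        by (intro sum.cong) (auto simp: c'_def)
      then show "AE x in lebesgue_on (elem T). v x = (\<Sum>\<alpha>\<in>?S. c' (T, \<alpha>) * ?m \<alpha> x)" using c[OF T] by simp
    qed
    then show "\<exists>c. D v c \<and> (\<forall>i. i \<notin> M \<times> ?S \<longrightarrow> c i = 0)"
      by (intro exI[of _ c']) (auto simp: c'_def)
  qed (rule fe_space_lincomb[OF P])
  moreover have "(\<lambda>x. v x + w x) \<in> ?V" if "v \<in> ?V" "w \<in> ?V" for v w
    using fe_space_lincomb[OF P that, of 1 1] by simp
  moreover have "(\<lambda>x. a * v x) \<in> ?V" if "v \<in> ?V" for v a
    using fe_space_lincomb[OF P that that, of a 0] by simp
  ultimately show ?thesis using zero by (simp add: fin_dim_space_def)
qed

section \<open>The error estimator\<close>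

lemma facet_integral_nonneg: "(\<And>x. 0 \<le> g x) \<Longrightarrow> 0 \<le> facet_integral F n g"
  by (simp add: facet_integral_def)

lemma eta_sq_nonneg: "0 \<le> eta_sq P M T v"
  unfolding eta_sq_def Let_def
  by (intro add_nonneg_nonneg mult_nonneg_nonneg sum_nonneg facet_integral_nonneg) auto

lemma eta_nonneg: "0 \<le> eta P M U v"
  by (simp add: eta_def sum_nonneg eta_sq_nonneg)

lemma eta_power2: "(eta P M U v)\<^sup>2 = (\<Sum>T\<in>U. eta_sq P M T v)"
  by (simp add: eta_def sum_nonneg eta_sq_nonneg)

lemma eta_power2_split:
  assumes "finite M" "U \<subseteq> M"
  shows "(eta P M' M v)\<^sup>2 = (eta P M' U v)\<^sup>2 + (eta P M' (M - U) v)\<^sup>2"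
  unfolding eta_power2 using sum.subset_diff[OF assms(2,1)] by (simp add: add.commute)

lemma eta_subset_le:
  assumes "finite M" "U \<subseteq> M"
  shows "(eta P M' U v)\<^sup>2 \<le> (eta P M' M v)\<^sup>2"
  unfolding eta_power2 using assms by (intro sum_mono2) (auto simp: eta_sq_nonneg)

text \<open>On common elements the estimator of a fixed function does not change, since stability
  with both functions equal to \<open>v\<close> bounds the difference by zero. The refined part is
  reduced by the factor \<open>q\<close>, and squares add up.\<close>

lemma eta_refinement_le:
  assumes P: "model_problem P" and st: "stability P p C" and red: "reduction P p q" and q: "0 \<le> q"
    and M: "M \<in> meshes P" and M': "M' \<in> refinements (dom P) M" and v: "v \<in> fe_space P p M"
  shows "(eta P M' M' v)\<^sup>2 \<le> (eta P M M v)\<^sup>2 - (1 - q\<^sup>2) * (eta P M (M - M') v)\<^sup>2"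
proof -
  have v': "v \<in> fe_space P p M'" using fe_space_mono[OF meshes_conforming[OF M] M'] v by blast
  have fin: "finite M" "finite M'"
    using meshes_finite[OF M] meshes_finite[OF meshes_refinements[OF M M']] by auto
  have "\<bar>eta P M' (M \<inter> M') v - eta P M (M \<inter> M') v\<bar> \<le> C * edist P v v"
    using st M M' v v' unfolding stability_def by blast
  then have eq: "eta P M' (M \<inter> M') v = eta P M (M \<inter> M') v"
    by (simp add: edist_self[OF P fe_space_H10[OF v], simplified])
  have "eta P M' (M' - M) v \<le> q * eta P M (M - M') v"
    using red M M' v unfolding reduction_def by blast
  then have "(eta P M' (M' - M) v)\<^sup>2 \<le> (q * eta P M (M - M') v)\<^sup>2"
    by (intro power_mono) (auto simp: eta_nonneg)
  moreover have "(eta P M' M' v)\<^sup>2 = (eta P M' (M \<inter> M') v)\<^sup>2 + (eta P M' (M' - M) v)\<^sup>2"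
    using eta_power2_split[OF fin(2), of "M \<inter> M'" P M' v] by (simp add: Diff_Int)
  moreover have "(eta P M M v)\<^sup>2 = (eta P M (M \<inter> M') v)\<^sup>2 + (eta P M (M - M') v)\<^sup>2"
    using eta_power2_split[OF fin(1), of "M \<inter> M'" P M v] by (simp add: Diff_Int)
  ultimately show ?thesis unfolding eq by (simp add: power_mult_distrib algebra_simps)
qed

lemma eta_refinement_mono:
  assumes "model_problem P" "stability P p C" "reduction P p q" "0 \<le> q" "q \<le> 1"
    and "M \<in> meshes P" "M' \<in> refinements (dom P) M" "v \<in> fe_space P p M"
  shows "eta P M' M' v \<le> eta P M M v"
proof (rule power2_le_imp_le[OF _ eta_nonneg])
  have "0 \<le> (1 - q\<^sup>2) * (eta P M (M - M') v)\<^sup>2"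
    using \<open>0 \<le> q\<close> \<open>q \<le> 1\<close> by (simp add: power_le_one)
  then show "(eta P M' M' v)\<^sup>2 \<le> (eta P M M v)\<^sup>2"
    using eta_refinement_le[OF assms(1-4,6-8)] by linarith
qed

text \<open>All marked elements are refined, so \<open>M - M'\<close> satisfies the Doerfler
  criterion as well; at least the share \<open>\<theta>\<close> of the squared estimator is
  therefore reduced by the factor \<open>q\<^sup>2\<close>.\<close>

lemma eta_doerfler_reduction:
  assumes "model_problem P" "stability P p C" "reduction P p q" "0 \<le> q" "q \<le> 1"
    and M: "M \<in> meshes P" and "M' \<in> refinements (dom P) M" "v \<in> fe_space P p M"
    and R: "doerfler P \<theta> M v R" "R \<inter> M' = {}"
  shows "eta P M' M' v \<le> sqrt (1 - (1 - q\<^sup>2) * \<theta>) * eta P M M v"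
proof -
  have "R \<subseteq> M - M'" using R by (auto simp: doerfler_def)
  then have "\<theta> * (eta P M M v)\<^sup>2 \<le> (eta P M (M - M') v)\<^sup>2"
    using R eta_subset_le[of "M - M'" R P M v] meshes_finite[OF M] by (auto simp: doerfler_def)
  then have "(1 - q\<^sup>2) * (\<theta> * (eta P M M v)\<^sup>2) \<le> (1 - q\<^sup>2) * (eta P M (M - M') v)\<^sup>2"
    using \<open>0 \<le> q\<close> \<open>q \<le> 1\<close> by (intro mult_left_mono) (auto simp: power_le_one)
  then have "(eta P M' M' v)\<^sup>2 \<le> (1 - (1 - q\<^sup>2) * \<theta>) * (eta P M M v)\<^sup>2"
    using eta_refinement_le[OF assms(1-4) M assms(7,8)] by (simp add: algebra_simps)
  then have "sqrt ((eta P M' M' v)\<^sup>2) \<le> sqrt ((1 - (1 - q\<^sup>2) * \<theta>) * (eta P M M v)\<^sup>2)"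
    by (rule real_sqrt_le_mono)
  then show ?thesis by (simp add: real_sqrt_mult eta_nonneg)
qed

section \<open>R-linear convergence of abstract quasi-errors\<close>

text \<open>The decay comes from iterating over indices where \<open>Y\<close> has halved; these are at most \<open>N\<close>
  apart since the average of the next \<open>N\<close> values is at most half the current one.\<close>
lemma tail_sum_le:
  fixes Y :: "nat \<Rightarrow> real" and \<phi> :: "nat \<Rightarrow> real"
  assumes Y: "\<And>i. i \<le> J \<Longrightarrow> 0 \<le> Y i"
    and win: "\<And>j n. 1 \<le> n \<Longrightarrow> j + n \<le> J \<Longrightarrow> (\<Sum>i=Suc j..j+n. Y i) \<le> \<phi> n * Y j"
    and \<phi>: "\<And>n. n \<le> N \<Longrightarrow> \<phi> n \<le> real N / 2" and N: "1 \<le> N"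
  shows "j + n \<le> J \<Longrightarrow> (\<Sum>i=Suc j..j+n. Y i) \<le> real N * Y j"
proof (induction n arbitrary: j rule: less_induct)
  case (less n)
  have Yj: "0 \<le> Y j" using less.prems by (intro Y) simp
  have half: "\<phi> n' * Y j \<le> real N / 2 * Y j" if "n' \<le> N" for n'
    using \<phi>[OF that] Yj by (rule mult_right_mono)
  show ?case
  proof (cases "n \<le> N")
    case True
    show ?thesis
    proof (cases "n = 0")
      case False
      then have "(\<Sum>i=Suc j..j+n. Y i) \<le> real N / 2 * Y j"
        using win[of n j] half[OF True] less.prems by force
      also have "\<dots> \<le> real N * Y j" using Yj by (intro mult_right_mono) auto
      finally show ?thesis .
    qed (use Yj in simp)
  next
    case False
    have sumN: "(\<Sum>i=Suc j..j+N. Y i) \<le> real N / 2 * Y j"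
      using win[of N j] half[of N] less.prems N False by force
    \<comment> \<open>If all \<open>N\<close> values exceeded \<open>Y j / 2\<close>, their sum
      would exceed the bound just obtained.\<close>
    have "\<exists>i\<in>{Suc j..j+N}. Y i \<le> Y j / 2"
    proof (rule ccontr)
      assume "\<not> ?thesis"
      then have "(\<Sum>i=Suc j..j+N. Y j / 2) < (\<Sum>i=Suc j..j+N. Y i)"
        using N by (intro sum_strict_mono) (auto simp: not_le)
      then show False using sumN by simp
    qed
    then obtain i where i: "Suc j \<le> i" "i \<le> j + N" "Y i \<le> Y j / 2" by auto
    \<comment> \<open>Split where \<open>Y\<close> has halved: the first part is a window of at most
      \<open>N\<close> terms, the second is at most \<open>N * Y i\<close> by induction, and each
      contributes at most half of the claimed bound.\<close>
    define n1 n2 where "n1 = i - j" and "n2 = j + n - i"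
    have n12: "1 \<le> n1" "n1 \<le> N" "i = j + n1" "j + n = i + n2" "n2 < n"
      using i False by (auto simp: n1_def n2_def)
    have "(\<Sum>i=Suc j..j+n. Y i) = (\<Sum>i=Suc j..j+n1. Y i) + (\<Sum>k=Suc i..i+n2. Y k)"
      using sum.ub_add_nat[of "Suc j" "j + n1" Y n2] n12 by (simp add: add.assoc)
    also have "(\<Sum>i=Suc j..j+n1. Y i) \<le> real N / 2 * Y j"
      using win[of n1 j] half[of n1] less.prems n12 by force
    also have "(\<Sum>k=Suc i..i+n2. Y k) \<le> real N * Y i"
      using n12 less.prems by (intro less.IH) auto
    also have "real N * Y i \<le> real N / 2 * Y j"
      using mult_left_mono[OF i(3), of "real N"] by simp
    finally show ?thesis by simp
  qed
qed

text \<open>Each value \<open>f t\<close> is counted once for each of the \<open>L\<close> indices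
  with quotient \<open>t\<close>. This passes from sums over levels to sums over solve
  levels.\<close>

lemma sum_div_blocks:
  fixes f :: "nat \<Rightarrow> real"
  assumes "L \<ge> 1"
  shows "(\<Sum>i=j*L..<(j+n)*L. f (i div L)) = real L * (\<Sum>t=j..<j+n. f t)"
proof (induction n)
  case (Suc n)
  have "(\<Sum>i=j*L..<(j + Suc n)*L. f (i div L)) =
      (\<Sum>i=j*L..<(j+n)*L. f (i div L)) + (\<Sum>i=(j+n)*L..<(j + Suc n)*L. f (i div L))"
    by (intro sum.atLeastLessThan_concat[symmetric] mult_le_mono1) auto
  also have "(\<Sum>i=(j+n)*L..<(j + Suc n)*L. f (i div L)) = (\<Sum>i=(j+n)*L..<(j + Suc n)*L. f (j + n))"
  proof (intro sum.cong refl arg_cong[where f = f])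
    fix i assume "i \<in> {(j+n)*L..<(j + Suc n)*L}"
    then show "i div L = j + n" by (intro div_nat_eqI) (auto simp: algebra_simps)
  qed
  also have "\<dots> = real L * f (j + n)" by (simp add: algebra_simps)
  finally show ?case using Suc.IH by (simp add: algebra_simps)
qed simp

text \<open>The constants have a locale of their own because they must not depend on a run. Here
  \<open>q\<close> is the contraction factor of the solver, \<open>qt\<close> that of the estimator
  under Doerfler marking, \<open>Cs\<close> the stability constant; \<open>C0\<close> bounds the
  estimator by the algebraic error before stopping, \<open>Cd\<close> and \<open>s\<close> stem from
  quasi-orthogonality and reliability, \<open>Cm\<close> from quasi-monotonicity.\<close>

locale quasi_error_constants =
  fixes q qt Cs C0 Cd Cm s :: real
  assumes q: "0 < q" "q < 1" and qt: "0 \<le> qt" "qt < 1" and Cs: "0 < Cs" and C0: "0 \<le> C0"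
    and Cd: "0 \<le> Cd" and Cm: "1 \<le> Cm" and s: "0 < s" "s \<le> 1"
begin

text \<open>Large enough that half of \<open>weight * (1 - q)\<close> absorbs the algebraic error,
  with factor \<open>2 * Cs\<close>, in the estimator reduction; the added 1 keeps it at least
  one.\<close>

definition weight :: real where "weight = 4 * Cs / (1 - q) + 1"
definition contr :: real where "contr = max qt ((1 + q) / 2)"
text \<open>The division by \<open>1 - contr\<close> comes from absorbing \<open>contr\<close> times
  a sum of \<open>Y\<close> over a window into the left-hand side.\<close>

definition window_const :: real where "window_const = (1 + (Cs + weight) * Cd) / (1 - contr)"
text \<open>With \<open>a = 2 * window_const * L\<close>, taking
  \<open>N \<ge> a powr (1 / s)\<close> gives \<open>a \<le> N powr s\<close>, which makes the
  sublinear window bound at most \<open>N / 2\<close>; the added 1 keeps \<open>N\<close>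
  positive.\<close>

definition halving_steps :: "nat \<Rightarrow> nat" where "halving_steps L = nat \<lceil>(2 * window_const * real L) powr (1 / s)\<rceil> + 1"
text \<open>Growth of the quasi-error across at most \<open>L\<close> levels: the summands stand for
  the inherited algebraic error, quasi-monotonicity of the estimator, and the accumulated distances
  of discrete solutions.\<close>

definition block_const :: "nat \<Rightarrow> real" where "block_const L = 1 + Cm + Cd * real L"
definition level_const :: real where "level_const = 2 + (1 + C0) / (1 - q)"
text \<open>The first factor accounts for the steps inside one level and alone contains
  \<open>K\<close>. The second sums over levels: 1 for the current one, the next summand for those
  before the next solve level, the last for everything from there on.\<close>

definition lin_const :: "nat \<Rightarrow> nat \<Rightarrow> real" where
  "lin_const K L = (level_const + real K + 1) * (1 + real L * block_const L + real L * (block_const L)\<^sup>2 * weight * (1 + real (halving_steps L)))"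

lemma weight_ge_1: "1 \<le> weight" using q Cs by (simp add: weight_def)

lemma contr: "0 < contr" "contr < 1" "qt \<le> contr" "(1 + q) / 2 \<le> contr"
  using q qt by (auto simp: contr_def less_max_iff_disj)

lemma window_const_ge_1: "1 \<le> window_const"
proof -
  have "0 \<le> (Cs + weight) * Cd" using Cs weight_ge_1 Cd by (intro mult_nonneg_nonneg) auto
  then show ?thesis using contr by (simp add: window_const_def)
qed

lemma block_const_ge_1: "1 \<le> block_const L" using Cm Cd by (simp add: block_const_def)

lemma level_const_ge_2: "2 \<le> level_const" using q C0 by (simp add: level_const_def)

lemma lin_const_ge_2: "2 \<le> lin_const K L"
proof -
  have "0 \<le> real L * block_const L + real L * (block_const L)\<^sup>2 * weight * (1 + real (halving_steps L))"
    using block_const_ge_1[of L] weight_ge_1 by (intro add_nonneg_nonneg mult_nonneg_nonneg) auto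
  then have "2 * 1 \<le> lin_const K L" unfolding lin_const_def using level_const_ge_2 by (intro mult_mono) auto
  then show ?thesis by simp
qed

text \<open>In \<open>L\<close> the growth is polynomial of degree \<open>3 + 1 / s\<close>: one
  power from the number of levels per block, two from \<open>block_const\<close>, and
  \<open>1 / s\<close> from \<open>halving_steps\<close>. An exponential dominates this
  power.\<close>

lemma lin_const_growth: "\<exists>C c. \<forall>K\<ge>1. \<forall>L\<ge>1. lin_const K L \<le> C * real K * exp (c * real L)"
proof -
  define b n0 r where "b = 1 + Cm + Cd" and "n0 = 3 + (2 * window_const) powr (1 / s)" and "r = 1 / s"
  have r: "1 \<le> r" using s by (simp add: r_def)
  have b: "1 \<le> b" using Cm Cd by (simp add: b_def)
  have n0: "0 \<le> n0" by (simp add: n0_def)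
  have "lin_const K L \<le> (level_const + 2) * (1 + b + b\<^sup>2 * weight * n0) * real K * exp ((3 + r) * real L)"
    if K: "1 \<le> K" and L: "1 \<le> L" for K L
  proof -
    define x where "x = real L"
    have x: "1 \<le> x" using L by (simp add: x_def)
    have xr: "1 \<le> x powr r" using x r by (intro ge_one_powr_ge_zero) auto
    have Bx: "block_const L \<le> b * x"
      using x mult_right_mono[OF x, of "1 + Cm"] Cm by (simp add: block_const_def b_def x_def[symmetric] algebra_simps)
    have Nx: "1 + real (halving_steps L) \<le> n0 * x powr r"
    proof -
      have "0 \<le> (2 * window_const * x) powr r" by simp
      then have "0 \<le> \<lceil>(2 * window_const * x) powr r\<rceil>" by linarith
      then have "real (halving_steps L) \<le> (2 * window_const * x) powr r + 2"
        unfolding halving_steps_def x_def[symmetric] r_def[symmetric] by (simp add: of_nat_nat) linarith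
      also have "(2 * window_const * x) powr r = (2 * window_const) powr r * x powr r" by (simp add: powr_mult)
      finally show ?thesis using xr by (simp add: n0_def r_def[symmetric] algebra_simps)
    qed
    have pow: "x * x\<^sup>2 * x powr r = x powr (3 + r)"
      using x by (simp add: powr_add powr_numeral power2_eq_square power3_eq_cube)
    have "x powr (3 + r) = exp ((3 + r) * ln x)" using x by (simp add: powr_def)
    also have "\<dots> \<le> exp ((3 + r) * x)"
      using x r ln_le_minus_one[of x] by (simp add: mult_left_mono)
    finally have ex: "x powr (3 + r) \<le> exp ((3 + r) * x)" .
    have one: "1 \<le> x powr (3 + r)" using x r by (intro ge_one_powr_ge_zero) auto
    have "x * block_const L \<le> b * (x * x)" using mult_left_mono[OF Bx, of x] x by (simp add: algebra_simps)
    also have "\<dots> \<le> b * x powr (3 + r)"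
    proof (rule mult_left_mono)
      have "x * x = x powr 2" using x by (simp add: powr_numeral power2_eq_square)
      also have "\<dots> \<le> x powr (3 + r)" using x r by (intro powr_mono) auto
      finally show "x * x \<le> x powr (3 + r)" .
    qed (use b in simp)
    finally have t1: "x * block_const L \<le> b * x powr (3 + r)" .
    have "x * (block_const L)\<^sup>2 * weight * (1 + real (halving_steps L)) \<le> x * (b * x)\<^sup>2 * weight * (n0 * x powr r)"
      using x Bx Nx block_const_ge_1[of L] weight_ge_1 by (intro mult_mono power_mono mult_nonneg_nonneg) auto
    also have "\<dots> = b\<^sup>2 * weight * n0 * x powr (3 + r)"
      unfolding pow[symmetric] by (simp add: power2_eq_square algebra_simps)
    finally have t2: "x * (block_const L)\<^sup>2 * weight * (1 + real (halving_steps L)) \<le> b\<^sup>2 * weight * n0 * x powr (3 + r)" .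
    have c: "0 \<le> 1 + b + b\<^sup>2 * weight * n0"
      using b weight_ge_1 n0 by (intro add_nonneg_nonneg mult_nonneg_nonneg) auto
    have "lin_const K L \<le> ((level_const + 2) * real K) * ((1 + b + b\<^sup>2 * weight * n0) * exp ((3 + r) * x))"
      unfolding lin_const_def x_def[symmetric]
    proof (rule mult_mono)
      have "level_const + 1 \<le> (level_const + 1) * real K" using K level_const_ge_2 by simp
      then show "level_const + real K + 1 \<le> (level_const + 2) * real K" by (simp add: algebra_simps)
      have "1 + x * block_const L + x * (block_const L)\<^sup>2 * weight * (1 + real (halving_steps L)) \<le> (1 + b + b\<^sup>2 * weight * n0) * x powr (3 + r)"
        using one t1 t2 by (simp add: algebra_simps)
      also have "\<dots> \<le> (1 + b + b\<^sup>2 * weight * n0) * exp ((3 + r) * x)"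
        using c ex by (intro mult_left_mono)
      finally show "1 + x * block_const L + x * (block_const L)\<^sup>2 * weight * (1 + real (halving_steps L)) \<le> (1 + b + b\<^sup>2 * weight * n0) * exp ((3 + r) * x)" .
      show "0 \<le> (level_const + 2) * real K" using level_const_ge_2 by simp
      show "0 \<le> 1 + x * block_const L + x * (block_const L)\<^sup>2 * weight * (1 + real (halving_steps L))"
        using x block_const_ge_1[of L] weight_ge_1 by (intro add_nonneg_nonneg mult_nonneg_nonneg) auto
    qed
    then show ?thesis by (simp add: x_def mult_ac)
  qed
  then show ?thesis by blast
qed

end

text \<open>Abstract quasi-errors up to the last step \<open>(m, kk m)\<close>: \<open>g l\<close> stands for the estimator of the
  exact discrete solution on level \<open>l\<close>, \<open>e l k\<close> for the algebraic error, and \<open>d l\<close> for the distance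
  of consecutive discrete solutions.\<close>
locale quasi_error_sequence = quasi_error_constants +
  fixes K L m :: nat and kk :: "nat \<Rightarrow> nat"
    and e :: "nat \<Rightarrow> nat \<Rightarrow> real" and g d :: "nat \<Rightarrow> real"
  assumes L: "1 \<le> L"
    and e_nonneg: "\<And>l k. l \<le> m \<Longrightarrow> k \<le> kk l \<Longrightarrow> 0 \<le> e l k"
    and g_nonneg: "\<And>l. l \<le> m \<Longrightarrow> 0 \<le> g l"
    and g_mono: "\<And>l l'. l' \<le> l \<Longrightarrow> l \<le> m \<Longrightarrow> g l \<le> Cm * g l'"
    and d_sum: "\<And>l n. 1 \<le> n \<Longrightarrow> l + n \<le> m \<Longrightarrow> (\<Sum>i=l..<l+n. d i) \<le> Cd * real n powr (1 - s) * g l"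
    and e_next: "\<And>l. l < m \<Longrightarrow> e (Suc l) 0 \<le> e l (kk l) + d l"
    and e_solve: "\<And>l k. l \<le> m \<Longrightarrow> L dvd l \<Longrightarrow> k < kk l \<Longrightarrow> e l (Suc k) \<le> q * e l k"
    and e_smooth: "\<And>l k. l \<le> m \<Longrightarrow> \<not> L dvd l \<Longrightarrow> k < kk l \<Longrightarrow> e l (Suc k) \<le> e l k"
    and kk_smooth: "\<And>l. l \<le> m \<Longrightarrow> \<not> L dvd l \<Longrightarrow> kk l \<le> K"
    and kk_solve: "\<And>l. l < m \<Longrightarrow> L dvd l \<Longrightarrow> 1 \<le> kk l"
    and not_stopped: "\<And>l k. l \<le> m \<Longrightarrow> L dvd l \<Longrightarrow> Suc k < kk l \<Longrightarrow> g l \<le> C0 * e l k"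
    and g_reduction: "\<And>l. l < m \<Longrightarrow> L dvd l \<Longrightarrow> g (Suc l) \<le> qt * g l + Cs * (2 * e l (kk l) + d l)"
    and g_next: "\<And>l. l < m \<Longrightarrow> g (Suc l) \<le> g l + Cs * d l"
begin

section \<open>Growth of algebraic errors and estimators across levels\<close>

lemma e_decreasing:
  assumes l: "l \<le> m" and "k' \<le> k" "k \<le> kk l"
  shows "e l k \<le> e l k'"
  using assms(2,3)
proof (induction k rule: dec_induct)
  case (step k)
  have "e l (Suc k) \<le> e l k"
  proof (cases "L dvd l")
    case True
    have "e l (Suc k) \<le> q * e l k" using e_solve[OF l True] step by simp
    also have "\<dots> \<le> 1 * e l k" using q e_nonneg[OF l, of k] step by (intro mult_right_mono) auto
    finally show ?thesis by simp
  qed (use e_smooth[OF l] step in simp)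
  then show ?case using step by simp
qed simp

text \<open>Each level inherits its initial iterate, so passing to it costs only the distance of the
  discrete solutions, and no solver or smoother step increases the error.\<close>

lemma e_across:
  assumes "l' < l" "l \<le> m"
  shows "e l 0 \<le> e l' (kk l') + (\<Sum>i=l'..<l. d i)"
  using assms
proof (induction l rule: less_induct)
  case (less l)
  then obtain l1 where l1: "l = Suc l1" "l' \<le> l1" by (cases l) auto
  show ?case
  proof (cases "l' = l1")
    case False
    have "e l1 (kk l1) \<le> e l1 0" using l1 less.prems by (intro e_decreasing) auto
    also have "\<dots> \<le> e l' (kk l') + (\<Sum>i=l'..<l1. d i)" using False l1 less.prems by (intro less.IH) auto
    finally show ?thesis using e_next[of l1] l1 less.prems by simp
  qed (use e_next[of l1] l1 less.prems in simp)
qed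

lemma g_across:
  assumes "l' \<le> l" "l \<le> m"
  shows "g l \<le> g l' + Cs * (\<Sum>i=l'..<l. d i)"
  using assms
proof (induction l rule: dec_induct)
  case (step l)
  then show ?case using g_next[of l] by (simp add: algebra_simps)
qed simp

definition h :: "nat \<Rightarrow> nat \<Rightarrow> real" where "h l k = e l k + g l"

lemma h_nonneg: "l \<le> m \<Longrightarrow> k \<le> kk l \<Longrightarrow> 0 \<le> h l k"
  using e_nonneg g_nonneg by (simp add: h_def)

lemma d_sum_le:
  assumes "l' \<le> l" "l \<le> m" "l - l' \<le> L"
  shows "(\<Sum>i=l'..<l. d i) \<le> Cd * real L * g l'"
proof (cases "l' = l")
  case True
  then show ?thesis using Cd g_nonneg[of l] assms by simp
next
  case False
  then have n: "1 \<le> l - l'" "l' + (l - l') = l" using assms by auto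
  have "(\<Sum>i=l'..<l. d i) \<le> Cd * real (l - l') powr (1 - s) * g l'"
    using d_sum[of "l - l'" l'] n assms by simp
  also have "\<dots> \<le> Cd * real L * g l'"
  proof (intro mult_right_mono mult_left_mono)
    have "real (l - l') powr (1 - s) \<le> real (l - l') powr 1"
      using n s by (intro powr_mono) auto
    also have "\<dots> \<le> real L" using n assms by simp
    finally show "real (l - l') powr (1 - s) \<le> real L" .
  qed (use Cd g_nonneg[of l'] assms in auto)
  finally show ?thesis .
qed

text \<open>No decay is claimed: within one period the quasi-error grows at most by a constant
  factor, which connects arbitrary steps with neighbouring solve levels.\<close>

lemma h_block:
  assumes "l' < l" "l \<le> m" "l - l' \<le> L" "k' \<le> kk l'"
  shows "h l 0 \<le> block_const L * h l' k'"
proof -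
  have "e l 0 \<le> e l' (kk l') + (\<Sum>i=l'..<l. d i)" using assms by (intro e_across) auto
  also have "e l' (kk l') \<le> e l' k'" using assms by (intro e_decreasing) auto
  also have "(\<Sum>i=l'..<l. d i) \<le> Cd * real L * g l'" using assms by (intro d_sum_le) auto
  finally have "h l 0 \<le> e l' k' + Cd * real L * g l' + Cm * g l'"
    using g_mono[of l' l] assms by (simp add: h_def)
  also have "\<dots> \<le> block_const L * e l' k' + block_const L * g l'"
  proof -
    have e: "0 \<le> e l' k'" and g: "0 \<le> g l'" using assms by (auto intro: e_nonneg g_nonneg)
    have "1 * e l' k' \<le> block_const L * e l' k'" using block_const_ge_1[of L] e by (rule mult_right_mono)
    then show ?thesis using g by (simp add: block_const_def algebra_simps)
  qed
  finally show ?thesis by (simp add: h_def algebra_simps)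
qed

section \<open>Perturbed contraction from one solve level to the next\<close>

definition Y :: "nat \<Rightarrow> real" where "Y j = g (j * L) + weight * e (j * L) 0"

lemma Y_nonneg: "j * L \<le> m \<Longrightarrow> 0 \<le> Y j"
  using g_nonneg e_nonneg weight_ge_1 by (simp add: Y_def)

lemma h_le_Y: "j * L \<le> m \<Longrightarrow> h (j * L) 0 \<le> Y j"
  using e_nonneg[of "j * L" 0] weight_ge_1 mult_right_mono[of 1 weight "e (j * L) 0"] by (simp add: h_def Y_def)

lemma Y_le_h: "j * L \<le> m \<Longrightarrow> Y j \<le> weight * h (j * L) 0"
  using g_nonneg[of "j * L"] weight_ge_1 mult_right_mono[of 1 weight "g (j * L)"] by (simp add: h_def Y_def algebra_simps)

lemma Y_step:
  assumes "Suc j * L \<le> m"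
  shows "Y (Suc j) \<le> contr * Y j + (Cs + weight) * (\<Sum>i=j*L..<Suc j*L. d i)"
proof -
  let ?l = "j * L" let ?S = "\<Sum>i=j*L..<Suc j*L. d i"
  have l: "?l < m" "L dvd ?l" "Suc ?l \<le> Suc j * L" "?l < Suc j * L" using assms L by auto
  have kk: "1 \<le> kk ?l" using kk_solve l by blast
  have e0: "0 \<le> e ?l 0" and g0: "0 \<le> g ?l" using l e_nonneg g_nonneg by auto
  \<comment> \<open>Only the first solver step is used as a contraction; a solve level has at least
    one, and the others do not increase the error.\<close>
  have "e ?l (kk ?l) \<le> e ?l 1" using kk l by (intro e_decreasing) auto
  also have "e ?l 1 \<le> q * e ?l 0" using e_solve[of ?l 0] l kk by simp
  finally have E: "e ?l (kk ?l) \<le> q * e ?l 0" .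
  have e': "e (Suc j * L) 0 \<le> q * e ?l 0 + ?S"
    using e_across[OF l(4) assms] E by linarith
  have S: "?S = d ?l + (\<Sum>i=Suc ?l..<Suc j*L. d i)"
    using l(4) by (rule sum.atLeast_Suc_lessThan)
  have "g (Suc j * L) \<le> g (Suc ?l) + Cs * (\<Sum>i=Suc ?l..<Suc j*L. d i)"
    by (rule g_across[OF l(3) assms])
  also have "g (Suc ?l) \<le> qt * g ?l + Cs * (2 * e ?l (kk ?l) + d ?l)"
    using l by (intro g_reduction) auto
  also have "Cs * (2 * e ?l (kk ?l) + d ?l) \<le> Cs * (2 * (q * e ?l 0) + d ?l)"
    using E Cs by (intro mult_left_mono) auto
  finally have g': "g (Suc j * L) \<le> qt * g ?l + Cs * (2 * (q * e ?l 0)) + Cs * ?S"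
    unfolding S by (simp add: algebra_simps)
  \<comment> \<open>Half of the gap \<open>1 - q\<close>, scaled by \<open>weight\<close>, dominates
    \<open>2 * Cs\<close>; this inequality dictates the value of \<open>weight\<close>.\<close>
  have coef: "2 * Cs * q + weight * q \<le> contr * weight"
  proof -
    have "2 * Cs * q \<le> 2 * Cs * 1" using Cs q by (intro mult_left_mono) auto
    also have "\<dots> \<le> weight * ((1 - q) / 2)"
    proof -
      have "weight * (1 - q) = 4 * Cs + (1 - q)" using q by (simp add: weight_def field_simps)
      then show ?thesis using q by simp
    qed
    finally have "2 * Cs * q + weight * q \<le> ((1 + q) / 2) * weight" by (simp add: field_simps)
    also have "\<dots> \<le> contr * weight" using contr weight_ge_1 by (intro mult_right_mono) auto
    finally show ?thesis .
  qed
  have "Y (Suc j) \<le> qt * g ?l + (2 * Cs * q + weight * q) * e ?l 0 + (Cs + weight) * ?S"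
    using g' mult_left_mono[OF e', of weight] weight_ge_1 by (simp add: Y_def algebra_simps)
  also have "\<dots> \<le> contr * g ?l + (contr * weight) * e ?l 0 + (Cs + weight) * ?S"
    using mult_right_mono[OF contr(3) g0] mult_right_mono[OF coef e0] by linarith
  finally show ?thesis by (simp add: Y_def algebra_simps)
qed

text \<open>Summing \<open>Y_step\<close> puts the window sum \<open>W\<close> on the right with
  factor \<open>contr < 1\<close>, so it can be absorbed. Quasi-orthogonality is applied once to all
  \<open>n * L\<close> levels rather than to each block, which keeps the growth in \<open>n\<close>
  sublinear.\<close>

lemma Y_window:
  assumes n: "1 \<le> n" and m: "(j + n) * L \<le> m"
  shows "(\<Sum>i=Suc j..j+n. Y i) \<le> window_const * real (n * L) powr (1 - s) * Y j"
proof -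
  let ?x = "real (n * L) powr (1 - s)"
  have jm: "i * L \<le> m" if "i \<le> j + n" for i using that m by (meson le_trans mult_le_mono1)
  define W where "W = (\<Sum>i=Suc j..j+n. Y i)"
  have Yj: "0 \<le> Y j" by (intro Y_nonneg jm) simp
  have "W = (\<Sum>i=j..<j+n. Y (Suc i))"
    unfolding W_def by (subst sum.shift_bounds_Suc_ivl[symmetric]) (simp add: atLeastLessThanSuc_atLeastAtMost)
  also have "\<dots> \<le> (\<Sum>i=j..<j+n. contr * Y i + (Cs + weight) * (\<Sum>k=i*L..<Suc i*L. d k))"
    by (intro sum_mono Y_step jm) auto
  also have "\<dots> = contr * (\<Sum>i=j..<j+n. Y i) + (Cs + weight) * (\<Sum>i=j..<j+n. \<Sum>k=i*L..<Suc i*L. d k)"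
    by (simp only: sum.distrib sum_distrib_left)
  also have "(\<Sum>i=j..<j+n. \<Sum>k=i*L..<Suc i*L. d k) = (\<Sum>k=j*L..<(j+n)*L. d k)"
    by (induction n) (simp_all add: sum.atLeastLessThan_concat add_mult_distrib2 flip: mult_Suc)
  also have "\<dots> \<le> Cd * ?x * g (j * L)"
    using d_sum[of "n * L" "j * L"] n L m by (simp add: add_mult_distrib)
  also have "Cd * ?x * g (j * L) \<le> Cd * ?x * Y j"
    using Cd weight_ge_1 e_nonneg[of "j * L" 0] jm[of j] by (intro mult_left_mono) (auto simp: Y_def)
  also have "(\<Sum>i=j..<j+n. Y i) \<le> Y j + W"
  proof -
    have "(\<Sum>i=j..<j+n. Y i) \<le> (\<Sum>i=j..j+n. Y i)" by (intro sum_mono2 Y_nonneg jm) auto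
    also have "\<dots> = Y j + W" unfolding W_def by (rule sum.atLeast_Suc_atMost) simp
    finally show ?thesis .
  qed
  finally have "W \<le> contr * (Y j + W) + (Cs + weight) * (Cd * ?x * Y j)"
    using contr Cs weight_ge_1 by (simp add: mult_left_mono)
  then have "(1 - contr) * W \<le> contr * Y j + (Cs + weight) * Cd * ?x * Y j"
    by (simp add: algebra_simps)
  \<comment> \<open>As \<open>n * L\<close> is at least one, so is the power \<open>?x\<close>; both
    terms thus become multiples of \<open>?x * Y j\<close>.\<close>
  also have "contr * Y j \<le> ?x * Y j"
  proof (rule mult_right_mono[OF _ Yj])
    have "1 \<le> n * L" using n L by (metis mult_le_mono nat_mult_1)
    then have "1 \<le> real (n * L)" by linarith
    then have "1 \<le> ?x" using s by (intro ge_one_powr_ge_zero) auto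
    then show "contr \<le> ?x" using contr by simp
  qed
  also have "?x * Y j + (Cs + weight) * Cd * ?x * Y j = (1 - contr) * (window_const * ?x * Y j)"
    using contr by (simp add: window_const_def field_simps)
  finally show ?thesis using contr by (simp add: W_def)
qed

lemma halving_steps_window:
  assumes "n \<le> halving_steps L"
  shows "window_const * real (n * L) powr (1 - s) \<le> real (halving_steps L) / 2"
proof -
  let ?a = "2 * window_const * real L"
  have a: "0 < ?a" using window_const_ge_1 L by simp
  have "0 < halving_steps L" by (simp add: halving_steps_def)
  then have N: "0 < real (halving_steps L)" by simp
  have "?a powr (1 / s) \<le> real (halving_steps L)" unfolding halving_steps_def by linarith
  then have "(?a powr (1 / s)) powr s \<le> real (halving_steps L) powr s" using s by (intro powr_mono2) auto
  then have aN: "?a \<le> real (halving_steps L) powr s" using s a by (simp add: powr_powr)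
  have "window_const * real (n * L) powr (1 - s) \<le> window_const * (real (halving_steps L) powr (1 - s) * real L)"
  proof (intro mult_left_mono)
    have "real (n * L) powr (1 - s) = real n powr (1 - s) * real L powr (1 - s)"
      by (simp add: powr_mult)
    also have "\<dots> \<le> real (halving_steps L) powr (1 - s) * real L powr 1"
      using assms s L by (intro mult_mono powr_mono2 powr_mono) auto
    finally show "real (n * L) powr (1 - s) \<le> real (halving_steps L) powr (1 - s) * real L" using L by simp
  qed (use window_const_ge_1 in simp)
  also have "\<dots> = real (halving_steps L) powr (1 - s) * ?a / 2" by simp
  also have "\<dots> \<le> real (halving_steps L) powr (1 - s) * real (halving_steps L) powr s / 2"
    using aN by (intro divide_right_mono mult_left_mono) auto
  also have "\<dots> = real (halving_steps L) / 2" using N by (simp flip: powr_add)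
  finally show ?thesis .
qed

lemma Y_tail_sum:
  assumes "(j + n) * L \<le> m"
  shows "(\<Sum>i=j..j+n. Y i) \<le> (1 + real (halving_steps L)) * Y j"
proof -
  have "(\<Sum>i=Suc j..j+n. Y i) \<le> real (halving_steps L) * Y j"
  proof (rule tail_sum_le[where J = "m div L" and \<phi> = "\<lambda>n. window_const * real (n * L) powr (1 - s)"])
    have dv: "i * L \<le> m \<longleftrightarrow> i \<le> m div L" for i using L by (simp add: less_eq_div_iff_mult_less_eq)
    show "0 \<le> Y i" if "i \<le> m div L" for i using that by (intro Y_nonneg) (simp add: dv)
    show "(\<Sum>i=Suc j..j+n. Y i) \<le> window_const * real (n * L) powr (1 - s) * Y j" if "1 \<le> n" "j + n \<le> m div L" for j n
      using that by (intro Y_window) (simp_all add: dv)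
    show "j + n \<le> m div L" using assms by (simp add: dv)
  qed (use halving_steps_window in \<open>auto simp: halving_steps_def\<close>)
  moreover have "(\<Sum>i=j..j+n. Y i) = Y j + (\<Sum>i=Suc j..j+n. Y i)"
    by (rule sum.atLeast_Suc_atMost) simp
  ultimately show ?thesis by (simp add: algebra_simps)
qed

section \<open>Sums of quasi-errors within one level\<close>

definition level_sum :: "nat \<Rightarrow> nat \<Rightarrow> real" where
  "level_sum l k = (\<Sum>i=k..kk l. h l i)"

text \<open>Induction backwards from the last step. While the criterion still fails at the next
  step, the estimator is at most \<open>C0 * e l k\<close>, so the quasi-errors are dominated by a
  geometric series. The last two steps lack this bound, whence \<open>2 * g l\<close>.\<close>

lemma level_sum_solve:
  assumes l: "l \<le> m" "L dvd l" and "k \<le> kk l"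
  shows "level_sum l k \<le> (1 + C0) / (1 - q) * e l k + 2 * g l"
  using assms(3)
proof (induction k rule: inc_induct)
  let ?c = "(1 + C0) / (1 - q)"
  case base
  have "1 \<le> ?c" using q C0 by simp
  then have "1 * e l (kk l) \<le> ?c * e l (kk l)" using l by (intro mult_right_mono e_nonneg) auto
  then show ?case using g_nonneg[OF l(1)] by (simp add: level_sum_def h_def)
next
  let ?c = "(1 + C0) / (1 - q)"
  case (step k)
  have e0: "0 \<le> e l k" using step l by (intro e_nonneg) auto
  have split: "level_sum l k = h l k + level_sum l (Suc k)"
    using step by (simp add: level_sum_def sum.atLeast_Suc_atMost)
  have eq: "e l (Suc k) \<le> q * e l k" using e_solve l step by blast
  show ?case
  proof (cases "Suc k < kk l")
    case True
    have "level_sum l k \<le> e l k + g l + (?c * e l (Suc k) + 2 * g l)"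
      using split step by (simp add: h_def)
    also have "\<dots> \<le> e l k + C0 * e l k + (?c * (q * e l k) + 2 * g l)"
      using not_stopped[OF l True] eq q C0 by (intro add_mono mult_left_mono) auto
    \<comment> \<open>The constant solves \<open>?c = 1 + C0 + ?c * q\<close>.\<close>
    also have "\<dots> = ?c * e l k + 2 * g l" using q by (simp add: field_simps)
    finally show ?thesis .
  next
    case False
    then have k: "kk l = Suc k" using step by simp
    have "(1 + q) * (1 - q) \<le> 1 + C0" using C0 by (simp add: algebra_simps)
    then have "1 + q \<le> ?c" using q by (simp add: pos_le_divide_eq)
    then have "(1 + q) * e l k \<le> ?c * e l k" using e0 by (rule mult_right_mono)
    moreover have "level_sum l k \<le> (1 + q) * e l k + 2 * g l"
      using split eq by (simp add: level_sum_def k h_def algebra_simps)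
    ultimately show ?thesis by linarith
  qed
qed

text \<open>An intermediate level contributes at most \<open>K + 1\<close> iterates with
  non-increasing error; this is the origin of the linear growth in \<open>K\<close>.\<close>

lemma level_sum_le:
  assumes l: "l \<le> m" and k: "k \<le> kk l"
  shows "level_sum l k \<le> (level_const + real K + 1) * h l k"
proof (cases "L dvd l")
  case True
  have h: "0 \<le> e l k" "0 \<le> g l" using l k by (auto intro: e_nonneg g_nonneg)
  have "level_sum l k \<le> (1 + C0) / (1 - q) * e l k + 2 * g l" by (rule level_sum_solve[OF l True k])
  also have "\<dots> \<le> level_const * e l k + level_const * g l"
    using h level_const_ge_2 by (intro add_mono mult_right_mono) (auto simp: level_const_def)
  also have "\<dots> = level_const * h l k" by (simp add: h_def algebra_simps)
  also have "\<dots> \<le> (level_const + real K + 1) * h l k" using h_nonneg[OF l k] by (intro mult_right_mono) auto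
  finally show ?thesis .
next
  case False
  have "level_sum l k \<le> (\<Sum>i=k..kk l. h l k)"
    unfolding level_sum_def using l by (intro sum_mono) (auto simp: h_def intro: e_decreasing)
  also have "\<dots> = real (Suc (kk l) - k) * h l k" by simp
  also have "\<dots> \<le> (level_const + real K + 1) * h l k"
    using kk_smooth[OF l False] level_const_ge_2 h_nonneg[OF l k] by (intro mult_right_mono) auto
  finally show ?thesis .
qed

section \<open>Sums of quasi-errors over all later steps and their contraction\<close>

definition tail :: "nat \<Rightarrow> nat \<Rightarrow> real" where
  "tail l k = level_sum l k + (\<Sum>i=Suc l..m. level_sum i 0)"

text \<open>Levels before the next solve level are compared with the current step directly. From
  there on, each level is compared with the solve level that starts its block,
  \<open>Y_tail_sum\<close> bounds the resulting sum, and its first term is led back to the current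
  step. The two comparisons produce the square of \<open>block_const L\<close>.\<close>

lemma level_heads_sum:
  assumes l: "l \<le> m" and k: "k \<le> kk l"
  shows "(\<Sum>i=Suc l..m. h i 0) \<le> (real L * block_const L + real L * (block_const L)\<^sup>2 * weight * (1 + real (halving_steps L))) * h l k"
proof -
  \<comment> \<open>\<open>j * L\<close> is the first solve level strictly after \<open>l\<close>,
    also if \<open>l\<close> itself is a solve level.\<close>
  define j where "j = Suc (l div L)"
  have jL: "l < j * L" "j * L \<le> l + L"
    using L by (auto simp: j_def dividend_less_div_times)
  have h0: "0 \<le> h l k" by (rule h_nonneg[OF l k])
  have hi: "0 \<le> h i 0" if "i \<le> m" for i using that by (intro h_nonneg) auto
  have near: "h i 0 \<le> block_const L * h l k" if "l < i" "i \<le> j * L" "i \<le> m" for i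
    using that jL k by (intro h_block) auto
  have Bh: "0 \<le> block_const L * h l k" using block_const_ge_1[of L] h0 by simp
  have far: "(\<Sum>i=j*L..m. h i 0) \<le> real L * (block_const L)\<^sup>2 * weight * (1 + real (halving_steps L)) * h l k"
  proof (cases "j * L \<le> m")
    case True
    have dv: "i * L \<le> m \<longleftrightarrow> i \<le> m div L" for i using L by (simp add: less_eq_div_iff_mult_less_eq)
    define n where "n = m div L - j"
    have jn: "j + n = m div L" using True by (simp add: n_def dv)
    have "(\<Sum>i=j*L..m. h i 0) \<le> (\<Sum>i=j*L..m. block_const L * Y (i div L))"
    proof (rule sum_mono)
      fix i assume i: "i \<in> {j*L..m}"
      let ?t = "i div L * L"
      have t: "?t \<le> i" "i - ?t \<le> L"
        using L by (auto simp: minus_div_mult_eq_mod intro: less_imp_le)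
      have "h i 0 \<le> block_const L * h ?t 0"
      proof (cases "?t = i")
        case True
        then show ?thesis using block_const_ge_1[of L] hi[of i] i mult_right_mono[of 1 "block_const L" "h i 0"] by simp
      next
        case False
        then have "?t < i" using t by linarith
        then show ?thesis using t i by (intro h_block) auto
      qed
      also have "\<dots> \<le> block_const L * Y (i div L)"
      proof (intro mult_left_mono h_le_Y)
        show "?t \<le> m" using t i by (meson atLeastAtMost_iff le_trans)
      qed (use block_const_ge_1[of L] in simp)
      finally show "h i 0 \<le> block_const L * Y (i div L)" .
    qed
    \<comment> \<open>The last block is filled up beyond \<open>m\<close>, which adds only
      nonnegative terms, so that \<open>sum_div_blocks\<close> applies.\<close>
    also have "\<dots> \<le> (\<Sum>i=j*L..<(j + Suc n)*L. block_const L * Y (i div L))"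
    proof (rule sum_mono2)
      have "m < Suc (m div L) * L" using L by (metis dividend_less_div_times add.commute mult_Suc less_le_trans zero_less_one)
      then show "{j*L..m} \<subseteq> {j*L..<(j + Suc n)*L}" using jn by auto
      fix i assume "i \<in> {j*L..<(j + Suc n)*L} - {j*L..m}"
      then have "i div L < Suc (m div L)" using L jn by (auto intro: less_mult_imp_div_less)
      then show "0 \<le> block_const L * Y (i div L)" using block_const_ge_1[of L] by (intro mult_nonneg_nonneg Y_nonneg) (auto simp: dv)
    qed simp
    also have "\<dots> = real L * (\<Sum>t=j..<j + Suc n. block_const L * Y t)" by (rule sum_div_blocks[OF L])
    also have "\<dots> = real L * (block_const L * (\<Sum>t=j..j+n. Y t))"
      by (simp add: sum_distrib_left atLeastLessThanSuc_atLeastAtMost)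
    also have "\<dots> \<le> real L * (block_const L * ((1 + real (halving_steps L)) * Y j))"
      using block_const_ge_1[of L] jn by (intro mult_left_mono Y_tail_sum) (auto simp: dv)
    also have "\<dots> \<le> real L * (block_const L * ((1 + real (halving_steps L)) * (weight * h (j*L) 0)))"
      using block_const_ge_1[of L] True by (intro mult_left_mono Y_le_h) auto
    also have "\<dots> \<le> real L * (block_const L * ((1 + real (halving_steps L)) * (weight * (block_const L * h l k))))"
      using block_const_ge_1[of L] weight_ge_1 True near[OF jL(1) le_refl True] by (intro mult_left_mono) auto
    finally show ?thesis by (simp add: power2_eq_square mult_ac)
  next
    case False
    then show ?thesis using h0 block_const_ge_1[of L] weight_ge_1 by simp
  qed
  have "(\<Sum>i=Suc l..m. h i 0) \<le> (\<Sum>i\<in>{Suc l..<j*L} \<inter> {..m} \<union> {j*L..m}. h i 0)"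
    using hi by (intro sum_mono2) auto
  also have "\<dots> = (\<Sum>i\<in>{Suc l..<j*L} \<inter> {..m}. h i 0) + (\<Sum>i=j*L..m. h i 0)"
    by (rule sum.union_disjoint) auto
  also have "(\<Sum>i\<in>{Suc l..<j*L} \<inter> {..m}. h i 0) \<le> real L * (block_const L * h l k)"
  proof -
    have "(\<Sum>i\<in>{Suc l..<j*L} \<inter> {..m}. h i 0) \<le> real (card ({Suc l..<j*L} \<inter> {..m})) * (block_const L * h l k)"
      using near by (intro sum_bounded_above) auto
    also have "\<dots> \<le> real L * (block_const L * h l k)"
    proof (rule mult_right_mono[OF _ Bh])
      have "card ({Suc l..<j*L} \<inter> {..m}) \<le> card {Suc l..<j*L}" by (intro card_mono) auto
      then show "real (card ({Suc l..<j*L} \<inter> {..m})) \<le> real L" using jL by simp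
    qed
    finally show ?thesis .
  qed
  finally show ?thesis using far by (simp add: algebra_simps)
qed

lemma tail_le:
  assumes l: "l \<le> m" and k: "k \<le> kk l"
  shows "tail l k \<le> lin_const K L * h l k"
proof -
  let ?D = "level_const + real K + 1"
  have "tail l k \<le> ?D * h l k + (\<Sum>i=Suc l..m. ?D * h i 0)"
    unfolding tail_def using l k by (intro add_mono sum_mono level_sum_le) auto
  also have "\<dots> = ?D * (h l k + (\<Sum>i=Suc l..m. h i 0))" by (simp add: sum_distrib_left algebra_simps)
  also have "\<dots> \<le> ?D * (h l k + (real L * block_const L + real L * (block_const L)\<^sup>2 * weight * (1 + real (halving_steps L))) * h l k)"
    using level_const_ge_2 level_heads_sum[OF l k] by (intro mult_left_mono add_left_mono) auto
  also have "\<dots> = lin_const K L * h l k" by (simp add: lin_const_def algebra_simps)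
  finally show ?thesis .
qed

lemma level_sum_nonneg: "l \<le> m \<Longrightarrow> 0 \<le> level_sum l k"
  unfolding level_sum_def by (intro sum_nonneg h_nonneg) auto

lemma h_le_tail:
  assumes l: "l \<le> m" and k: "k \<le> kk l"
  shows "h l k \<le> tail l k"
proof -
  have "h l k \<le> level_sum l k"
    unfolding level_sum_def using l k by (intro member_le_sum h_nonneg) auto
  moreover have "0 \<le> (\<Sum>i=Suc l..m. level_sum i 0)" by (intro sum_nonneg level_sum_nonneg) auto
  ultimately show ?thesis by (simp add: tail_def)
qed

text \<open>The remainder \<open>t\<close> stands for the tail at the next step. By
  \<open>tail_le\<close> the current quasi-error is at least the fraction
  \<open>1 / lin_const K L\<close> of the tail, and this fraction drops out in each step.\<close>

lemma tail_contract:
  assumes l: "l \<le> m" and k: "k \<le> kk l" and "tail l k = h l k + t"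
  shows "t \<le> (1 - 1 / lin_const K L) * tail l k"
proof -
  have "tail l k / lin_const K L \<le> h l k" using tail_le[OF l k] lin_const_ge_2[of K L] by (simp add: divide_le_eq mult.commute)
  then show ?thesis using assms(3) by (simp add: algebra_simps)
qed

lemma tail_Suc:
  assumes l: "l \<le> m" and k: "k < kk l"
  shows "tail l (Suc k) \<le> (1 - 1 / lin_const K L) * tail l k"
  using assms by (intro tail_contract) (auto simp: tail_def level_sum_def sum.atLeast_Suc_atMost)

lemma tail_next_level:
  assumes l: "l < m"
  shows "tail (Suc l) 0 \<le> (1 - 1 / lin_const K L) * tail l (kk l)"
  using assms by (intro tail_contract) (auto simp: tail_def level_sum_def[of _ "kk l"] sum.atLeast_Suc_atMost)

lemma tail_within_level:
  assumes l: "l \<le> m" and "k' \<le> k" "k \<le> kk l"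
  shows "tail l k \<le> (1 - 1 / lin_const K L) ^ (k - k') * tail l k'"
  using assms(2,3)
proof (induction k rule: dec_induct)
  case (step k)
  have "tail l (Suc k) \<le> (1 - 1 / lin_const K L) * tail l k" using l step by (intro tail_Suc) auto
  also have "\<dots> \<le> (1 - 1 / lin_const K L) * ((1 - 1 / lin_const K L) ^ (k - k') * tail l k')"
    using lin_const_ge_2[of K L] step by (intro mult_left_mono) auto
  finally show ?case using step by (simp add: Suc_diff_le mult.assoc)
qed simp

text \<open>The abstract counterpart of \<open>step_index\<close>. Level \<open>i\<close> has the
  steps from 0 to \<open>kk i\<close>, hence \<open>Suc (kk i)\<close> of them; passing to the start
  of the next level counts as a step although the iterate is unchanged.\<close>

definition pos :: "nat \<Rightarrow> nat \<Rightarrow> nat" where "pos l k = (\<Sum>i<l. Suc (kk i)) + k"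

text \<open>The comparison of positions is carried through the induction because the exponents are
  truncated differences of natural numbers.\<close>

lemma tail_across:
  assumes "l' < l" "l \<le> m" "k' \<le> kk l'"
  shows "pos l' k' \<le> pos l 0 \<and> tail l 0 \<le> (1 - 1 / lin_const K L) ^ (pos l 0 - pos l' k') * tail l' k'"
  using assms(1,2)
proof (induction l rule: less_induct)
  case (less l)
  then obtain l1 where l1: "l = Suc l1" "l' \<le> l1" "l1 < m" by (cases l) auto
  have "pos l' k' \<le> pos l1 (kk l1) \<and> tail l1 (kk l1) \<le> (1 - 1 / lin_const K L) ^ (pos l1 (kk l1) - pos l' k') * tail l' k'"
  proof (cases "l' = l1")
    case True
    then show ?thesis using tail_within_level[of l' k' "kk l'"] assms less.prems l1 by (simp add: pos_def)
  next
    case False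
    then have IH: "pos l' k' \<le> pos l1 0" "tail l1 0 \<le> (1 - 1 / lin_const K L) ^ (pos l1 0 - pos l' k') * tail l' k'"
      using less.IH[of l1] l1 by auto
    have "tail l1 (kk l1) \<le> (1 - 1 / lin_const K L) ^ kk l1 * tail l1 0"
      using tail_within_level[of l1 0 "kk l1"] l1 by simp
    also have "\<dots> \<le> (1 - 1 / lin_const K L) ^ kk l1 * ((1 - 1 / lin_const K L) ^ (pos l1 0 - pos l' k') * tail l' k')"
      using lin_const_ge_2[of K L] IH by (intro mult_left_mono) auto
    also have "\<dots> = (1 - 1 / lin_const K L) ^ (pos l1 (kk l1) - pos l' k') * tail l' k'"
      using IH(1) by (simp add: pos_def add.commute flip: power_add mult.assoc)
    finally show ?thesis using IH(1) by (simp add: pos_def)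
  qed
  moreover have "tail l 0 \<le> (1 - 1 / lin_const K L) * tail l1 (kk l1)" using tail_next_level l1 by simp
  ultimately have le: "pos l' k' \<le> pos l1 (kk l1)"
    and "tail l 0 \<le> (1 - 1 / lin_const K L) * ((1 - 1 / lin_const K L) ^ (pos l1 (kk l1) - pos l' k') * tail l' k')"
    using lin_const_ge_2[of K L] by (auto intro: order_trans[OF _ mult_left_mono])
  moreover have "pos l 0 = Suc (pos l1 (kk l1))" by (simp add: pos_def l1)
  ultimately show ?case by (simp add: Suc_diff_le mult.assoc)
qed

text \<open>The tail lies between \<open>h\<close> and \<open>lin_const K L * h\<close>, so the
  constant is paid only once, at the earlier step.\<close>

theorem R_linear:
  assumes "l' < l \<or> l' = l \<and> k' \<le> k" and l: "l \<le> m" "k \<le> kk l" and k': "k' \<le> kk l'"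
  shows "h l k \<le> lin_const K L * (1 - 1 / lin_const K L) ^ (pos l k - pos l' k') * h l' k'"
proof -
  have "tail l k \<le> (1 - 1 / lin_const K L) ^ (pos l k - pos l' k') * tail l' k'"
  proof (cases "l' = l")
    case True
    then show ?thesis using tail_within_level[of l k' k] assms by (simp add: pos_def)
  next
    case False
    then have "l' < l" using assms by auto
    note T = tail_across[OF this l(1) k']
    have "tail l k \<le> (1 - 1 / lin_const K L) ^ k * tail l 0"
      using tail_within_level[of l 0 k] l by simp
    also have "\<dots> \<le> (1 - 1 / lin_const K L) ^ k * ((1 - 1 / lin_const K L) ^ (pos l 0 - pos l' k') * tail l' k')"
      using lin_const_ge_2[of K L] T by (intro mult_left_mono) auto
    also have "\<dots> = (1 - 1 / lin_const K L) ^ (pos l k - pos l' k') * tail l' k'"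
      using T by (simp add: pos_def add.commute flip: power_add mult.assoc)
    finally show ?thesis .
  qed
  also have "\<dots> \<le> (1 - 1 / lin_const K L) ^ (pos l k - pos l' k') * (lin_const K L * h l' k')"
    using lin_const_ge_2[of K L] assms by (intro mult_left_mono tail_le) auto
  finally show ?thesis using h_le_tail[OF l] by (simp add: mult_ac)
qed

end

section \<open>The adaptive algorithm\<close>

lemma reached_mono: "reached R l \<Longrightarrow> l' \<le> l \<Longrightarrow> reached R l'"
  by (auto simp: reached_def)

lemma last_it_finite:
  assumes "reached R l" "l' < l"
  shows "last_it R l' = enat (the_enat (last_it R l'))"
  using assms by (cases "last_it R l'") (auto simp: reached_def)

lemma enat_le_last_it_iff:
  assumes "reached R l" "l' < l"
  shows "enat k \<le> last_it R l' \<longleftrightarrow> k \<le> the_enat (last_it R l')"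
  using assms by (cases "last_it R l'") (auto simp: reached_def)

text \<open>Meant for reached levels \<open>l\<close>: all earlier levels then have a finite last
  index, so \<open>the_enat\<close> returns it.\<close>

definition iterations_before :: "'n::finite safem_run \<Rightarrow> nat \<Rightarrow> nat" where
  "iterations_before R l = (\<Sum>i<l. Suc (the_enat (last_it R i)))"

lemma step_index_eq:
  assumes "(l, k) \<in> Qset R"
  shows "step_index R l k = iterations_before R l + k"
proof -
  let ?kk = "\<lambda>i. the_enat (last_it R i)"
  have r: "reached R l" and k: "enat k \<le> last_it R l" using assms by (auto simp: Qset_def)
  have "{(l', k') \<in> Qset R. l' < l \<or> (l' = l \<and> k' < k)} =
      Sigma {..<l} (\<lambda>i. {..?kk i}) \<union> {l} \<times> {..<k}" (is "?A = ?B")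
  proof
    show "?A \<subseteq> ?B"
    proof
      fix x assume "x \<in> ?A"
      then obtain l' k' where x: "x = (l', k')" "enat k' \<le> last_it R l'" "l' < l \<or> (l' = l \<and> k' < k)"
        by (auto simp: Qset_def)
      then show "x \<in> ?B" using enat_le_last_it_iff[OF r, of l' k'] by auto
    qed
    show "?B \<subseteq> ?A"
    proof
      fix x assume "x \<in> ?B"
      then consider l' k' where "x = (l', k')" "l' < l" "k' \<le> ?kk l'" | k' where "x = (l, k')" "k' < k"
        by auto
      then show "x \<in> ?A"
      proof cases
        case 1
        then have "enat k' \<le> last_it R l'" using enat_le_last_it_iff[OF r, of l' k'] by simp
        then show ?thesis using 1 reached_mono[OF r, of l'] by (auto simp: Qset_def)
      next
        case 2
        then have "enat k' \<le> last_it R l" by (intro order_trans[OF _ k]) simp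
        then show ?thesis using 2 r by (auto simp: Qset_def)
      qed
    qed
  qed
  then have "step_index R l k = card ?B" by (simp add: step_index_def)
  also have "\<dots> = card (Sigma {..<l} (\<lambda>i. {..?kk i})) + card ({l} \<times> {..<k})"
    by (rule card_Un_disjoint) auto
  finally show ?thesis by (simp add: iterations_before_def)
qed

text \<open>Links the order by \<open>step_index\<close> in the final result to the lexicographic
  order of the abstract one: a complete level has more steps than any of its final indices.\<close>

lemma step_index_le_imp_lex:
  assumes Q: "(l', k') \<in> Qset R" "(l, k) \<in> Qset R" and le: "step_index R l' k' \<le> step_index R l k"
  shows "l' < l \<or> l' = l \<and> k' \<le> k"
proof (rule ccontr)
  assume "\<not> ?thesis"
  then consider "l < l'" | "l = l'" "k < k'" by linarith
  then show False
  proof cases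
    case 1
    have "k \<le> the_enat (last_it R l)"
      using Q enat_le_last_it_iff[OF _ 1, of R k] by (simp add: Qset_def)
    then have "iterations_before R l + k < iterations_before R (Suc l)"
      by (simp add: iterations_before_def)
    also have "\<dots> \<le> iterations_before R l'"
      unfolding iterations_before_def using 1 by (intro sum_mono2) auto
    finally show False using le Q by (simp add: step_index_eq)
  qed (use le Q in \<open>simp add: step_index_eq\<close>)
qed

locale safem_problem =
  fixes P :: "'n::finite problem" and p :: nat and us :: "real^'n \<Rightarrow> real"
    and ud :: "'n mesh \<Rightarrow> real^'n \<Rightarrow> real"
    and \<Phi> \<Psi> :: "'n mesh \<Rightarrow> (real^'n \<Rightarrow> real) \<Rightarrow> real^'n \<Rightarrow> real"
    and C_stab q_red C_rel C_mon C_orth \<delta> q_alg lam \<theta> C_alg C_mark C_card :: real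
    and K L :: nat and u00 :: "real^'n \<Rightarrow> real" and R :: "'n safem_run"
  assumes P: "model_problem P"
    and us: "solves_on P (H10 P) us"
    and ud: "\<And>M. M \<in> meshes P \<Longrightarrow> solves_on P (fe_space P p M) (ud M)"
    and stab: "stability P p C_stab"
    and red: "reduction P p q_red"
    and rel: "reliability P us ud C_rel"
    and mon: "quasi_monotonicity P ud C_mon"
    and orth: "quasi_orthogonality P us C_orth \<delta>"
    and \<Phi>: "\<And>M v. M \<in> meshes P \<Longrightarrow> v \<in> fe_space P p M \<Longrightarrow> \<Phi> M v \<in> fe_space P p M \<and>
          edist P (ud M) (\<Phi> M v) \<le> q_alg * edist P (ud M) v"
    and \<Psi>: "\<And>M v. M \<in> meshes P \<Longrightarrow> v \<in> fe_space P p M \<Longrightarrow> \<Psi> M v \<in> fe_space P p M \<and>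
          edist P (ud M) (\<Psi> M v) \<le> C_alg * edist P (ud M) v"
    and C_alg: "C_alg \<le> 1"
    and L: "1 \<le> L"
    and u00: "u00 \<in> fe_space P p (T0 P)"
    and run: "safem P \<Phi> \<Psi> K L \<theta> C_mark C_card lam u00 R"
    and params: "lam > 0" "0 < \<theta>" "\<theta> \<le> 1" "0 < q_alg" "q_alg < 1" "C_stab > 0" "0 < q_red"
      "q_red < 1" "C_rel > 0" "C_mon \<ge> 1" "C_orth > 0" "0 < \<delta>" "\<delta> \<le> 1"
begin

abbreviation "X M \<equiv> fe_space P p M"
abbreviation "M l \<equiv> mesh R l"
abbreviation "u l k \<equiv> iter R l k"
abbreviation "U l \<equiv> ud (mesh R l)"
abbreviation "est l v \<equiv> eta P (mesh R l) (mesh R l) v"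

section \<open>Meshes, iterates and discrete spaces of a run\<close>

lemma solve_level:
  assumes "reached R l" "L dvd l"
  shows "last_it R l \<ge> 1"
    and "1 \<le> k \<Longrightarrow> enat k \<le> last_it R l \<Longrightarrow> u l k = \<Phi> (M l) (u l (k - 1))"
    and "1 \<le> k \<Longrightarrow> enat k \<le> last_it R l \<Longrightarrow>
      edist P (u l k) (u l (k - 1)) \<le> lam * est l (u l k) \<longleftrightarrow> enat k = last_it R l"
proof -
  have "solve_step P \<Phi> lam R l" using run assms by (simp add: safem_def)
  then show "last_it R l \<ge> 1"
    and "1 \<le> k \<Longrightarrow> enat k \<le> last_it R l \<Longrightarrow> u l k = \<Phi> (M l) (u l (k - 1))"
    and "1 \<le> k \<Longrightarrow> enat k \<le> last_it R l \<Longrightarrow>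
      edist P (u l k) (u l (k - 1)) \<le> lam * est l (u l k) \<longleftrightarrow> enat k = last_it R l"
    unfolding solve_step_def by blast+
qed

lemma smooth_level:
  assumes "reached R l" "\<not> L dvd l"
  shows "last_it R l = enat K"
    and "1 \<le> k \<Longrightarrow> k \<le> K \<Longrightarrow> u l k = \<Psi> (M l) (u l (k - 1))"
proof -
  have "smooth_step \<Psi> K R l" using run assms by (simp add: safem_def)
  then show "last_it R l = enat K"
    and "1 \<le> k \<Longrightarrow> k \<le> K \<Longrightarrow> u l k = \<Psi> (M l) (u l (k - 1))"
    by (simp_all add: smooth_step_def)
qed

lemma refine_level:
  assumes "reached R (Suc l)"
  obtains k where "last_it R l = enat k" "M (Suc l) \<in> refinements (dom P) (M l)"
    "u (Suc l) 0 = u l k"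
    "L dvd l \<Longrightarrow> doerfler P \<theta> (M l) (u l k) (marked R l)" "marked R l \<inter> M (Suc l) = {}"
proof -
  obtain k where k: "last_it R l = enat k" using last_it_finite[OF assms] by blast
  have "reached R l" using assms by (rule reached_mono) simp
  then have "mark_refine_step P L \<theta> C_mark C_card R l k" using run k by (auto simp: safem_def)
  then show ?thesis using that[OF k] by (auto simp: mark_refine_step_def is_refine_def)
qed

text \<open>The induction inside one level; \<open>level_start\<close> provides the hypotheses by
  induction over levels, using this lemma for the last iterate of the previous one.\<close>

lemma level_iterates:
  assumes l: "reached R l" and M: "M l \<in> meshes P" and 0: "u l 0 \<in> X (M l)"
  shows "enat k \<le> last_it R l \<Longrightarrow> u l k \<in> X (M l)"
proof (induction k)
  case (Suc k)
  then have k: "u l k \<in> X (M l)" by (meson Suc_n_not_le_n enat_ord_simps(1) nle_le order_trans)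
  show ?case
  proof (cases "L dvd l")
    case True
    then show ?thesis using solve_level(2)[OF l True, of "Suc k"] Suc.prems \<Phi>[OF M k] by simp
  next
    case False
    then show ?thesis using smooth_level(1)[OF l False] smooth_level(2)[OF l False, of "Suc k"] Suc.prems \<Psi>[OF M k] by simp
  qed
qed (use 0 in simp)

lemma level_start:
  "reached R l \<Longrightarrow> M l \<in> meshes P \<and> u l 0 \<in> X (M l)"
proof (induction l)
  case 0
  have "conforming (dom P) (T0 P)" using P by (simp add: model_problem_def)
  then show ?case using run u00 by (simp add: safem_def meshes_def refinements_refl)
next
  case (Suc l)
  obtain k where k: "last_it R l = enat k" "M (Suc l) \<in> refinements (dom P) (M l)" "u (Suc l) 0 = u l k"
    using refine_level[OF Suc.prems] by metis
  have l: "reached R l" using Suc.prems by (rule reached_mono) simp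
  have "u l k \<in> X (M l)" using level_iterates[OF l, of k] Suc.IH[OF l] k by simp
  then show ?case
    using meshes_refinements[OF _ k(2)] fe_space_mono[OF meshes_conforming k(2)] Suc.IH[OF l] k(3) by auto
qed

lemma M: "reached R l \<Longrightarrow> M l \<in> meshes P"
  using level_start by blast

lemma u_X: "reached R l \<Longrightarrow> enat k \<le> last_it R l \<Longrightarrow> u l k \<in> X (M l)"
  using level_iterates level_start by blast

lemma U_X: "reached R l \<Longrightarrow> U l \<in> X (M l)"
  using ud[OF M] by (simp add: solves_on_def)

lemma M_refinements:
  assumes "reached R l" "l' \<le> l"
  shows "M l \<in> refinements (dom P) (M l')"
  using assms(2,1)
proof (induction l rule: dec_induct)
  case base
  show ?case by (rule refinements_refl[OF meshes_conforming[OF M[OF base]]])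
next
  case (step l)
  have "M (Suc l) \<in> refinements (dom P) (M l)" using refine_level[OF step.prems] by metis
  moreover have "reached R l" using step.prems by (rule reached_mono) simp
  ultimately show ?case using step.IH refinements_trans by blast
qed

lemma X_mono: "reached R l \<Longrightarrow> l' \<le> l \<Longrightarrow> X (M l') \<subseteq> X (M l)"
  by (meson M M_refinements fe_space_mono meshes_conforming reached_mono)

text \<open>A mesh of the run is a refinement of itself, so stability also compares two functions on
  one mesh.\<close>

lemma est_stable:
  assumes "reached R l" "v \<in> X (M l)" "w \<in> X (M l)"
  shows "est l v \<le> est l w + C_stab * edist P v w"
proof -
  have "M l \<in> refinements (dom P) (M l)" using M_refinements[OF assms(1)] by simp
  then have "\<bar>est l v - est l w\<bar> \<le> C_stab * edist P v w"
    using stab M[OF assms(1)] assms(2,3) unfolding stability_def by blast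
  then show ?thesis by linarith
qed

lemma edist_U_nonneg: "reached R l \<Longrightarrow> enat k \<le> last_it R l \<Longrightarrow> 0 \<le> edist P (U l) (u l k)"
  by (rule edist_nonneg[OF P fe_space_H10[OF U_X] fe_space_H10[OF u_X]])

lemma solve_contract:
  assumes "reached R l" "L dvd l" "enat (Suc k) \<le> last_it R l"
  shows "edist P (U l) (u l (Suc k)) \<le> q_alg * edist P (U l) (u l k)"
proof -
  have "enat k \<le> last_it R l" using assms(3) by (meson Suc_ile_eq order_less_imp_le)
  then show ?thesis
    using solve_level(2)[OF assms(1,2), of "Suc k"] assms(3) \<Phi>[OF M[OF assms(1)] u_X[OF assms(1)]] by simp
qed

lemma smooth_stable:
  assumes "reached R l" "\<not> L dvd l" "Suc k \<le> K"
  shows "edist P (U l) (u l (Suc k)) \<le> edist P (U l) (u l k)"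
proof -
  have k: "enat k \<le> last_it R l" using smooth_level(1)[OF assms(1,2)] assms(3) by simp
  have "edist P (U l) (u l (Suc k)) \<le> C_alg * edist P (U l) (u l k)"
    using smooth_level(2)[OF assms(1,2), of "Suc k"] assms(3) \<Psi>[OF M[OF assms(1)] u_X[OF assms(1) k]] by simp
  also have "\<dots> \<le> 1 * edist P (U l) (u l k)"
    using C_alg edist_U_nonneg[OF assms(1) k] by (intro mult_right_mono) auto
  finally show ?thesis by simp
qed

text \<open>The criterion fails at step \<open>Suc k\<close>, so \<open>lam\<close> times the
  estimator there is below the distance of the two iterates, which is at most twice the error at
  step \<open>k\<close>. Passing from the iterate to the exact discrete solution adds
  \<open>C_stab\<close>.\<close>

lemma est_le_if_not_stopped:
  assumes l: "reached R l" "L dvd l" and k: "enat (Suc k) < last_it R l"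
  shows "est l (U l) \<le> (2 / lam + C_stab) * edist P (U l) (u l k)"
proof -
  let ?e = "edist P (U l) (u l k)" and ?e' = "edist P (U l) (u l (Suc k))"
  have le: "enat (Suc k) \<le> last_it R l" "enat k \<le> last_it R l"
    using k by (cases "last_it R l"; auto)+
  have H: "U l \<in> X (M l)" "u l k \<in> X (M l)" "u l (Suc k) \<in> X (M l)"
    using U_X u_X l le by auto
  note HH = H[THEN fe_space_H10]
  have e0: "0 \<le> ?e" using edist_U_nonneg l le by blast
  have "?e' \<le> q_alg * ?e" by (rule solve_contract[OF l le(1)])
  also have "\<dots> \<le> 1 * ?e" using e0 params by (intro mult_right_mono) auto
  finally have e': "?e' \<le> ?e" by simp
  have "lam * est l (u l (Suc k)) < edist P (u l (Suc k)) (u l k)"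
    using solve_level(3)[OF l, of "Suc k"] le k by auto
  also have "\<dots> \<le> edist P (u l (Suc k)) (U l) + ?e" by (rule edist_triangle[OF P HH(3,1,2)])
  also have "\<dots> \<le> 2 * ?e" using e' edist_commute[OF P HH(3,1)] by simp
  finally have "est l (u l (Suc k)) \<le> 2 / lam * ?e" using params by (simp add: field_simps)
  moreover have "est l (U l) \<le> est l (u l (Suc k)) + C_stab * ?e'" by (rule est_stable[OF l(1) H(1,3)])
  moreover have "C_stab * ?e' \<le> C_stab * ?e" using e' params by (intro mult_left_mono) auto
  ultimately show ?thesis by (simp add: algebra_simps)
qed

text \<open>Refinement alone does not increase the estimator of a fixed coarse function; changing
  the function then costs the stability term.\<close>

lemma est_next:
  assumes l: "reached R (Suc l)"
  shows "est (Suc l) (U (Suc l)) \<le> est l (U l) + C_stab * edist P (U (Suc l)) (U l)"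
proof -
  have l': "reached R l" using l by (rule reached_mono) simp
  have "U l \<in> X (M (Suc l))" using X_mono[OF l, of l] U_X[OF l'] by auto
  then have "est (Suc l) (U (Suc l)) \<le> est (Suc l) (U l) + C_stab * edist P (U (Suc l)) (U l)"
    by (intro est_stable U_X l)
  also have "est (Suc l) (U l) \<le> est l (U l)"
    using eta_refinement_mono[OF P stab red _ _ M[OF l'] M_refinements[OF l] U_X[OF l']] params by simp
  finally show ?thesis by simp
qed

text \<open>Doerfler marking refers to the computed iterate, whereas the contraction is wanted for
  the exact discrete solution. Passing to the iterate and back by stability costs the algebraic
  error twice, hence the factor 2.\<close>

lemma est_solve_reduction:
  assumes l: "reached R (Suc l)" "L dvd l" and k: "last_it R l = enat k"
  shows "est (Suc l) (U (Suc l)) \<le> sqrt (1 - (1 - q_red\<^sup>2) * \<theta>) * est l (U l)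
    + C_stab * (2 * edist P (U l) (u l k) + edist P (U (Suc l)) (U l))"
proof -
  let ?q = "sqrt (1 - (1 - q_red\<^sup>2) * \<theta>)" and ?e = "edist P (U l) (u l k)"
  have l': "reached R l" using l(1) by (rule reached_mono) simp
  have uX: "u l k \<in> X (M l)" using u_X[OF l'] k by simp
  have X: "U l \<in> X (M l)" "U (Suc l) \<in> X (M (Suc l))" "u l k \<in> X (M (Suc l))"
    using U_X l l' X_mono[OF l(1), of l] uX by auto
  note H = X(1,2)[THEN fe_space_H10] uX[THEN fe_space_H10]
  have "0 \<le> (1 - q_red\<^sup>2) * \<theta>" using params by (simp add: power_le_one)
  then have q: "?q \<le> 1" by simp
  have q0: "0 \<le> ?q"
  proof -
    have "(1 - q_red\<^sup>2) * \<theta> \<le> 1 * 1" using params by (intro mult_mono) (auto simp: power_le_one)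
    then show ?thesis by simp
  qed
  have D: "doerfler P \<theta> (M l) (u l k) (marked R l)" "marked R l \<inter> M (Suc l) = {}"
    using refine_level[OF l(1)] l(2) k by (metis enat.inject)+
  have 1: "est (Suc l) (U (Suc l)) \<le> est (Suc l) (u l k) + C_stab * edist P (U (Suc l)) (u l k)"
    by (rule est_stable[OF l(1) X(2,3)])
  have 2: "est (Suc l) (u l k) \<le> ?q * est l (u l k)"
    using eta_doerfler_reduction[OF P stab red _ _ M[OF l'] M_refinements[OF l(1)] uX D] params by simp
  have "est l (u l k) \<le> est l (U l) + C_stab * ?e"
    using est_stable[OF l' uX X(1)] edist_commute[OF P H(3,1)] by simp
  then have 3: "?q * est l (u l k) \<le> ?q * (est l (U l) + C_stab * ?e)"
    using q0 by (rule mult_left_mono)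
  have 4: "?q * (est l (U l) + C_stab * ?e) \<le> ?q * est l (U l) + C_stab * ?e"
  proof -
    have "?q * (C_stab * ?e) \<le> 1 * (C_stab * ?e)"
      using q params edist_nonneg[OF P H(1,3)] by (intro mult_right_mono) auto
    then show ?thesis unfolding distrib_left by simp
  qed
  have 5: "C_stab * edist P (U (Suc l)) (u l k) \<le> C_stab * (edist P (U (Suc l)) (U l) + ?e)"
    using params edist_triangle[OF P H(2,1,3)] by (intro mult_left_mono) auto
  have "est (Suc l) (U (Suc l)) \<le> ?q * est l (U l) + C_stab * ?e + C_stab * (edist P (U (Suc l)) (U l) + ?e)"
    using 1 2 3 4 5 by linarith
  also have "\<dots> = ?q * est l (U l) + C_stab * (2 * ?e + edist P (U (Suc l)) (U l))"
    unfolding distrib_left by simp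
  finally show ?thesis .
qed

text \<open>Cauchy-Schwarz contributes \<open>n powr (1 / 2)\<close> and quasi-orthogonality
  \<open>n powr ((1 - \<delta>) / 2)\<close>; the product has the exponent
  \<open>1 - \<delta> / 2 < 1\<close>.\<close>

lemma edist_U_sum:
  assumes n: "1 \<le> n" and l: "reached R (l + n)"
  shows "(\<Sum>i=l..<l+n. edist P (U (Suc i)) (U i)) \<le> sqrt C_orth * C_rel * real n powr (1 - \<delta> / 2) * est l (U l)"
proof -
  let ?m = "l + n" and ?d = "\<lambda>i. edist P (U (Suc i)) (U i)"
  have reach: "reached R i" if "i \<le> ?m" for i using l that by (rule reached_mono)
  \<comment> \<open>Quasi-orthogonality asks for an infinite nested sequence, but later levels need
    not be reached; the sequence is frozen from level \<open>l + n\<close> on.\<close>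
  define V w where "V i = X (M (min i ?m))" and "w i = U (min i ?m)" for i
  have "\<forall>i. fin_dim_space (dom P) (V i) \<and> V i \<subseteq> V (Suc i) \<and> V i \<subseteq> H10 P \<and> solves_on P (V i) (w i)"
  proof
    fix i
    have "fin_dim_space (dom P) (V i)" "solves_on P (V i) (w i)" "V i \<subseteq> H10 P"
      unfolding V_def w_def using fin_dim_fe_space[OF P] ud M[OF reach] fe_space_H10 by auto
    moreover have "V i \<subseteq> V (Suc i)" unfolding V_def by (intro X_mono reach) auto
    ultimately show "fin_dim_space (dom P) (V i) \<and> V i \<subseteq> V (Suc i) \<and> V i \<subseteq> H10 P \<and> solves_on P (V i) (w i)"
      by blast
  qed
  \<comment> \<open>The choice \<open>N = n - 1\<close> gives exactly \<open>n\<close>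
    summands.\<close>
  then have "(\<Sum>i=l..l+(n-1). (edist P (w (Suc i)) (w i))\<^sup>2)
      \<le> C_orth * real ((n-1) + 1) powr (1 - \<delta>) * (edist P us (w l))\<^sup>2"
    using orth unfolding quasi_orthogonality_def by blast
  moreover have "(\<Sum>i=l..l+(n-1). (edist P (w (Suc i)) (w i))\<^sup>2) = (\<Sum>i=l..<l+n. (?d i)\<^sup>2)"
    using n by (intro sum.cong) (auto simp: w_def min_def)
  ultimately have A4: "(\<Sum>i=l..<l+n. (?d i)\<^sup>2) \<le> C_orth * real n powr (1 - \<delta>) * (edist P us (U l))\<^sup>2"
    using n by (simp add: w_def)
  have e0: "0 \<le> edist P us (U l)"
    using us fe_space_H10[OF U_X[OF reach[of l]]] by (intro edist_nonneg[OF P]) (auto simp: solves_on_def)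
  have "edist P us (U l) \<le> C_rel * est l (U l)"
    using rel M[OF reach[of l]] by (simp add: reliability_def)
  then have "(edist P us (U l))\<^sup>2 \<le> (C_rel * est l (U l))\<^sup>2" using e0 by (intro power_mono)
  then have A4': "(\<Sum>i=l..<l+n. (?d i)\<^sup>2) \<le> C_orth * real n powr (1 - \<delta>) * (C_rel * est l (U l))\<^sup>2"
    using params by (intro order_trans[OF A4] mult_left_mono) auto
  have "(\<Sum>i=l..<l+n. ?d i)\<^sup>2 \<le> real (card {l..<l+n}) * (\<Sum>i=l..<l+n. (?d i)\<^sup>2)"
    using Cauchy_Schwarz_ineq_sum[of "\<lambda>i. 1" ?d "{l..<l+n}"] by simp
  also have "\<dots> \<le> real n * (C_orth * real n powr (1 - \<delta>) * (C_rel * est l (U l))\<^sup>2)"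
    using A4' by (simp add: mult_left_mono)
  also have "\<dots> = (sqrt C_orth * C_rel * real n powr (1 - \<delta> / 2) * est l (U l))\<^sup>2"
  proof -
    have "real n * real n powr (1 - \<delta>) = real n powr 1 * real n powr (1 - \<delta>)" using n by simp
    also have "\<dots> = real n powr (1 + (1 - \<delta>))" by (rule powr_add[symmetric])
    also have "\<dots> = real n powr ((1 - \<delta> / 2) + (1 - \<delta> / 2))" by (rule arg_cong[where f = "\<lambda>t. real n powr t"]) simp
    also have "\<dots> = (real n powr (1 - \<delta> / 2))\<^sup>2" by (simp only: powr_add power2_eq_square)
    finally have pow: "real n * real n powr (1 - \<delta>) = (real n powr (1 - \<delta> / 2))\<^sup>2" .
    have "real n * (C_orth * real n powr (1 - \<delta>) * (C_rel * est l (U l))\<^sup>2)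
        = C_orth * (real n * real n powr (1 - \<delta>)) * (C_rel * est l (U l))\<^sup>2" by simp
    also have "\<dots> = (sqrt C_orth * C_rel * real n powr (1 - \<delta> / 2) * est l (U l))\<^sup>2"
      unfolding pow using params by (simp add: power_mult_distrib)
    finally show ?thesis .
  qed
  finally show ?thesis
    by (rule power2_le_imp_le) (use params in \<open>simp add: eta_nonneg\<close>)
qed

text \<open>The run is cut at \<open>(m, km)\<close>, possibly in the middle of a level or inside a
  solver loop that never ends; on all earlier levels the last index is finite.\<close>

lemma quasi_error_sequence_run:
  assumes m: "reached R m" and km: "enat km \<le> last_it R m"
  shows "quasi_error_sequence q_alg (sqrt (1 - (1 - q_red\<^sup>2) * \<theta>)) C_stab (2 / lam + C_stab)
    (sqrt C_orth * C_rel) C_mon (\<delta> / 2) K L m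
    (\<lambda>i. if i < m then the_enat (last_it R i) else km)
    (\<lambda>l k. edist P (U l) (u l k)) (\<lambda>l. est l (U l)) (\<lambda>l. edist P (U (Suc l)) (U l))"
proof -
  let ?kk = "\<lambda>i. if i < m then the_enat (last_it R i) else km"
  have reach: "reached R l" if "l \<le> m" for l using m that by (rule reached_mono)
  have kk: "enat (?kk l) \<le> last_it R l" if "l \<le> m" for l
    using that km last_it_finite[OF m, of l] by (cases "l < m") auto
  have kkD: "enat k \<le> last_it R l" if "l \<le> m" "k \<le> ?kk l" for l k
    using kk[OF that(1)] that(2) by (meson enat_ord_simps(1) order_trans)
  have fin: "last_it R l = enat (?kk l)" if "l < m" for l
    using last_it_finite[OF m that] that by simp
  show ?thesis
  proof
    show "0 \<le> sqrt (1 - (1 - q_red\<^sup>2) * \<theta>)" "sqrt (1 - (1 - q_red\<^sup>2) * \<theta>) < 1"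
    proof -
      have "(1 - q_red\<^sup>2) * \<theta> \<le> 1 * 1" using params by (intro mult_mono) (auto simp: power_le_one)
      then show "0 \<le> sqrt (1 - (1 - q_red\<^sup>2) * \<theta>)" by simp
      have "q_red\<^sup>2 < 1" using params by (simp add: power_less_one_iff)
      then have "0 < (1 - q_red\<^sup>2) * \<theta>" using params by simp
      then show "sqrt (1 - (1 - q_red\<^sup>2) * \<theta>) < 1" by simp
    qed
  next
    fix l k assume "l \<le> m" "k \<le> ?kk l"
    then show "0 \<le> edist P (U l) (u l k)" by (intro edist_U_nonneg reach kkD)
  next
    fix l l' :: nat assume "l' \<le> l" "l \<le> m"
    then show "est l (U l) \<le> C_mon * est l' (U l')"
      using mon M[OF reach[of l']] M_refinements[OF reach[of l], of l'] unfolding quasi_monotonicity_def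
      by auto
  next
    fix l n :: nat assume "1 \<le> n" "l + n \<le> m"
    then show "(\<Sum>i=l..<l+n. edist P (U (Suc i)) (U i)) \<le> sqrt C_orth * C_rel * real n powr (1 - \<delta> / 2) * est l (U l)"
      by (intro edist_U_sum reach)
  next
    fix l assume l: "l < m"
    obtain k where k: "last_it R l = enat k" "u (Suc l) 0 = u l k"
      using refine_level[OF reach[of "Suc l"]] l by (metis Suc_leI)
    then have "u (Suc l) 0 = u l (?kk l)" using fin[OF l] by simp
    moreover have "edist P (U (Suc l)) (u l (?kk l)) \<le> edist P (U (Suc l)) (U l) + edist P (U l) (u l (?kk l))"
      using l by (intro edist_triangle[OF P] fe_space_H10[OF U_X] fe_space_H10[OF u_X] reach kk) auto
    ultimately show "edist P (U (Suc l)) (u (Suc l) 0) \<le> edist P (U l) (u l (?kk l)) + edist P (U (Suc l)) (U l)"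
      by simp
  next
    fix l k assume "l \<le> m" "L dvd l" "k < ?kk l"
    then show "edist P (U l) (u l (Suc k)) \<le> q_alg * edist P (U l) (u l k)"
      by (intro solve_contract reach kkD) auto
  next
    fix l k assume a: "l \<le> m" "\<not> L dvd l" "k < ?kk l"
    then have "enat (Suc k) \<le> enat K" using kkD[of l "Suc k"] smooth_level(1)[OF reach a(2)] by auto
    with a show "edist P (U l) (u l (Suc k)) \<le> edist P (U l) (u l k)"
      by (intro smooth_stable reach) auto
  next
    fix l assume a: "l \<le> m" "\<not> L dvd l"
    then show "?kk l \<le> K" using kk[of l] smooth_level(1)[OF reach a(2)] by (auto split: if_splits)
  next
    fix l assume a: "l < m" "L dvd l"
    have "1 \<le> enat (?kk l)" using fin[OF a(1)] solve_level(1)[OF reach a(2)] a by auto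
    then show "1 \<le> ?kk l" by (simp add: one_enat_def)
  next
    fix l k assume a: "l \<le> m" "L dvd l" "Suc k < ?kk l"
    have "enat (Suc k) < enat (?kk l)" using a by simp
    also have "\<dots> \<le> last_it R l" by (rule kk[OF a(1)])
    finally show "est l (U l) \<le> (2 / lam + C_stab) * edist P (U l) (u l k)"
      using a by (intro est_le_if_not_stopped reach)
  next
    fix l assume a: "l < m" "L dvd l"
    then show "est (Suc l) (U (Suc l)) \<le> sqrt (1 - (1 - q_red\<^sup>2) * \<theta>) * est l (U l)
      + C_stab * (2 * edist P (U l) (u l (?kk l)) + edist P (U (Suc l)) (U l))"
      by (intro est_solve_reduction reach fin) auto
  next
    fix l assume "l < m"
    then show "est (Suc l) (U (Suc l)) \<le> est l (U l) + C_stab * edist P (U (Suc l)) (U l)"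
      by (intro est_next reach) auto
  qed (use params L in \<open>auto simp: eta_nonneg\<close>)
qed

lemma quasi_error_R_linear:
  defines "A \<equiv> quasi_error_constants.lin_const q_alg (sqrt (1 - (1 - q_red\<^sup>2) * \<theta>)) C_stab (2 / lam + C_stab)
    (sqrt C_orth * C_rel) C_mon (\<delta> / 2) K L"
  assumes Q: "(l', k') \<in> Qset R" "(l, k) \<in> Qset R" and le: "step_index R l' k' \<le> step_index R l k"
  shows "quasi_error P ud R l k \<le> A * (1 - 1 / A) ^ (step_index R l k - step_index R l' k') * quasi_error P ud R l' k'"
proof -
  have l: "reached R l" "enat k \<le> last_it R l" using Q by (auto simp: Qset_def)
  interpret S: quasi_error_sequence q_alg "sqrt (1 - (1 - q_red\<^sup>2) * \<theta>)" C_stab "2 / lam + C_stab"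
    "sqrt C_orth * C_rel" C_mon "\<delta> / 2" K L l
    "\<lambda>i. if i < l then the_enat (last_it R i) else k"
    "\<lambda>l k. edist P (U l) (u l k)" "\<lambda>l. est l (U l)" "\<lambda>l. edist P (U (Suc l)) (U l)"
    by (rule quasi_error_sequence_run[OF l])
  have lex: "l' < l \<or> l' = l \<and> k' \<le> k" by (rule step_index_le_imp_lex[OF Q le])
  have k': "k' \<le> (if l' < l then the_enat (last_it R l') else k)"
  proof (cases "l' < l")
    case True
    then show ?thesis using Q(1) enat_le_last_it_iff[OF l(1) True] by (simp add: Qset_def)
  qed (use lex in auto)
  have pos: "S.pos i j = step_index R i j" if "(i, j) \<in> Qset R" "i \<le> l" for i j
    using that by (auto simp: S.pos_def step_index_eq iterations_before_def intro!: sum.cong)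
  have "S.h l k \<le> A * (1 - 1 / A) ^ (S.pos l k - S.pos l' k') * S.h l' k'"
    unfolding A_def using lex k' by (intro S.R_linear) auto
  then show ?thesis using pos Q lex by (auto simp: S.h_def quasi_error_def)
qed

end

text \<open>Choosing \<open>C_lin\<close> and \<open>q_lin\<close> before the problem, the degree
  and the run expresses on which quantities they may depend. The approach of \<open>q_lin\<close> to
  one is measured by \<open>1 / (1 - q_lin K L)\<close>.\<close>

theorem theorem8:
  fixes lam \<theta> q_alg C_stab q_red C_rel C_mon C_orth \<delta> :: real
  assumes "lam > 0" and "0 < \<theta>" and "\<theta> \<le> 1" and "0 < q_alg" and "q_alg < 1"
    and "C_stab > 0" and "0 < q_red" and "q_red < 1" and "C_rel > 0" and "C_mon \<ge> 1"
    and "C_orth > 0" and "0 < \<delta>" and "\<delta> \<le> 1"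
  shows "\<exists>C_lin q_lin :: nat \<Rightarrow> nat \<Rightarrow> real.
    (\<forall>K\<ge>1. \<forall>L\<ge>1. C_lin K L > 0 \<and> 0 < q_lin K L \<and> q_lin K L < 1) \<and>
    (\<exists>C c. \<forall>K\<ge>1. \<forall>L\<ge>1. C_lin K L \<le> C * real K * exp (c * real L) \<and>
                         1 / (1 - q_lin K L) \<le> C * real K * exp (c * real L)) \<and>
    (\<forall>(P :: 'n::finite problem) p us ud \<Phi> \<Psi> C_alg K L C_mark C_card u00 R.
       model_problem P \<longrightarrow> p \<ge> 1 \<longrightarrow>
       solves_on P (H10 P) us \<longrightarrow>
       (\<forall>M \<in> meshes P. solves_on P (fe_space P p M) (ud M)) \<longrightarrow>
       stability P p C_stab \<longrightarrow>
       reduction P p q_red \<longrightarrow>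
       reliability P us ud C_rel \<longrightarrow>
       quasi_monotonicity P ud C_mon \<longrightarrow>
       quasi_orthogonality P us C_orth \<delta> \<longrightarrow>
       (\<forall>M \<in> meshes P. \<forall>v \<in> fe_space P p M. \<Phi> M v \<in> fe_space P p M \<and>
          edist P (ud M) (\<Phi> M v) \<le> q_alg * edist P (ud M) v) \<longrightarrow>
       0 < C_alg \<longrightarrow> C_alg \<le> 1 \<longrightarrow>
       (\<forall>M \<in> meshes P. \<forall>v \<in> fe_space P p M. \<Psi> M v \<in> fe_space P p M \<and>
          edist P (ud M) (\<Psi> M v) \<le> C_alg * edist P (ud M) v) \<longrightarrow>
       K \<ge> 1 \<longrightarrow> L \<ge> 1 \<longrightarrow> C_mark \<ge> 1 \<longrightarrow> C_card \<ge> 1 \<longrightarrow>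
       u00 \<in> fe_space P p (T0 P) \<longrightarrow>
       safem P \<Phi> \<Psi> K L \<theta> C_mark C_card lam u00 R \<longrightarrow>
       (\<forall>(l', k') \<in> Qset R. \<forall>(l, k) \<in> Qset R. step_index R l' k' \<le> step_index R l k \<longrightarrow>
          quasi_error P ud R l k
            \<le> C_lin K L * q_lin K L ^ (step_index R l k - step_index R l' k') *
               quasi_error P ud R l' k'))"
proof -
  let ?qt = "sqrt (1 - (1 - q_red\<^sup>2) * \<theta>)"
  have qt: "0 \<le> ?qt" "?qt < 1"
  proof -
    have "(1 - q_red\<^sup>2) * \<theta> \<le> 1 * 1" using assms by (intro mult_mono) (auto simp: power_le_one)
    then show "0 \<le> ?qt" by simp
    have "q_red\<^sup>2 < 1" using assms by (simp add: power_less_one_iff)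
    then have "0 < (1 - q_red\<^sup>2) * \<theta>" using assms by simp
    then show "?qt < 1" by simp
  qed
  interpret C: quasi_error_constants q_alg ?qt C_stab "2 / lam + C_stab" "sqrt C_orth * C_rel" C_mon "\<delta> / 2"
    by unfold_locales (use assms qt in auto)
  show ?thesis
  proof (rule exI[of _ C.lin_const], rule exI[of _ "\<lambda>K L. 1 - 1 / C.lin_const K L"], intro conjI)
    show "\<forall>K\<ge>1. \<forall>L\<ge>1. C.lin_const K L > 0 \<and> 0 < 1 - 1 / C.lin_const K L \<and> 1 - 1 / C.lin_const K L < 1"
    proof (intro allI impI)
      fix K L
      show "C.lin_const K L > 0 \<and> 0 < 1 - 1 / C.lin_const K L \<and> 1 - 1 / C.lin_const K L < 1"
        using C.lin_const_ge_2[of K L] by (simp add: divide_less_eq)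
    qed
    \<comment> \<open>With \<open>q_lin\<close> of this form both growth bounds concern the same
      quantity.\<close>
    have "1 / (1 - (1 - 1 / C.lin_const K L)) = C.lin_const K L" for K L by simp
    then show "\<exists>C c. \<forall>K\<ge>1. \<forall>L\<ge>1. C.lin_const K L \<le> C * real K * exp (c * real L) \<and>
        1 / (1 - (1 - 1 / C.lin_const K L)) \<le> C * real K * exp (c * real L)"
      using C.lin_const_growth by simp
  next
    show "\<forall>(P :: 'n problem) p us ud \<Phi> \<Psi> C_alg K L C_mark C_card u00 R.
       model_problem P \<longrightarrow> p \<ge> 1 \<longrightarrow>
       solves_on P (H10 P) us \<longrightarrow>
       (\<forall>M \<in> meshes P. solves_on P (fe_space P p M) (ud M)) \<longrightarrow>
       stability P p C_stab \<longrightarrow>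
       reduction P p q_red \<longrightarrow>
       reliability P us ud C_rel \<longrightarrow>
       quasi_monotonicity P ud C_mon \<longrightarrow>
       quasi_orthogonality P us C_orth \<delta> \<longrightarrow>
       (\<forall>M \<in> meshes P. \<forall>v \<in> fe_space P p M. \<Phi> M v \<in> fe_space P p M \<and>
          edist P (ud M) (\<Phi> M v) \<le> q_alg * edist P (ud M) v) \<longrightarrow>
       0 < C_alg \<longrightarrow> C_alg \<le> 1 \<longrightarrow>
       (\<forall>M \<in> meshes P. \<forall>v \<in> fe_space P p M. \<Psi> M v \<in> fe_space P p M \<and>
          edist P (ud M) (\<Psi> M v) \<le> C_alg * edist P (ud M) v) \<longrightarrow>
       K \<ge> 1 \<longrightarrow> L \<ge> 1 \<longrightarrow> C_mark \<ge> 1 \<longrightarrow> C_card \<ge> 1 \<longrightarrow>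
       u00 \<in> fe_space P p (T0 P) \<longrightarrow>
       safem P \<Phi> \<Psi> K L \<theta> C_mark C_card lam u00 R \<longrightarrow>
       (\<forall>(l', k') \<in> Qset R. \<forall>(l, k) \<in> Qset R. step_index R l' k' \<le> step_index R l k \<longrightarrow>
          quasi_error P ud R l k
            \<le> C.lin_const K L * (1 - 1 / C.lin_const K L) ^ (step_index R l k - step_index R l' k') *
               quasi_error P ud R l' k')"
    proof (intro allI impI)
      fix P :: "'n problem" and p us ud \<Phi> \<Psi> C_alg K L C_mark C_card u00 R
      assume a: "model_problem P" "solves_on P (H10 P) us"
       "\<forall>M \<in> meshes P. solves_on P (fe_space P p M) (ud M)"
       "stability P p C_stab" "reduction P p q_red" "reliability P us ud C_rel"
       "quasi_monotonicity P ud C_mon" "quasi_orthogonality P us C_orth \<delta>"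
       "\<forall>M \<in> meshes P. \<forall>v \<in> fe_space P p M. \<Phi> M v \<in> fe_space P p M \<and>
          edist P (ud M) (\<Phi> M v) \<le> q_alg * edist P (ud M) v"
       "C_alg \<le> 1"
       "\<forall>M \<in> meshes P. \<forall>v \<in> fe_space P p M. \<Psi> M v \<in> fe_space P p M \<and>
          edist P (ud M) (\<Psi> M v) \<le> C_alg * edist P (ud M) v"
       "L \<ge> 1" "u00 \<in> fe_space P p (T0 P)"
       "safem P \<Phi> \<Psi> K L \<theta> C_mark C_card lam u00 R"
      interpret safem_problem P p us ud \<Phi> \<Psi> C_stab q_red C_rel C_mon C_orth \<delta> q_alg lam \<theta>
        C_alg C_mark C_card K L u00 R
        by unfold_locales (use a assms in blast)+
      show "\<forall>(l', k') \<in> Qset R. \<forall>(l, k) \<in> Qset R. step_index R l' k' \<le> step_index R l k \<longrightarrow>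
          quasi_error P ud R l k
            \<le> C.lin_const K L * (1 - 1 / C.lin_const K L) ^ (step_index R l k - step_index R l' k') *
               quasi_error P ud R l' k'"
        by clarify (rule quasi_error_R_linear)
    qed
  qed
qed

end
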